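(* Let $d\ge 1$ be an integer and let $p$ be a real number with $p>d$. Let $V\in L^1(\mathbb{R}^d)$ be real-valued with $\int_{\mathbb{R}^d}V(x)\,dx>0$. Then $$\lim_{\alpha\to 0+}\alpha^{-\frac{p}{p-d}}\,\lambda(\alpha V)=-\frac{p-d}{p}\left(\frac dp\right)^{\frac{d}{p-d}}\left(\mathcal{S}_{d,p}\int_{\mathbb{R}^d}V(x)\,dx\right)^{\frac{p}{p-d}},$$ where $\mathcal{S}_{d,p}$ is the sharp constant in the Sobolev interpolation inequality $\|u\|_\infty^p\le \mathcal{S}_{d,p}\,\|\nabla u\|_p^d\,\|u\|_p^{p-d}$, $u\in W^{1,p}(\mathbb{R}^d)$.
   Context: For a real-valued function $V$ on $\mathbb{R}^d$ and $u\in W^{1,p}(\mathbb{R}^d)$ set $$Q_V[u]=\int_{\mathbb{R}^d}\left(|\nabla u|^p-V|u|^p\right)dx,\qquad \lambda(V)=\inf_{0\ne u\in W^{1,p}(\mathbb{R}^d)}\frac{Q_V[u]}{\int_{\mathbb{R}^d}|u|^p\,dx}.$$ $\|\cdot\|_q$ denotes the $L^q(\mathbb{R}^d)$ norm. For $p>d$, $\mathcal{S}_{d,p}$ denotes the optimal (smallest possible) constant such that $\|u\|_\infty^p\le \mathcal{S}_{d,p}\,\|\nabla u\|_p^d\,\|u\|_p^{p-d}$ for all $u\in W^{1,p}(\mathbb{R}^d)$. *)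

theory Defs
  imports "HOL-Analysis.Analysis" "HOL-Probability.Essential_Supremum"
begin

text \<open>
  The space $R^d$ is rendered by a type of class \<open>euclidean_space\<close> with \<open>d = DIM('a)\<close> (which is
  at least 1). Functions are representatives of almost-everywhere classes with respect to
  \<open>lebesgue\<close>; elements of Sobolev spaces are real-valued.
\<close>

definition in_Lp :: "real \<Rightarrow> ('a::euclidean_space \<Rightarrow> 'b::euclidean_space) \<Rightarrow> bool" where
  "in_Lp p f \<longleftrightarrow> f \<in> borel_measurable lebesgue \<and> integrable lebesgue (\<lambda>x. norm (f x) powr p)"

definition Lp_norm :: "real \<Rightarrow> ('a::euclidean_space \<Rightarrow> 'b::euclidean_space) \<Rightarrow> real" where
  "Lp_norm p f = (LINT x|lebesgue. norm (f x) powr p) powr (1 / p)"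

definition in_Linf :: "('a::euclidean_space \<Rightarrow> real) \<Rightarrow> bool" where
  "in_Linf u \<longleftrightarrow> u \<in> borel_measurable lebesgue \<and> esssup lebesgue (\<lambda>x. ereal \<bar>u x\<bar>) < \<infinity>"

text \<open>Only meaningful together with \<^const>\<open>in_Linf\<close>, since \<open>real_of_ereal \<infinity> = 0\<close>.\<close>

definition Linf_norm :: "('a::euclidean_space \<Rightarrow> real) \<Rightarrow> real" where
  "Linf_norm u = real_of_ereal (esssup lebesgue (\<lambda>x. ereal \<bar>u x\<bar>))"

definition locally_integrable :: "('a::euclidean_space \<Rightarrow> 'b::euclidean_space) \<Rightarrow> bool" where
  "locally_integrable f \<longleftrightarrow> (\<forall>K. compact K \<longrightarrow> set_integrable lebesgue K f)"

primrec C_k :: "nat \<Rightarrow> ('a::euclidean_space \<Rightarrow> real) \<Rightarrow> bool" where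
  "C_k 0 f \<longleftrightarrow> continuous_on UNIV f"
| "C_k (Suc k) f \<longleftrightarrow> (\<forall>x. f differentiable at x) \<and>
     (\<forall>b\<in>Basis. C_k k (\<lambda>x. frechet_derivative f (at x) b))"

definition test_function :: "('a::euclidean_space \<Rightarrow> real) \<Rightarrow> bool" where
  "test_function \<phi> \<longleftrightarrow> (\<forall>k. C_k k \<phi>) \<and> compact (closure {x. \<phi> x \<noteq> 0})"

definition has_weak_gradient ::
    "('a::euclidean_space \<Rightarrow> real) \<Rightarrow> ('a \<Rightarrow> 'a) \<Rightarrow> bool" where
  "has_weak_gradient u g \<longleftrightarrow> locally_integrable u \<and> locally_integrable g \<and>
     (\<forall>\<phi>. test_function \<phi> \<longrightarrow> (\<forall>b\<in>Basis.
        (LINT x|lebesgue. u x * frechet_derivative \<phi> (at x) b)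
          = - (LINT x|lebesgue. (g x \<bullet> b) * \<phi> x)))"

text \<open>The weak gradient is unique up to null sets, so the integrals of it used below do not
  depend on the representative that is chosen.\<close>

definition weak_gradient :: "('a::euclidean_space \<Rightarrow> real) \<Rightarrow> 'a \<Rightarrow> 'a" where
  "weak_gradient u = (SOME g. has_weak_gradient u g)"

definition W1p :: "real \<Rightarrow> ('a::euclidean_space \<Rightarrow> real) set" where
  "W1p p = {u. in_Lp p u \<and> (\<exists>g. has_weak_gradient u g \<and> in_Lp p g)}"

definition Q_form :: "real \<Rightarrow> ('a::euclidean_space \<Rightarrow> real) \<Rightarrow> ('a \<Rightarrow> real) \<Rightarrow> real" where
  "Q_form p V u =
     (LINT x|lebesgue. norm (weak_gradient u x) powr p - V x * \<bar>u x\<bar> powr p)"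

text \<open>The infimum is taken in the reals. For integrable \<open>V\<close> and \<open>p > d\<close>, as in the theorem, the
  set is nonempty and bounded below, and the integrand of \<^const>\<open>Q_form\<close> is integrable because
  functions in \<^term>\<open>W1p p\<close> are essentially bounded.\<close>

definition lambda_inf :: "real \<Rightarrow> ('a::euclidean_space \<Rightarrow> real) \<Rightarrow> real" where
  "lambda_inf p V =
     Inf {Q_form p V u / (LINT x|lebesgue. \<bar>u x\<bar> powr p) | u.
            u \<in> W1p p \<and> \<not> (AE x in lebesgue. u x = 0)}"

definition sobolev_bound :: "'a::euclidean_space itself \<Rightarrow> real \<Rightarrow> real \<Rightarrow> bool" where
  "sobolev_bound _ p C \<longleftrightarrow> (\<forall>u::'a \<Rightarrow> real. u \<in> W1p p \<longrightarrow> in_Linf u \<and>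
     Linf_norm u powr p
       \<le> C * Lp_norm p (weak_gradient u) ^ DIM('a) * Lp_norm p u powr (p - real DIM('a)))"

definition sobolev_const :: "'a::euclidean_space itself \<Rightarrow> real \<Rightarrow> real" where
  "sobolev_const T p = Inf {C. sobolev_bound T p C}"

end

theory Submission imports Defs begin

text \<open>
  Write \<open>d\<close> for the dimension, \<open>\<theta> = d / p < 1\<close>, \<open>I = \<integral>V > 0\<close> and \<open>S\<close> for the sharp Sobolev constant. For a
  function \<open>u\<close> let \<open>A = \<integral>|\<nabla>u|^p\<close>, \<open>B = \<integral>|u|^p\<close>, so that the Sobolev inequality reads
  \<open>sup |u|^p \<le> S A^\<theta> B^(1-\<theta>)\<close>. At weak coupling \<open>\<alpha>\<close> a competitor for \<open>\<lambda>(\<alpha>V)\<close> can only pay off if it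
  spreads over a large length; on that length \<open>V\<close> looks like the point mass \<open>I \<delta>\<close>, so the Rayleigh
  quotient behaves like \<open>(A - \<alpha> I sup |u|^p) / B\<close>. By the Sobolev inequality and with \<open>t = A / B\<close>
  this is at least \<open>t - \<alpha> I S t^\<theta>\<close>, with equality for an optimiser. The minimum of
  \<open>t - K t^\<theta>\<close> over \<open>t > 0\<close> is \<open>-(1-\<theta>) \<theta>^(\<theta>/(1-\<theta>)) K^(1/(1-\<theta>))\<close>, and \<open>1/(1-\<theta>) = p/(p-d)\<close>; with
  \<open>K = \<alpha> I S\<close> this gives both the power of \<open>\<alpha>\<close> and the constant of the theorem.

  Two facts make this rigorous. The lower bound (\<open>lambda_liminf\<close>) needs the point mass approximation
  with an error that is controlled by the energy, uniformly in \<open>u\<close>: for every \<open>\<epsilon> > 0\<close>,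
  \<open>\<integral>V|u|^p \<le> (I + \<epsilon>) S A^\<theta> B^(1-\<theta>) + K A\<close> (\<open>potential_term_upper_bound\<close>), and \<open>\<alpha> K A\<close> is negligible
  against \<open>A\<close> as \<open>\<alpha>\<close> tends to 0. This follows from Morrey's inequality, which bounds the oscillation
  of \<open>u\<close> on a ball by its energy. The upper bound (\<open>lambda_limsup\<close>) takes a function that is almost
  optimal in the Sobolev inequality, recentres it at a point where it is almost maximal, and dilates
  it by a length proportional to \<open>\<alpha>^(-1/(p-d))\<close>.

  Morrey's inequality for weakly differentiable functions is derived without smoothing \<open>u\<close>. For a
  smooth kernel \<open>\<kappa>\<close> with integral 1 the averages \<open>F(s) = \<integral>u(z) s^d \<kappa>(s(z - x)) dz\<close> can be
  differentiated in \<open>s\<close>, and the derivative of the kernel is a divergence in \<open>z\<close>. Hence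
  \<open>F'(s)\<close> is an integral of \<open>\<nabla>u\<close> against a test field, and Hoelder's inequality bounds it by a multiple
  of \<open>A^(1/p) s^(-1-(1-\<theta>))\<close>, which is integrable at infinity because \<open>p > d\<close>. So the averages converge
  uniformly in \<open>x\<close>, with a rate, to a continuous function (\<open>kernel_average_limit\<close>), which is a version of
  \<open>u\<close> (\<open>limit_of_averages_AE_eq\<close>). Comparing the averages of one kernel and of its translates gives the
  oscillation estimate (\<open>Morrey\<close>).
\<close>

section \<open>Smooth functions with compact support\<close>

abbreviation partial_deriv :: "('a::euclidean_space \<Rightarrow> real) \<Rightarrow> 'a \<Rightarrow> 'a \<Rightarrow> real" where
  "partial_deriv f b x \<equiv> frechet_derivative f (at x) b"

text \<open>
  Smoothness of all orders by coinduction: it suffices to exhibit a family of functions that is closed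
  under taking partial derivatives.
\<close>

lemma C_k_closed_under_partials:
  assumes "\<And>f. f \<in> F \<Longrightarrow> \<exists>D. (\<forall>x. (f has_derivative D x) (at x)) \<and> (\<forall>b\<in>Basis. (\<lambda>x. D x b) \<in> F)"
    and "f \<in> F"
  shows "C_k k f"
  using assms(2)
proof (induction k arbitrary: f)
  case 0
  then show ?case
    using assms(1)[OF 0]
    by (auto intro: continuous_at_imp_continuous_on has_derivative_continuous)
next
  case (Suc k)
  then obtain D where D: "\<And>x. (f has_derivative D x) (at x)" "\<And>b. b \<in> Basis \<Longrightarrow> (\<lambda>x. D x b) \<in> F"
    using assms(1) by metis
  have "frechet_derivative f (at x) = D x" for x
    using D(1) frechet_derivative_at by metis
  with D Suc.IH show ?case
    by (auto simp: differentiable_def)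
qed

lemma C_k_continuous: "C_k k f \<Longrightarrow> continuous_on UNIV f"
  by (cases k) (auto simp: continuous_at_imp_continuous_on differentiable_imp_continuous_within)

lemma C_k_pred: "C_k (Suc k) f \<Longrightarrow> C_k k f"
proof (induction k arbitrary: f)
  case 0
  then show ?case using C_k_continuous[OF 0] by simp
next
  case (Suc k)
  then show ?case by (metis C_k.simps(2))
qed

lemma C_k_const: "C_k k (\<lambda>x. c)"
  by (rule C_k_closed_under_partials[where F="range (\<lambda>c x. c)"])
     (auto intro!: exI[of _ "\<lambda>_ _. 0"])

lemma C_k_inner: "C_k k (\<lambda>x. x \<bullet> v)"
proof (rule C_k_closed_under_partials[where F="insert (\<lambda>x. x \<bullet> v) (range (\<lambda>c x. c))"])
  fix f assume "f \<in> insert (\<lambda>x. x \<bullet> v) (range (\<lambda>c x. c))"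
  then consider "f = (\<lambda>x. x \<bullet> v)" | c where "f = (\<lambda>x. c)" by blast
  then show "\<exists>D. (\<forall>x. (f has_derivative D x) (at x)) \<and> (\<forall>b\<in>Basis. (\<lambda>x. D x b) \<in> insert (\<lambda>x. x \<bullet> v) (range (\<lambda>c x. c)))"
  proof cases
    case 1
    then show ?thesis by (intro exI[of _ "\<lambda>_ h. h \<bullet> v"]) (auto intro!: derivative_eq_intros)
  next
    case 2
    then show ?thesis by (intro exI[of _ "\<lambda>_ _. 0"]) auto
  qed
qed simp

lemma C_k_add: "C_k k f \<Longrightarrow> C_k k g \<Longrightarrow> C_k k (\<lambda>x. f x + g x)"
proof (induction k arbitrary: f g)
  case 0
  then show ?case by (auto intro: continuous_intros)
next
  case (Suc k)
  have "partial_deriv (\<lambda>x. f x + g x) b x = partial_deriv f b x + partial_deriv g b x" for b x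
  proof -
    have "f differentiable at x" "g differentiable at x" using Suc.prems by auto
    from this[THEN frechet_derivative_works[THEN iffD1]]
    have "((\<lambda>x. f x + g x) has_derivative
        (\<lambda>h. frechet_derivative f (at x) h + frechet_derivative g (at x) h)) (at x)"
      by (rule has_derivative_add)
    from frechet_derivative_at[OF this] show ?thesis by (simp add: fun_eq_iff)
  qed
  then show ?case using Suc by auto
qed

lemma partial_deriv_mult:
  assumes "f differentiable at x" "g differentiable at x"
  shows "partial_deriv (\<lambda>x. f x * g x) b x = f x * partial_deriv g b x + partial_deriv f b x * g x"
proof -
  from assms[THEN frechet_derivative_works[THEN iffD1]]
  have "((\<lambda>x. f x * g x) has_derivative
      (\<lambda>h. f x * frechet_derivative g (at x) h + frechet_derivative f (at x) h * g x)) (at x)"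
    by (rule has_derivative_mult)
  from frechet_derivative_at[OF this] show ?thesis by (simp add: fun_eq_iff)
qed

lemma C_k_mult: "C_k k f \<Longrightarrow> C_k k g \<Longrightarrow> C_k k (\<lambda>x. f x * g x)"
proof (induction k arbitrary: f g)
  case 0
  then show ?case by (auto intro: continuous_intros)
next
  case (Suc k)
  have pd: "partial_deriv (\<lambda>x. f x * g x) b x = f x * partial_deriv g b x + partial_deriv f b x * g x"
    for b x
    using Suc.prems by (intro partial_deriv_mult) auto
  have "C_k k (\<lambda>x. f x * partial_deriv g b x + partial_deriv f b x * g x)" if "b \<in> Basis" for b
    using Suc.prems that C_k_pred[OF Suc.prems(1)] C_k_pred[OF Suc.prems(2)]
    by (intro C_k_add Suc.IH) auto
  then show ?case using Suc.prems by (auto simp: pd)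
qed

lemma C_k_prod: "(\<And>i. i \<in> I \<Longrightarrow> C_k k (f i)) \<Longrightarrow> C_k k (\<lambda>x. \<Prod>i\<in>I. f i x)"
  by (induction I rule: infinite_finite_induct) (auto intro!: C_k_const C_k_mult)

lemma has_derivative_scaled:
  fixes f :: "'a::real_normed_vector \<Rightarrow> 'b::real_normed_vector"
  assumes "f differentiable at (c *\<^sub>R (x - a))"
  shows "((\<lambda>x. f (c *\<^sub>R (x - a))) has_derivative
           (\<lambda>h. c *\<^sub>R frechet_derivative f (at (c *\<^sub>R (x - a))) h)) (at x)"
proof -
  define f' where "f' = frechet_derivative f (at (c *\<^sub>R (x - a)))"
  have f': "(f has_derivative f') (at (c *\<^sub>R (x - a)))"
    using assms frechet_derivative_works f'_def by blast
  have lin: "f' (c *\<^sub>R h) = c *\<^sub>R f' h" for h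
    using f' has_derivative_linear linear_cmul by blast
  have "((\<lambda>x. f (c *\<^sub>R (x - a))) has_derivative (\<lambda>h. f' (c *\<^sub>R h))) (at x)"
    by (rule has_derivative_compose[of "\<lambda>x. c *\<^sub>R (x - a)" "\<lambda>h. c *\<^sub>R h" x UNIV f f'])
       (auto intro!: derivative_eq_intros f')
  then show ?thesis by (simp add: lin f'_def[symmetric])
qed

lemma partial_deriv_scaled:
  fixes f :: "'a::euclidean_space \<Rightarrow> real"
  assumes "f differentiable at (c *\<^sub>R (x - a))"
  shows "partial_deriv (\<lambda>x. f (c *\<^sub>R (x - a))) b x = c * partial_deriv f b (c *\<^sub>R (x - a))"
  using frechet_derivative_at[OF has_derivative_scaled[OF assms]] by (metis real_scaleR_def)

lemma C_k_scaled: "C_k k f \<Longrightarrow> C_k k (\<lambda>x. f (c *\<^sub>R (x - a)))"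
proof (induction k arbitrary: f)
  case 0
  then show ?case by (auto intro!: continuous_intros continuous_on_compose2[of UNIV f])
next
  case (Suc k)
  have *: "partial_deriv (\<lambda>x. f (c *\<^sub>R (x - a))) b x = c * partial_deriv f b (c *\<^sub>R (x - a))" for b x
    using Suc.prems by (intro partial_deriv_scaled) simp
  have "(\<lambda>x. f (c *\<^sub>R (x - a))) differentiable at x" for x
    using has_derivative_scaled Suc.prems unfolding differentiable_def[of "(\<lambda>x. f (c *\<^sub>R (x - a)))"] by force
  moreover have "C_k k (\<lambda>x. c * partial_deriv f b (c *\<^sub>R (x - a)))" if "b \<in> Basis" for b
    using Suc.prems Suc.IH[of "partial_deriv f b"] that by (intro C_k_mult C_k_const) auto
  ultimately show ?case unfolding C_k.simps * by blast
qed

text \<open>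
  The functions \<open>P(1/t) exp(-1/t)\<close>, extended by 0 to \<open>t \<le> 0\<close>. Admitting all polynomials \<open>P\<close> makes the family
  closed under differentiation, so that every member is smooth, including at 0.
\<close>

definition poly_exp_recip :: "real poly \<Rightarrow> real \<Rightarrow> real" where
  "poly_exp_recip P t = (if t \<le> 0 then 0 else poly P (1 / t) * exp (- (1 / t)))"

lemma poly_times_exp_minus_tendsto_0:
  "((\<lambda>y::real. poly P y * exp (- y)) \<longlongrightarrow> 0) at_top"
proof -
  have "((\<lambda>y::real. \<Sum>i\<le>degree P. coeff P i * (y ^ i / exp y)) \<longlongrightarrow> (\<Sum>i\<le>degree P. coeff P i * 0)) at_top"
    by (intro tendsto_intros tendsto_power_div_exp_0)
  then show ?thesis
    by (simp add: poly_altdef exp_minus divide_inverse sum_distrib_right mult.assoc)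
qed

lemma poly_exp_recip_has_derivative:
  "(poly_exp_recip P has_real_derivative
      poly_exp_recip ([:0, 0, 1:] * (P - pderiv P)) t) (at t)"
proof (cases t "0::real" rule: linorder_cases)
  case less
  have "\<forall>\<^sub>F x in nhds t. poly_exp_recip P x = 0"
    using less by (auto simp: poly_exp_recip_def intro!: eventually_mono[OF order_tendstoD(2)[OF tendsto_ident_at[of t UNIV]]] simp: eventually_nhds_conv_at)
  moreover have "((\<lambda>_. 0) has_real_derivative poly_exp_recip ([:0, 0, 1:] * (P - pderiv P)) t) (at t)"
    using less by (simp add: poly_exp_recip_def)
  ultimately show ?thesis by (subst DERIV_cong_ev[OF refl _ refl])
next
  case greater
  have "\<forall>\<^sub>F x in nhds t. poly_exp_recip P x = poly P (1 / x) * exp (- (1 / x))"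
    using greater by (auto simp: poly_exp_recip_def intro!: eventually_mono[OF order_tendstoD(1)[OF tendsto_ident_at[of t UNIV]]] simp: eventually_nhds_conv_at)
  moreover have "((\<lambda>x. poly P (1 / x) * exp (- (1 / x))) has_real_derivative
      poly_exp_recip ([:0, 0, 1:] * (P - pderiv P)) t) (at t)"
    using greater
    by (auto intro!: derivative_eq_intros simp: poly_exp_recip_def field_simps power2_eq_square)
  ultimately show ?thesis by (subst DERIV_cong_ev[OF refl _ refl])
next
  case equal
  have "((\<lambda>y. poly_exp_recip P y / y) \<longlongrightarrow> 0) (at_right 0)"
  proof -
    have "((\<lambda>y. poly ([:0, 1:] * P) (inverse y) * exp (- inverse y)) \<longlongrightarrow> 0) (at_right 0)"
      by (rule filterlim_compose[OF poly_times_exp_minus_tendsto_0 filterlim_inverse_at_top_right])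
    moreover have "\<forall>\<^sub>F y in at_right 0. poly ([:0, 1:] * P) (inverse y) * exp (- inverse y) = poly_exp_recip P y / y"
      by (auto simp: eventually_at_filter poly_exp_recip_def divide_inverse)
    ultimately show ?thesis by (rule Lim_transform_eventually)
  qed
  moreover have "((\<lambda>y. poly_exp_recip P y / y) \<longlongrightarrow> 0) (at_left 0)"
    by (rule Lim_transform_eventually[of "\<lambda>_. 0"]) (auto simp: eventually_at_filter poly_exp_recip_def)
  ultimately have "((\<lambda>y. poly_exp_recip P y / y) \<longlongrightarrow> 0) (at 0)"
    by (simp add: filterlim_at_split)
  then show ?thesis using equal by (simp add: has_field_derivative_iff poly_exp_recip_def)
qed

lemma C_k_poly_exp_recip_affine: "C_k k (\<lambda>x. poly_exp_recip P (x \<bullet> v + c))"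
proof (rule C_k_closed_under_partials[where F="{\<lambda>x. e * poly_exp_recip P (x \<bullet> v + c) | P e. True}"])
  fix f assume "f \<in> {\<lambda>x. e * poly_exp_recip P (x \<bullet> v + c) | P e. True}"
  then obtain P e where f: "f = (\<lambda>x. e * poly_exp_recip P (x \<bullet> v + c))" by blast
  define P' where "P' = [:0, 0, 1:] * (P - pderiv P)"
  have "(f has_derivative (\<lambda>h. (e * (h \<bullet> v)) * poly_exp_recip P' (x \<bullet> v + c))) (at x)" for x
  proof -
    have "((\<lambda>x. poly_exp_recip P (x \<bullet> v + c)) has_derivative (\<lambda>h. poly_exp_recip P' (x \<bullet> v + c) * (h \<bullet> v))) (at x)"
    proof (rule has_derivative_compose[where f="\<lambda>x. x \<bullet> v + c" and f'="\<lambda>h. h \<bullet> v" and g="poly_exp_recip P"])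
      show "((\<lambda>x. x \<bullet> v + c) has_derivative (\<lambda>h. h \<bullet> v)) (at x)"
        by (auto intro!: derivative_eq_intros)
      show "(poly_exp_recip P has_derivative (*) (poly_exp_recip P' (x \<bullet> v + c))) (at (x \<bullet> v + c))"
        unfolding P'_def by (rule poly_exp_recip_has_derivative[unfolded has_field_derivative_def])
    qed
    from has_derivative_mult_right[OF this, of e] show ?thesis
      by (simp add: f mult_ac)
  qed
  then show "\<exists>D. (\<forall>x. (f has_derivative D x) (at x)) \<and> (\<forall>b\<in>Basis. (\<lambda>x. D x b) \<in> {\<lambda>x. e * poly_exp_recip P (x \<bullet> v + c) | P e. True})"
    by (intro exI[of _ "\<lambda>x h. (e * (h \<bullet> v)) * poly_exp_recip P' (x \<bullet> v + c)"]) blast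
qed (force intro: exI[of _ 1])

text \<open>
  Smooth functions supported in a box that increase to its indicator: the factor
  \<open>exp(-1/((n+1) t))\<close> tends to 1 for \<open>t > 0\<close>.
\<close>

definition box_bump :: "'a::euclidean_space \<Rightarrow> 'a \<Rightarrow> nat \<Rightarrow> 'a \<Rightarrow> real" where
  "box_bump a b n x = (\<Prod>i\<in>Basis. poly_exp_recip 1 (real (Suc n) * (x \<bullet> i - a \<bullet> i))
                                  * poly_exp_recip 1 (real (Suc n) * (b \<bullet> i - x \<bullet> i)))"

lemma poly_exp_recip_1_bounds: "0 \<le> poly_exp_recip 1 t" "poly_exp_recip 1 t \<le> 1"
  "0 < t \<Longrightarrow> 0 < poly_exp_recip 1 t"
  by (auto simp: poly_exp_recip_def)

lemma box_bump_bounds: "0 \<le> box_bump a b n x" "box_bump a b n x \<le> 1"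
  unfolding box_bump_def
  by (auto intro!: prod_nonneg prod_le_1 mult_nonneg_nonneg mult_le_one simp: poly_exp_recip_1_bounds)

lemma box_bump_pos: "x \<in> box a b \<Longrightarrow> 0 < box_bump a b n x"
  unfolding box_bump_def by (intro prod_pos) (auto simp: mem_box poly_exp_recip_1_bounds)

lemma box_bump_outside: "x \<notin> box a b \<Longrightarrow> box_bump a b n x = 0"
  unfolding box_bump_def
  by (auto simp: mem_box poly_exp_recip_def not_less mult_le_0_iff)

lemma box_bump_tendsto_indicator:
  "(\<lambda>n. box_bump a b n x) \<longlonglongrightarrow> indicator (box a b) x"
proof (cases "x \<in> box a b")
  case True
  have *: "(\<lambda>n. poly_exp_recip 1 (real (Suc n) * t)) \<longlonglongrightarrow> 1" if "t > 0" for t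
  proof -
    have "(\<lambda>n. inverse (real (Suc n)) * inverse t) \<longlonglongrightarrow> 0 * inverse t"
      by (intro tendsto_intros LIMSEQ_inverse_real_of_nat)
    then have "(\<lambda>n. exp (- (inverse (real (Suc n)) * inverse t))) \<longlonglongrightarrow> exp (- 0)"
      by (intro tendsto_intros) simp
    then show ?thesis using that by (simp add: poly_exp_recip_def divide_inverse mult_le_0_iff)
  qed
  have "(\<lambda>n. box_bump a b n x) \<longlonglongrightarrow> (\<Prod>i\<in>(Basis::'a set). 1 * 1)"
    unfolding box_bump_def using True by (intro tendsto_intros *) (auto simp: mem_box)
  then show ?thesis using True by simp
qed (simp add: box_bump_outside)

lemma test_function_box_bump: "test_function (box_bump a b n)"
proof -
  have "C_k k (box_bump a b n)" for k
  proof -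
    have eq: "box_bump a b n = (\<lambda>x. \<Prod>i\<in>Basis. 
        poly_exp_recip 1 (x \<bullet> (real (Suc n) *\<^sub>R i) + (- real (Suc n) * (a \<bullet> i)))
      * poly_exp_recip 1 (x \<bullet> (- real (Suc n) *\<^sub>R i) + real (Suc n) * (b \<bullet> i)))"
      unfolding box_bump_def by (simp add: algebra_simps)
    show ?thesis unfolding eq by (intro C_k_prod C_k_mult C_k_poly_exp_recip_affine)
  qed
  moreover have "{x. box_bump a b n x \<noteq> 0} \<subseteq> cbox a b"
    using box_bump_outside box_subset_cbox by blast
  then have "compact (closure {x. box_bump a b n x \<noteq> 0})"
    by (meson bounded_cbox bounded_subset compact_closure)
  ultimately show ?thesis by (simp add: test_function_def)
qed

lemma test_function_alt:
  "test_function f \<longleftrightarrow> (\<forall>k. C_k k f) \<and> (\<exists>R. \<forall>x. norm x > R \<longrightarrow> f x = 0)"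
  unfolding test_function_def compact_closure bounded_iff
  by (auto) (metis linorder_not_le)+

lemma test_functionD:
  assumes "test_function f"
  shows "C_k k f" "f differentiable at x" "continuous_on A f" "f \<in> borel_measurable borel"
    and "f \<in> borel_measurable lebesgue"
proof -
  show "C_k k f" for k using assms by (simp add: test_function_def)
  from this[of "Suc 0"] show "f differentiable at x" by simp
  show c: "continuous_on A f" for A
    using C_k_continuous[OF \<open>C_k 0 f\<close>] continuous_on_subset by blast
  show *: "f \<in> borel_measurable borel" by (intro borel_measurable_continuous_onI c)
  then show "f \<in> borel_measurable lebesgue"
    by (simp add: measurable_completion)
qed

lemma test_function_support:
  assumes "test_function f"
  obtains R where "R > 0" "\<And>x. norm x > R \<Longrightarrow> f x = 0"
proof -
  obtain R where "\<forall>x. norm x > R \<longrightarrow> f x = 0" using assms test_function_alt by blast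
  then show ?thesis using that[of "max R 1"] by auto
qed

lemma test_function_bounded:
  assumes "test_function f"
  obtains M where "M > 0" "\<And>x. \<bar>f x\<bar> \<le> M"
proof -
  obtain R where R: "R > 0" "\<And>x. norm x > R \<Longrightarrow> f x = 0"
    using test_function_support[OF assms] by blast
  have "compact (f ` cball 0 R)"
    by (intro compact_continuous_image test_functionD[OF assms] compact_cball)
  then have "bounded (f ` cball 0 R)" by (rule compact_imp_bounded)
  then obtain M where M: "\<And>x. norm x \<le> R \<Longrightarrow> \<bar>f x\<bar> \<le> M"
    unfolding bounded_iff by (metis image_eqI mem_cball_0 real_norm_def)
  have "\<bar>f x\<bar> \<le> max M 1" for x
    using M[of x] R(2)[of x] by (cases "norm x \<le> R") auto
  then show ?thesis using that[of "max M 1"] by auto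
qed

lemma test_function_mult: 
  assumes "test_function f" "\<And>k. C_k k g" shows "test_function (\<lambda>x. f x * g x)" 
  using assms unfolding test_function_alt by (auto intro!: C_k_mult)

lemma test_function_partial_deriv:
  assumes "test_function f" "b \<in> Basis"
  shows "test_function (partial_deriv f b)"
proof -
  have "C_k k (partial_deriv f b)" for k
    using test_functionD(1)[OF assms(1), of "Suc k"] assms(2) by simp
  moreover obtain R where R: "R > 0" "\<And>x. norm x > R \<Longrightarrow> f x = 0"
    using test_function_support[OF assms(1)] by blast
  have "partial_deriv f b x = 0" if "norm x > R" for x
  proof -
    have "open {x::'a. norm x > R}" by (simp add: open_Collect_less continuous_on_norm_id)
    then have "(f has_derivative (\<lambda>_. 0)) (at x)"
      by (rule has_derivative_transform_within_open[OF has_derivative_const[of 0 "at x"]])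
         (simp_all add: that R(2))
    then show ?thesis using frechet_derivative_at by metis
  qed
  ultimately show ?thesis unfolding test_function_alt by blast
qed

lemma test_function_scaled:
  assumes "test_function f" "c > 0"
  shows "test_function (\<lambda>x. f (c *\<^sub>R (x - a)))"
proof -
  obtain R where R: "R > 0" "\<And>x. norm x > R \<Longrightarrow> f x = 0"
    using test_function_support[OF assms(1)] by blast
  have "f (c *\<^sub>R (x - a)) = 0" if "norm x > norm a + R / c" for x
  proof (rule R(2))
    have "R / c < norm (x - a)" using that norm_triangle_ineq2[of x a] by linarith
    then show "R < norm (c *\<^sub>R (x - a))"
      using assms(2) by (simp add: pos_divide_less_eq mult.commute del: scaleR_diff_right)
  qed
  then show ?thesis using C_k_scaled test_functionD[OF assms(1)] unfolding test_function_alt by blast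
qed

section \<open>Change of variables and locally integrable functions\<close>

lemma
  fixes a :: "'a::euclidean_space"
  assumes "c \<noteq> 0"
  shows scale_measurable_lebesgue: "(\<lambda>x. c *\<^sub>R (x - a)) \<in> lebesgue \<rightarrow>\<^sub>M lebesgue"
    and lebesgue_eq_density_scale:
      "lebesgue = density (distr lebesgue lebesgue (\<lambda>x. c *\<^sub>R (x - a))) (\<lambda>_. ennreal (\<bar>c\<bar> ^ DIM('a)))"
proof -
  have eq: "(\<lambda>x. - c *\<^sub>R a + (\<Sum>j\<in>Basis. (c * (x \<bullet> j)) *\<^sub>R j)) = (\<lambda>x. c *\<^sub>R (x - a))"
    unfolding scaleR_scaleR[symmetric] scaleR_sum_right[symmetric] euclidean_representation
    by (simp add: algebra_simps)
  show "(\<lambda>x. c *\<^sub>R (x - a)) \<in> lebesgue \<rightarrow>\<^sub>M lebesgue"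
    using lebesgue_affine_measurable[of "\<lambda>_. c" "- c *\<^sub>R a"] assms unfolding eq by simp
  show "lebesgue = density (distr lebesgue lebesgue (\<lambda>x. c *\<^sub>R (x - a))) (\<lambda>_. ennreal (\<bar>c\<bar> ^ DIM('a)))"
    using lebesgue_affine_euclidean[of "\<lambda>_. c" "- c *\<^sub>R a"] assms unfolding eq by simp
qed

lemma unscale: "c \<noteq> 0 \<Longrightarrow> (1 / c) *\<^sub>R (c *\<^sub>R (x - a) - (- c *\<^sub>R a)) = (x::'a::real_vector)"
  by (simp add: algebra_simps)

lemma rescale: "c \<noteq> 0 \<Longrightarrow> c *\<^sub>R ((1 / c) *\<^sub>R (x - (- c *\<^sub>R a)) - a) = (x::'a::real_vector)"
  by (simp add: algebra_simps)

lemma borel_measurable_scaled: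
  fixes f :: "'a::euclidean_space \<Rightarrow> 'b::euclidean_space"
  assumes "c \<noteq> 0" "f \<in> borel_measurable lebesgue"
  shows "(\<lambda>x. f (c *\<^sub>R (x - a))) \<in> borel_measurable lebesgue"
  using measurable_comp[OF scale_measurable_lebesgue[OF assms(1)] assms(2)] by (simp add: comp_def)

lemma integrable_scaled:
  fixes f :: "'a::euclidean_space \<Rightarrow> 'b::euclidean_space"
  assumes "c \<noteq> 0" "integrable lebesgue f"
  shows "integrable lebesgue (\<lambda>x. f (c *\<^sub>R (x - a)))"
proof -
  note [measurable] = scale_measurable_lebesgue[OF assms(1), of a] borel_measurable_integrable[OF assms(2)]
  have "integrable (density (distr lebesgue lebesgue (\<lambda>x. c *\<^sub>R (x - a))) (\<lambda>_. ennreal (\<bar>c\<bar> ^ DIM('a)))) f"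
    using assms(2) lebesgue_eq_density_scale[OF assms(1), of a] by simp
  then have "integrable lebesgue (\<lambda>x. \<bar>c\<bar> ^ DIM('a) *\<^sub>R f (c *\<^sub>R (x - a)))"
    using assms(1) by (simp add: integrable_density integrable_distr_eq)
  from integrable_scaleR_right[OF this, of "1 / \<bar>c\<bar> ^ DIM('a)"]
  show ?thesis using assms(1) by simp
qed

lemma integrable_scaled_iff:
  fixes f :: "'a::euclidean_space \<Rightarrow> 'b::euclidean_space"
  assumes "c \<noteq> 0"
  shows "integrable lebesgue (\<lambda>x. f (c *\<^sub>R (x - a))) \<longleftrightarrow> integrable lebesgue f"
proof
  assume "integrable lebesgue (\<lambda>x. f (c *\<^sub>R (x - a)))"
  from integrable_scaled[OF _ this, of "1/c" "- c *\<^sub>R a"]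
  show "integrable lebesgue f" using assms rescale[of c _ a] by simp
qed (rule integrable_scaled[OF assms])

text \<open>
  The factor \<open>c\<close> may be negative, which covers reflections.
\<close>

lemma integral_scaled:
  fixes f :: "'a::euclidean_space \<Rightarrow> 'b::euclidean_space"
  assumes "c \<noteq> 0"
  shows "(LINT x|lebesgue. f (c *\<^sub>R (x - a))) = (1 / \<bar>c\<bar> ^ DIM('a)) *\<^sub>R (LINT x|lebesgue. f x)"
proof (cases "integrable lebesgue f")
  case True
  note [measurable] = scale_measurable_lebesgue[OF assms(1), of a] borel_measurable_integrable[OF True]
  have "integral\<^sup>L lebesgue f
      = integral\<^sup>L (density (distr lebesgue lebesgue (\<lambda>x. c *\<^sub>R (x - a))) (\<lambda>_. ennreal (\<bar>c\<bar> ^ DIM('a)))) f"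
    using lebesgue_eq_density_scale[OF assms(1), of a] by simp
  also have "\<dots> = \<bar>c\<bar> ^ DIM('a) *\<^sub>R (LINT x|lebesgue. f (c *\<^sub>R (x - a)))"
    using assms by (simp add: integral_density integral_distr)
  finally show ?thesis using assms by simp
next
  case False
  then have "\<not> integrable lebesgue (\<lambda>x. f (c *\<^sub>R (x - a)))"
    using integrable_scaled_iff[OF assms] by blast
  with False show ?thesis by (metis not_integrable_integral_eq scaleR_zero_right)
qed

lemma AE_scaled:
  fixes P :: "'a::euclidean_space \<Rightarrow> bool"
  assumes "c \<noteq> 0" "AE x in lebesgue. P x"
  shows "AE x in lebesgue. P (c *\<^sub>R (x - a))"
proof -
  have "AE x in density (distr lebesgue lebesgue (\<lambda>x. c *\<^sub>R (x - a))) (\<lambda>_. ennreal (\<bar>c\<bar> ^ DIM('a))). P x"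
    by (subst lebesgue_eq_density_scale[OF assms(1), of a, symmetric]) (rule assms(2))
  then have "AE x in distr lebesgue lebesgue (\<lambda>x. c *\<^sub>R (x - a)). P x"
    using assms(1) by (simp add: AE_density)
  then show ?thesis by (rule AE_distrD[OF scale_measurable_lebesgue[OF assms(1)]])
qed

lemma integrable_locally_integrable_scaleR:
  fixes f :: "'a::euclidean_space \<Rightarrow> 'b::euclidean_space"
  assumes f: "locally_integrable f" and [measurable]: "\<phi> \<in> borel_measurable lebesgue"
    and M: "\<And>x. \<bar>\<phi> x\<bar> \<le> M" and R: "\<And>x. norm x > R \<Longrightarrow> \<phi> x = 0"
  shows "integrable lebesgue (\<lambda>x. \<phi> x *\<^sub>R f x)"
proof -
  let ?g = "\<lambda>x. indicator (cball 0 R) x *\<^sub>R f x"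
  have g: "integrable lebesgue ?g"
    using f unfolding locally_integrable_def set_integrable_def by auto
  have [measurable]: "?g \<in> borel_measurable lebesgue" using g by auto
  have eq: "\<phi> x *\<^sub>R f x = \<phi> x *\<^sub>R ?g x" for x
    using R[of x] by (cases "norm x > R") (auto simp: indicator_def not_less)
  have "integrable lebesgue (\<lambda>x. \<phi> x *\<^sub>R ?g x)"
  proof (rule Bochner_Integration.integrable_bound)
    show "integrable lebesgue (\<lambda>x. M *\<^sub>R ?g x)" using g by (rule integrable_scaleR_right)
    show "AE x in lebesgue. norm (\<phi> x *\<^sub>R ?g x) \<le> norm (M *\<^sub>R ?g x)"
      unfolding norm_scaleR
      by (intro always_eventually allI mult_right_mono order_trans[OF M abs_ge_self]) auto
  qed measurable
  then show ?thesis unfolding eq[symmetric] .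
qed

lemma integrable_locally_integrable_test:
  fixes f :: "'a::euclidean_space \<Rightarrow> 'b::euclidean_space"
  assumes "locally_integrable f" "test_function \<phi>"
  shows "integrable lebesgue (\<lambda>x. \<phi> x *\<^sub>R f x)"
proof -
  obtain R where "\<And>x. norm x > R \<Longrightarrow> \<phi> x = 0" using test_function_support[OF assms(2)] by blast
  moreover obtain M where "\<And>x. \<bar>\<phi> x\<bar> \<le> M" using test_function_bounded[OF assms(2)] by blast
  ultimately show ?thesis
    using integrable_locally_integrable_scaleR[OF assms(1) test_functionD(5)[OF assms(2)]] by blast
qed

lemma locally_integrable_continuous:
  fixes f :: "'a::euclidean_space \<Rightarrow> real"
  assumes "continuous_on UNIV f"
  shows "locally_integrable f"
  unfolding locally_integrable_def
proof (intro allI impI)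
  fix K :: "'a set" assume K: "compact K"
  have "set_integrable lborel K f"
    by (rule borel_integrable_compact[OF K, folded set_integrable_def])
       (use assms continuous_on_subset in auto)
  moreover have "(\<lambda>x. indicator K x *\<^sub>R f x) \<in> borel_measurable borel"
    using K assms by (intro borel_measurable_continuous_on_indicator borel_compact continuous_on_subset[OF assms]) auto
  ultimately show "set_integrable lebesgue K f"
    unfolding set_integrable_def by (simp add: integrable_completion)
qed

lemma locally_integrable_const: "locally_integrable (\<lambda>x::'a::euclidean_space. (c::real))"
  by (rule locally_integrable_continuous) simp

lemma test_function_integrable:
  assumes "test_function \<phi>" shows "integrable lebesgue \<phi>"
  using integrable_locally_integrable_test[OF locally_integrable_const[of 1] assms] by simp

lemma locally_integrable_diff:
  assumes "locally_integrable f" "locally_integrable g"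
  shows "locally_integrable (\<lambda>x. f x - g x)"
  using assms unfolding locally_integrable_def by (auto intro: set_integral_diff)

lemma locally_integrable_inner:
  assumes "locally_integrable f"
  shows "locally_integrable (\<lambda>x. f x \<bullet> b)"
proof -
  have "integrable lebesgue (\<lambda>x. (indicator K x *\<^sub>R f x) \<bullet> b)" if "compact K" for K
    using assms that unfolding locally_integrable_def set_integrable_def
    by (intro integrable_inner_left) auto
  then show ?thesis unfolding locally_integrable_def set_integrable_def by simp
qed

lemma locally_integrable_scaled:
  fixes f :: "'a::euclidean_space \<Rightarrow> 'b::euclidean_space"
  assumes "locally_integrable f" "c \<noteq> 0"
  shows "locally_integrable (\<lambda>x. f (c *\<^sub>R (x - a)))"
  unfolding locally_integrable_def
proof (intro allI impI)
  fix K :: "'a set" assume K: "compact K"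
  let ?T = "\<lambda>x. c *\<^sub>R (x - a)"
  have "compact (?T ` K)" using K by (intro compact_continuous_image continuous_intros)
  then have "integrable lebesgue (\<lambda>x. indicator (?T ` K) x *\<^sub>R f x)"
    using assms(1) unfolding locally_integrable_def set_integrable_def by blast
  from integrable_scaled[OF assms(2) this, of a]
  have "integrable lebesgue (\<lambda>x. indicator (?T ` K) (?T x) *\<^sub>R f (?T x))" .
  moreover have "indicator (?T ` K) (?T x) = (indicator K x :: real)" for x
    using assms(2) by (auto simp: indicator_def)
  ultimately show "set_integrable lebesgue K (\<lambda>x. f (?T x))" unfolding set_integrable_def by simp
qed

lemma integrable_indicator_cball:
  "integrable lebesgue (\<lambda>x. c * indicator (cball a R) x :: real)" for a :: "'a::euclidean_space"
  using lmeasurable_cball[of a R]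
  by (intro integrable_mult_right integrable_real_indicator) (auto simp: fmeasurable_def)

lemma integrable_indicator_box_mult:
  fixes h :: "'a::euclidean_space \<Rightarrow> real"
  assumes "locally_integrable h"
  shows "integrable lebesgue (\<lambda>x. indicator (box a b) x * h x)"
proof -
  have "set_integrable lebesgue (cbox a b) h"
    using assms unfolding locally_integrable_def by simp
  then have "set_integrable lebesgue (box a b) h"
    by (rule set_integrable_subset) (auto simp: box_subset_cbox)
  then show ?thesis by (simp add: set_integrable_def)
qed

section \<open>The fundamental lemma of the calculus of variations\<close>

text \<open>
  Boxes form a generator of the Borel sets that is stable under intersection, so the vanishing of the
  integral passes from boxes to all Borel sets.
\<close>

lemma AE_zero_if_integrals_boxes_zero:
  fixes f :: "'a::euclidean_space \<Rightarrow> real"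
  assumes f: "integrable lebesgue f"
    and zero: "\<And>a b. (LINT x|lebesgue. indicator (box a b) x * f x) = 0" "(LINT x|lebesgue. f x) = 0"
  shows "AE x in lebesgue. f x = 0"
proof -
  obtain f' where [measurable]: "f' \<in> borel_measurable lborel" and "AE x in lborel. f x = f' x"
    using completion_ex_borel_measurable_real[of f lborel] borel_measurable_integrable[OF f] by blast
  then have ae: "AE x in lebesgue. f x = f' x" by (simp add: AE_completion)
  have [measurable]: "f \<in> borel_measurable lebesgue" using f by simp
  have [measurable]: "f' \<in> borel_measurable lebesgue" by (rule measurable_completion) measurable
  have "integrable lebesgue f' = integrable lebesgue f"
    using ae by (intro integrable_cong_AE) auto
  with f have f': "integrable lborel f'" by (simp add: integrable_completion)
  have int_eq: "(LINT x|lborel. indicator A x *\<^sub>R f' x) = (LINT x|lebesgue. indicator A x * f x)"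
    if [measurable]: "A \<in> sets borel" for A
  proof -
    have [measurable]: "A \<in> sets lebesgue" using that by (simp add: sets_completionI_sets)
    have "(LINT x|lborel. indicator A x *\<^sub>R f' x) = (LINT x|lebesgue. indicator A x *\<^sub>R f' x)"
      by (subst integral_completion) auto
    also have "\<dots> = (LINT x|lebesgue. indicator A x * f x)"
      by (rule integral_cong_AE) (use ae in auto)
    finally show ?thesis .
  qed
  have *: "(LINT x:A|lborel. f' x) = 0" if "A \<in> sets borel" for A
  proof -
    let ?E = "range (\<lambda>(a, b). box a b :: 'a set)"
    have set_int: "set_integrable lborel B f'" if "B \<in> sets borel" for B
      unfolding set_integrable_def using that f' by (intro integrable_mult_indicator) auto
    have E: "Int_stable ?E" "?E \<subseteq> Pow UNIV" by (auto simp: Int_stable_def box_Int_box)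
    have "A \<in> sigma_sets UNIV ?E" using that by (simp add: borel_eq_box)
    from E this show ?thesis
    proof (induction rule: sigma_sets_induct_disjoint)
      case (basic A)
      then show ?case using zero(1) int_eq unfolding set_lebesgue_integral_def by auto
    next
      case empty then show ?case by (simp add: set_lebesgue_integral_def)
    next
      case (compl A)
      then have A: "A \<in> sets lborel" by (simp add: borel_eq_box)
      have "(LINT x:UNIV|lborel. f' x) = (LINT x:A|lborel. f' x) + (LINT x:UNIV - A|lborel. f' x)"
        using A by (subst set_integral_Un[symmetric]) (auto simp: sup.absorb2 intro!: set_int)
      then show ?case using compl int_eq[of UNIV] zero(2) by (simp add: set_lebesgue_integral_def)
    next
      case (union A)
      then have A: "A i \<in> sets lborel" for i by (auto simp: borel_eq_box)
      then have "(LINT x:(\<Union>i. A i)|lborel. f' x) = (\<Sum>i. LINT x:A i|lborel. f' x)"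
        using union by (intro lebesgue_integral_countable_add)
          (auto simp: disjoint_family_on_def intro!: set_int)
      then show ?case using union by simp
    qed
  qed
  have "AE x in lborel. f' x = 0"
    by (rule density_unique_real[of lborel f' "\<lambda>_. 0"]) (use f' * in auto)
  then have "AE x in lebesgue. f' x = 0" by (rule AE_completion)
  with ae show ?thesis by eventually_elim simp
qed

text \<open>
  Testing with smooth functions that converge boundedly to the indicator of a box shows that all box
  integrals vanish.
\<close>

lemma fundamental_lemma:
  fixes h :: "'a::euclidean_space \<Rightarrow> real"
  assumes h: "locally_integrable h"
    and zero: "\<And>\<phi>. test_function \<phi> \<Longrightarrow> (LINT x|lebesgue. h x * \<phi> x) = 0"
  shows "AE x in lebesgue. h x = 0"
proof -
  have box0: "(LINT x|lebesgue. indicator (box a b) x * h x) = 0" for a b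
  proof -
    have hi: "integrable lebesgue (\<lambda>x. indicator (cbox a b) x * h x)"
      using h unfolding locally_integrable_def set_integrable_def by auto
    have "(\<lambda>n. LINT x|lebesgue. box_bump a b n x * h x) \<longlonglongrightarrow> (LINT x|lebesgue. indicator (box a b) x * h x)"
    proof (rule integral_dominated_convergence)
      show "integrable lebesgue (\<lambda>x. norm (indicator (cbox a b) x * h x))" using hi by simp
      show "(\<lambda>x. indicator (box a b) x * h x) \<in> borel_measurable lebesgue"
        using integrable_indicator_box_mult[OF h] by (rule borel_measurable_integrable)
      show "(\<lambda>x. box_bump a b n x * h x) \<in> borel_measurable lebesgue" for n
        using integrable_locally_integrable_test[OF h test_function_box_bump[of a b n]] by auto
      show "AE x in lebesgue. (\<lambda>n. box_bump a b n x * h x) \<longlonglongrightarrow> indicator (box a b) x * h x"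
        by (intro always_eventually allI tendsto_mult box_bump_tendsto_indicator tendsto_const)
      show "AE x in lebesgue. norm (box_bump a b n x * h x) \<le> norm (indicator (cbox a b) x * h x)" for n
      proof (intro always_eventually allI)
        fix x
        show "norm (box_bump a b n x * h x) \<le> norm (indicator (cbox a b) x * h x)"
          using box_bump_bounds[of a b n x] box_bump_outside[of x a b n] box_subset_cbox[of a b]
          by (cases "x \<in> box a b") (auto simp: abs_mult mult_left_le_one_le)
      qed
    qed
    moreover have "(LINT x|lebesgue. box_bump a b n x * h x) = 0" for n
      using zero[OF test_function_box_bump[of a b n]] by (simp add: mult.commute)
    ultimately show ?thesis by (simp add: LIMSEQ_const_iff)
  qed
  define B where "B n = box (- (real n *\<^sub>R One)) (real n *\<^sub>R One :: 'a)" for n :: nat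
  have "AE x in lebesgue. indicator (B n) x * h x = 0" for n
  proof (rule AE_zero_if_integrals_boxes_zero)
    show "integrable lebesgue (\<lambda>x. indicator (B n) x * h x)"
      unfolding B_def by (rule integrable_indicator_box_mult[OF h])
    show "(LINT x|lebesgue. indicator (B n) x * h x) = 0" unfolding B_def by (rule box0)
    show "(LINT x|lebesgue. indicator (box a b) x * (indicator (B n) x * h x)) = 0" for a b
      using box0 unfolding B_def
      by (simp add: mult.assoc[symmetric] indicator_inter_arith[symmetric] box_Int_box)
  qed
  then have "AE x in lebesgue. \<forall>n. indicator (B n) x * h x = 0" unfolding AE_all_countable by blast
  then show ?thesis
  proof eventually_elim
    case (elim x)
    have "x \<in> (\<Union>n. B n)" unfolding B_def UN_box_eq_UNIV by simp
    then show ?case using elim by (auto simp: indicator_def split: if_splits)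
  qed
qed

section \<open>Weak gradients\<close>

lemma has_weak_gradientD:
  assumes "has_weak_gradient u g"
  shows "locally_integrable u" "locally_integrable g"
    and "test_function \<phi> \<Longrightarrow> b \<in> Basis \<Longrightarrow>
      (LINT x|lebesgue. u x * partial_deriv \<phi> b x) = - (LINT x|lebesgue. (g x \<bullet> b) * \<phi> x)"
  using assms unfolding has_weak_gradient_def by blast+

text \<open>
  Makes the choice in \<^const>\<open>weak_gradient\<close> harmless: any weak gradient that can be exhibited has the same
  \<open>L^p\<close> norm as the chosen one.
\<close>

lemma has_weak_gradient_unique:
  assumes "has_weak_gradient u g" "has_weak_gradient u g'"
  shows "AE x in lebesgue. g x = g' x"
proof -
  note loc = has_weak_gradientD(2)[OF assms(1), THEN locally_integrable_inner]
             has_weak_gradientD(2)[OF assms(2), THEN locally_integrable_inner]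
  have "AE x in lebesgue. g x \<bullet> b - g' x \<bullet> b = 0" if b: "b \<in> Basis" for b
  proof (rule fundamental_lemma)
    show "locally_integrable (\<lambda>x. g x \<bullet> b - g' x \<bullet> b)"
      by (intro locally_integrable_diff loc)
    fix \<phi> :: "'a \<Rightarrow> real" assume \<phi>: "test_function \<phi>"
    have "(LINT x|lebesgue. (g x \<bullet> b) * \<phi> x) = (LINT x|lebesgue. (g' x \<bullet> b) * \<phi> x)"
      using has_weak_gradientD(3)[OF assms(1) \<phi> b] has_weak_gradientD(3)[OF assms(2) \<phi> b] by simp
    moreover have "integrable lebesgue (\<lambda>x. (g x \<bullet> b) * \<phi> x)" "integrable lebesgue (\<lambda>x. (g' x \<bullet> b) * \<phi> x)"
      using loc[THEN integrable_locally_integrable_test, OF \<phi>] by (simp_all add: mult.commute)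
    ultimately show "(LINT x|lebesgue. (g x \<bullet> b - g' x \<bullet> b) * \<phi> x) = 0"
      by (simp add: left_diff_distrib)
  qed
  then have "AE x in lebesgue. \<forall>b\<in>Basis. g x \<bullet> b - g' x \<bullet> b = 0"
    by (simp add: AE_finite_all)
  then show ?thesis by eventually_elim (simp add: euclidean_eq_iff[of "g _"])
qed

lemma has_weak_gradient_scaled:
  fixes u :: "'a::euclidean_space \<Rightarrow> real"
  assumes u: "has_weak_gradient u g" and c: "c > 0"
  shows "has_weak_gradient (\<lambda>x. u (c *\<^sub>R (x - a))) (\<lambda>x. c *\<^sub>R g (c *\<^sub>R (x - a)))"
  unfolding has_weak_gradient_def
proof (intro conjI allI impI ballI)
  show "locally_integrable (\<lambda>x. u (c *\<^sub>R (x - a)))"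
    by (rule locally_integrable_scaled[OF has_weak_gradientD(1)[OF u]]) (use c in simp)
  have "locally_integrable (\<lambda>x. g (c *\<^sub>R (x - a)))"
    by (rule locally_integrable_scaled[OF has_weak_gradientD(2)[OF u]]) (use c in simp)
  then show "locally_integrable (\<lambda>x. c *\<^sub>R g (c *\<^sub>R (x - a)))"
    unfolding locally_integrable_def set_integrable_def
    by (simp add: scaleR_left_commute[of _ c] del: scaleR_scaleR)
  fix \<phi> :: "'a \<Rightarrow> real" and b :: 'a
  assume \<phi>: "test_function \<phi>" and b: "b \<in> Basis"
  let ?S = "\<lambda>y. (1 / c) *\<^sub>R (y - (- c *\<^sub>R a))"
  define \<psi> where "\<psi> y = \<phi> (?S y)" for y
  have \<psi>: "test_function \<psi>"
    unfolding \<psi>_def using \<phi> c by (intro test_function_scaled) auto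
  have pd: "partial_deriv \<psi> b y = (1 / c) * partial_deriv \<phi> b (?S y)" for y
    unfolding \<psi>_def by (rule partial_deriv_scaled) (rule test_functionD[OF \<phi>])
  have S: "?S (c *\<^sub>R (x - a)) = x" for x using c by (intro unscale) auto
  have "(LINT x|lebesgue. u (c *\<^sub>R (x - a)) * partial_deriv \<phi> b x)
      = (LINT x|lebesgue. c * (u (c *\<^sub>R (x - a)) * partial_deriv \<psi> b (c *\<^sub>R (x - a))))"
    using c unfolding pd S by simp
  also have "\<dots> = c * (1 / c ^ DIM('a) * (LINT y|lebesgue. u y * partial_deriv \<psi> b y))"
    by (subst integral_mult_right_zero, subst integral_scaled[of c "\<lambda>y. u y * partial_deriv \<psi> b y" a]) (use c in simp_all)
  also have "\<dots> = - c * (1 / c ^ DIM('a) * (LINT y|lebesgue. (g y \<bullet> b) * \<psi> y))"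
    using has_weak_gradientD(3)[OF u \<psi> b] by simp
  also have "\<dots> = - (LINT x|lebesgue. c * ((g (c *\<^sub>R (x - a)) \<bullet> b) * \<psi> (c *\<^sub>R (x - a))))"
    by (subst integral_mult_right_zero, subst integral_scaled[of c "\<lambda>y. (g y \<bullet> b) * \<psi> y" a]) (use c in simp_all)
  also have "\<dots> = - (LINT x|lebesgue. ((c *\<^sub>R g (c *\<^sub>R (x - a))) \<bullet> b) * \<phi> x)"
    unfolding \<psi>_def S by (simp add: mult.assoc)
  finally show "(LINT x|lebesgue. u (c *\<^sub>R (x - a)) * partial_deriv \<phi> b x)
      = - (LINT x|lebesgue. ((c *\<^sub>R g (c *\<^sub>R (x - a))) \<bullet> b) * \<phi> x)" .
qed

lemma test_function_has_derivative:
  "test_function f \<Longrightarrow> (f has_derivative frechet_derivative f (at x)) (at x)"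
  using test_functionD(2) frechet_derivative_works by blast

lemma test_function_line_derivative:
  assumes "test_function f"
  shows "((\<lambda>t. f (x + t *\<^sub>R b)) has_real_derivative partial_deriv f b (x + t *\<^sub>R b)) (at t)"
proof -
  let ?f' = "frechet_derivative f (at (x + t *\<^sub>R b))"
  have f': "(f has_derivative ?f') (at (x + t *\<^sub>R b))" by (rule test_function_has_derivative[OF assms])
  have "((\<lambda>t. f (x + t *\<^sub>R b)) has_derivative (\<lambda>h. ?f' (h *\<^sub>R b))) (at t)"
    by (rule has_derivative_compose[of "\<lambda>t. x + t *\<^sub>R b" "\<lambda>h. h *\<^sub>R b" t UNIV f])
       (auto intro!: derivative_eq_intros f')
  moreover have "?f' (h *\<^sub>R b) = ?f' b * h" for h
    using linear_cmul[OF has_derivative_linear[OF f']] by simp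
  ultimately show ?thesis by (simp add: has_field_derivative_def mult_commute_abs)
qed

text \<open>
  The integral of a difference quotient vanishes by translation invariance, and the difference quotients
  are bounded and supported in a common ball.
\<close>

lemma integral_partial_deriv_zero:
  fixes f :: "'a::euclidean_space \<Rightarrow> real"
  assumes f: "test_function f" and b: "b \<in> Basis"
  shows "(LINT x|lebesgue. partial_deriv f b x) = 0"
proof -
  define e where "e n = inverse (real (Suc n))" for n
  have e: "0 < e n" "e n \<le> 1" for n unfolding e_def by (auto simp: inverse_le_1_iff)
  have e0: "e \<longlonglongrightarrow> 0" unfolding e_def by (rule LIMSEQ_inverse_real_of_nat)
  obtain R where R: "R > 0" "\<And>x. norm x > R \<Longrightarrow> f x = 0" using test_function_support[OF f] by blast
  obtain M where M: "M > 0" "\<And>x. \<bar>partial_deriv f b x\<bar> \<le> M"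
    using test_function_bounded[OF test_function_partial_deriv[OF f b]] by blast
  have tr: "(\<lambda>x. f (x + e n *\<^sub>R b)) = (\<lambda>x. f (1 *\<^sub>R (x - (- e n *\<^sub>R b))))" for n by simp
  have int: "integrable lebesgue (\<lambda>x. f (x + e n *\<^sub>R b))" for n
    unfolding tr by (rule integrable_scaled) (simp_all add: test_function_integrable f)
  have val: "(LINT x|lebesgue. f (x + e n *\<^sub>R b)) = (LINT x|lebesgue. f x)" for n
    unfolding tr by (subst integral_scaled) simp_all
  have "(\<lambda>n. LINT x|lebesgue. (f (x + e n *\<^sub>R b) - f x) / e n) \<longlonglongrightarrow> (LINT x|lebesgue. partial_deriv f b x)"
  proof (rule integral_dominated_convergence)
    show "partial_deriv f b \<in> borel_measurable lebesgue"
      by (rule test_functionD(5)[OF test_function_partial_deriv[OF f b]])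
    show "(\<lambda>x. (f (x + e n *\<^sub>R b) - f x) / e n) \<in> borel_measurable lebesgue" for n
      using int test_function_integrable[OF f] by (intro borel_measurable_divide borel_measurable_diff) auto
    show "integrable lebesgue (\<lambda>x. M * indicator (cball 0 (R + 1)) x :: real)"
      by (rule integrable_indicator_cball)
    show "AE x in lebesgue. (\<lambda>n. (f (x + e n *\<^sub>R b) - f x) / e n) \<longlonglongrightarrow> partial_deriv f b x"
    proof (intro always_eventually allI)
      fix x
      have "((\<lambda>t. (f (x + t *\<^sub>R b) - f x) / t) \<longlongrightarrow> partial_deriv f b x) (at 0)"
        using test_function_line_derivative[OF f, of x b 0] by (simp add: has_field_derivative_iff)
      moreover have "filterlim e (at 0) sequentially"
        using e0 e(1)[THEN less_imp_neq, symmetric] by (simp add: filterlim_at)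
      ultimately show "(\<lambda>n. (f (x + e n *\<^sub>R b) - f x) / e n) \<longlonglongrightarrow> partial_deriv f b x"
        by (rule filterlim_compose)
    qed
    show "AE x in lebesgue. norm ((f (x + e n *\<^sub>R b) - f x) / e n) \<le> M * indicator (cball 0 (R + 1)) x" for n
    proof (intro always_eventually allI)
      fix x
      show "norm ((f (x + e n *\<^sub>R b) - f x) / e n) \<le> M * indicator (cball 0 (R + 1)) x"
      proof (cases "norm x \<le> R + 1")
        case True
        obtain t where "f (x + e n *\<^sub>R b) - f (x + 0 *\<^sub>R b) = (e n - 0) * partial_deriv f b (x + t *\<^sub>R b)"
          using MVT2[OF e(1)[of n], of "\<lambda>t. f (x + t *\<^sub>R b)" "\<lambda>t. partial_deriv f b (x + t *\<^sub>R b)"]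
            test_function_line_derivative[OF f] by metis
        then have "(f (x + e n *\<^sub>R b) - f x) / e n = partial_deriv f b (x + t *\<^sub>R b)"
          using e(1)[of n] by simp
        then show ?thesis using True M(2) by simp
      next
        case False
        have "norm x \<le> norm (x + e n *\<^sub>R b) + norm (e n *\<^sub>R b)"
          using norm_triangle_ineq4[of "x + e n *\<^sub>R b" "e n *\<^sub>R b"] by simp
        moreover have "norm (e n *\<^sub>R b) \<le> 1" using e[of n] b by simp
        ultimately have "norm (x + e n *\<^sub>R b) > R" using False by linarith
        then show ?thesis using False R by simp
      qed
    qed
  qed
  moreover have "(LINT x|lebesgue. (f (x + e n *\<^sub>R b) - f x) / e n) = 0" for n
    using int[of n] val[of n] test_function_integrable[OF f] by simp
  ultimately have "(\<lambda>n. 0) \<longlonglongrightarrow> (LINT x|lebesgue. partial_deriv f b x)" by (simp only:)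
  then show ?thesis by (simp add: LIMSEQ_const_iff)
qed

definition classical_gradient :: "('a::euclidean_space \<Rightarrow> real) \<Rightarrow> 'a \<Rightarrow> 'a" where
  "classical_gradient f x = (\<Sum>b\<in>Basis. partial_deriv f b x *\<^sub>R b)"

text \<open>
  Integration by parts: the integral of the partial derivative of the product with a test function
  vanishes. Its use is to show that \<^const>\<open>W1p\<close> contains a nonzero function.
\<close>

lemma has_weak_gradient_test_function:
  fixes u :: "'a::euclidean_space \<Rightarrow> real"
  assumes u: "test_function u"
  shows "has_weak_gradient u (classical_gradient u)"
  unfolding has_weak_gradient_def
proof (intro conjI allI impI ballI)
  show "locally_integrable u" by (intro locally_integrable_continuous test_functionD[OF u])
  have "locally_integrable (\<lambda>x. partial_deriv u b x)" if "b \<in> Basis" for b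
    by (intro locally_integrable_continuous test_functionD[OF test_function_partial_deriv[OF u that]])
  then have *: "integrable lebesgue (\<lambda>x. indicator K x * partial_deriv u b x)" if "compact K" "b \<in> Basis" for K b
    using that unfolding locally_integrable_def set_integrable_def by auto
  show "locally_integrable (classical_gradient u)"
    unfolding locally_integrable_def set_integrable_def classical_gradient_def
  proof (intro allI impI)
    fix K :: "'a set" assume "compact K"
    then show "integrable lebesgue (\<lambda>x. indicator K x *\<^sub>R (\<Sum>b\<in>Basis. partial_deriv u b x *\<^sub>R b))"
      unfolding scaleR_sum_right scaleR_scaleR
      by (intro Bochner_Integration.integrable_sum integrable_scaleR_left *)
  qed
  fix \<phi> :: "'a \<Rightarrow> real" and b :: 'a
  assume \<phi>: "test_function \<phi>" and b: "b \<in> Basis"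
  have t: "test_function (\<lambda>x. u x * \<phi> x)" "test_function (\<lambda>x. u x * partial_deriv \<phi> b x)"
      "test_function (\<lambda>x. partial_deriv u b x * \<phi> x)"
    using u \<phi> test_function_partial_deriv[OF u b] test_function_partial_deriv[OF \<phi> b]
    by (auto intro!: test_function_mult test_functionD(1))
  have "(\<lambda>x. partial_deriv (\<lambda>x. u x * \<phi> x) b x) = (\<lambda>x. u x * partial_deriv \<phi> b x + partial_deriv u b x * \<phi> x)"
    by (intro ext partial_deriv_mult test_functionD u \<phi>)
  then have "0 = (LINT x|lebesgue. u x * partial_deriv \<phi> b x + partial_deriv u b x * \<phi> x)"
    using integral_partial_deriv_zero[OF t(1) b] by simp
  also have "\<dots> = (LINT x|lebesgue. u x * partial_deriv \<phi> b x) + (LINT x|lebesgue. partial_deriv u b x * \<phi> x)"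
    by (intro Bochner_Integration.integral_add test_function_integrable t)
  finally have "(LINT x|lebesgue. u x * partial_deriv \<phi> b x) = - (LINT x|lebesgue. partial_deriv u b x * \<phi> x)"
    by simp
  moreover have "classical_gradient u x \<bullet> b = partial_deriv u b x" for x
    using b by (simp add: classical_gradient_def inner_sum_left inner_Basis if_distrib cong: if_cong)
  ultimately show "(LINT x|lebesgue. u x * partial_deriv \<phi> b x) = - (LINT x|lebesgue. (classical_gradient u x \<bullet> b) * \<phi> x)"
    by simp
qed

lemma in_Lp_bounded_support:
  fixes f :: "'a::euclidean_space \<Rightarrow> 'b::euclidean_space"
  assumes [measurable]: "f \<in> borel_measurable lebesgue" and "p > 0"
    and "\<And>x. norm (f x) \<le> M" "\<And>x. norm x > R \<Longrightarrow> f x = 0"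
  shows "in_Lp p f"
  unfolding in_Lp_def
proof (intro conjI)
  show "integrable lebesgue (\<lambda>x. norm (f x) powr p)"
  proof (rule Bochner_Integration.integrable_bound)
    show "integrable lebesgue (\<lambda>x. M powr p * indicator (cball 0 R) x :: real)"
      by (rule integrable_indicator_cball)
    show "AE x in lebesgue. norm (norm (f x) powr p) \<le> norm (M powr p * indicator (cball 0 R) x :: real)"
    proof (intro always_eventually allI)
      fix x show "norm (norm (f x) powr p) \<le> norm (M powr p * indicator (cball 0 R) x :: real)"
        using assms(2) assms(3)[of x] assms(4)[of x] by (cases "norm x > R") (auto intro: powr_mono2)
    qed
  qed measurable
qed fact

lemma test_function_in_W1p:
  fixes u :: "'a::euclidean_space \<Rightarrow> real"
  assumes u: "test_function u" and "p > 0"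
  shows "u \<in> W1p p"
proof -
  obtain R where R: "R > 0" "\<And>x. norm x > R \<Longrightarrow> u x = 0" using test_function_support[OF u] by blast
  obtain M where M: "M > 0" "\<And>x. \<bar>u x\<bar> \<le> M" using test_function_bounded[OF u] by blast
  have "in_Lp p u" using M R assms(2) by (intro in_Lp_bounded_support test_functionD[OF u]) auto
  moreover have "in_Lp p (classical_gradient u)"
  proof -
    have "\<exists>S. \<forall>x. norm x > S \<longrightarrow> partial_deriv u b x = 0" if "b \<in> Basis" for b
      using test_function_support[OF test_function_partial_deriv[OF u that]] by metis
    then obtain S where S: "\<And>b x. b \<in> Basis \<Longrightarrow> norm x > S b \<Longrightarrow> partial_deriv u b x = 0" by metis
    have "\<exists>N. \<forall>x. \<bar>partial_deriv u b x\<bar> \<le> N" if "b \<in> Basis" for b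
      using test_function_bounded[OF test_function_partial_deriv[OF u that]] by metis
    then obtain N where N: "\<And>b x. b \<in> Basis \<Longrightarrow> \<bar>partial_deriv u b x\<bar> \<le> N b" by metis
    show ?thesis
    proof (rule in_Lp_bounded_support)
      show "classical_gradient u \<in> borel_measurable lebesgue"
        unfolding classical_gradient_def
        by (intro borel_measurable_sum borel_measurable_scaleR test_functionD[OF test_function_partial_deriv[OF u]]) auto
      show "norm (classical_gradient u x) \<le> (\<Sum>b\<in>Basis. N b)" for x
        unfolding classical_gradient_def by (rule sum_norm_le) (simp add: N)
      show "classical_gradient u x = 0" if "norm x > Max (S ` Basis)" for x
      proof -
        have "norm x > S b" if "b \<in> Basis" for b
          using that \<open>norm x > Max (S ` Basis)\<close> Max_ge[of "S ` Basis" "S b"] by force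
        then show ?thesis unfolding classical_gradient_def by (simp add: S)
      qed
    qed fact
  qed
  ultimately show ?thesis unfolding W1p_def using has_weak_gradient_test_function[OF u] by blast
qed

lemma W1p_weak_gradient:
  assumes "u \<in> W1p p"
  shows "has_weak_gradient u (weak_gradient u)" "in_Lp p (weak_gradient u)" "in_Lp p u"
proof -
  obtain g where g: "has_weak_gradient u g" "in_Lp p g" and u: "in_Lp p u"
    using assms unfolding W1p_def by blast
  show *: "has_weak_gradient u (weak_gradient u)"
    unfolding weak_gradient_def by (rule someI[of _ g]) (rule g)
  have ae: "AE x in lebesgue. g x = weak_gradient u x" by (rule has_weak_gradient_unique[OF g(1) *])
  have m: "g \<in> borel_measurable lebesgue" using g by (simp add: in_Lp_def)
  have m': "weak_gradient u \<in> borel_measurable lebesgue"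
    by (rule borel_measurable_AE[OF m ae])
  show "in_Lp p (weak_gradient u)"
    unfolding in_Lp_def
  proof (intro conjI m')
    show "integrable lebesgue (\<lambda>x. norm (weak_gradient u x) powr p)"
    proof (rule integrable_cong_AE_imp)
      show "integrable lebesgue (\<lambda>x. norm (g x) powr p)" using g by (simp add: in_Lp_def)
      show "(\<lambda>x. norm (weak_gradient u x) powr p) \<in> borel_measurable lebesgue" using m' by measurable
      show "AE x in lebesgue. norm (g x) powr p = norm (weak_gradient u x) powr p"
        using ae by eventually_elim simp
    qed
  qed
  show "in_Lp p u" by (rule u)
qed

section \<open>Averages against a dilated kernel\<close>

text \<open>
  The weighted mean of \<open>u\<close> near \<open>x\<close> at the length \<open>1 / s\<close>. With the inverse length as parameter the
  derivative of the kernel has no negative powers.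
\<close>

definition kernel_average :: "('a::euclidean_space \<Rightarrow> real) \<Rightarrow> ('a \<Rightarrow> real) \<Rightarrow> 'a \<Rightarrow> real \<Rightarrow> real" where
  "kernel_average \<kappa> u x s = (LINT z|lebesgue. u z * (s ^ DIM('a) * \<kappa> (s *\<^sub>R (z - x))))"

text \<open>
  The divergence of the vector field \<open>\<kappa>(w) w\<close>, that is, the derivative at \<open>s = 1\<close> of the dilated kernel
  \<open>s^d \<kappa>(s w)\<close>.
\<close>

definition dilation_divergence :: "('a::euclidean_space \<Rightarrow> real) \<Rightarrow> 'a \<Rightarrow> real" where
  "dilation_divergence \<kappa> w = (\<Sum>b\<in>Basis. partial_deriv (\<lambda>y. \<kappa> y * (y \<bullet> b)) b w)"

lemma test_function_sum:
  "(\<And>i. i \<in> I \<Longrightarrow> test_function (f i)) \<Longrightarrow> test_function (\<lambda>x. \<Sum>i\<in>I. f i x)"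
proof (induction I rule: infinite_finite_induct)
  case (insert i I)
  have i: "test_function (f i)" and I: "test_function (\<lambda>x. \<Sum>i\<in>I. f i x)"
    using insert by auto
  obtain R where R: "\<And>x. norm x > R \<Longrightarrow> f i x = 0"
    using test_function_support[OF i] by metis
  obtain S where S: "\<And>x. norm x > S \<Longrightarrow> (\<Sum>i\<in>I. f i x) = 0"
    using test_function_support[OF I] by metis
  have "\<forall>x. norm x > max R S \<longrightarrow> f i x + (\<Sum>i\<in>I. f i x) = 0" using R S by simp
  moreover have "C_k k (\<lambda>x. f i x + (\<Sum>i\<in>I. f i x))" for k
    by (intro C_k_add test_functionD(1) i I)
  ultimately have "test_function (\<lambda>x. f i x + (\<Sum>i\<in>I. f i x))"
    unfolding test_function_alt by blast
  then show ?case using insert by simp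
qed (auto simp: test_function_alt C_k_const)

lemma test_function_dilation_divergence:
  assumes "test_function \<kappa>" shows "test_function (dilation_divergence \<kappa>)"
  unfolding dilation_divergence_def
  by (intro test_function_sum test_function_partial_deriv test_function_mult assms C_k_inner)

lemma dilation_divergence_eq:
  fixes \<kappa> :: "'a::euclidean_space \<Rightarrow> real"
  assumes "test_function \<kappa>"
  shows "dilation_divergence \<kappa> w = real DIM('a) * \<kappa> w + frechet_derivative \<kappa> (at w) w"
proof -
  have lin: "linear (frechet_derivative \<kappa> (at w))"
    using test_function_has_derivative[OF assms] has_derivative_linear by blast
  have ib: "partial_deriv (\<lambda>y. y \<bullet> b) b w = b \<bullet> b" for b :: 'a
  proof -
    have "((\<lambda>y. y \<bullet> b) has_derivative (\<lambda>h. h \<bullet> b)) (at w)" by (auto intro!: derivative_eq_intros)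
    from frechet_derivative_at[OF this] show ?thesis by metis
  qed
  have d: "(\<lambda>y. y \<bullet> b) differentiable at w" for b :: 'a
    by (auto simp: differentiable_def intro!: derivative_eq_intros exI)
  have "dilation_divergence \<kappa> w = (\<Sum>b\<in>Basis. \<kappa> w * (b \<bullet> b) + partial_deriv \<kappa> b w * (w \<bullet> b))"
    unfolding dilation_divergence_def
    by (intro sum.cong refl) (simp add: partial_deriv_mult[OF test_functionD(2)[OF assms] d] ib)
  also have "\<dots> = real DIM('a) * \<kappa> w + (\<Sum>b\<in>Basis. (w \<bullet> b) * partial_deriv \<kappa> b w)"
    by (simp add: sum.distrib mult.commute)
  also have "(\<Sum>b\<in>Basis. (w \<bullet> b) * partial_deriv \<kappa> b w) = frechet_derivative \<kappa> (at w) (\<Sum>b\<in>Basis. (w \<bullet> b) *\<^sub>R b)"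
    by (simp add: linear_sum[OF lin] linear_cmul[OF lin])
  finally show ?thesis by (simp add: euclidean_representation)
qed

lemma dilated_kernel_derivative:
  fixes \<kappa> :: "'a::euclidean_space \<Rightarrow> real"
  assumes "test_function \<kappa>"
  shows "((\<lambda>s. s ^ DIM('a) * \<kappa> (s *\<^sub>R v)) has_real_derivative
          s ^ (DIM('a) - 1) * dilation_divergence \<kappa> (s *\<^sub>R v)) (at s)"
proof -
  have lin: "linear (frechet_derivative \<kappa> (at (s *\<^sub>R v)))"
    using test_function_has_derivative[OF assms] has_derivative_linear by blast
  have "((\<lambda>s. \<kappa> (s *\<^sub>R v)) has_real_derivative partial_deriv \<kappa> v (s *\<^sub>R v)) (at s)"
    using test_function_line_derivative[OF assms, of 0 v s] by simp
  then have "((\<lambda>s. s ^ DIM('a) * \<kappa> (s *\<^sub>R v)) has_real_derivative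
      real DIM('a) * s ^ (DIM('a) - 1) * \<kappa> (s *\<^sub>R v) + s ^ DIM('a) * partial_deriv \<kappa> v (s *\<^sub>R v)) (at s)"
    by (auto intro!: derivative_eq_intros)
  moreover have "s ^ DIM('a) = s ^ (DIM('a) - 1) * s"
    by (metis DIM_positive power_minus_mult)
  ultimately show ?thesis
    by (simp add: dilation_divergence_eq[OF assms] linear_cmul[OF lin] algebra_simps)
qed

text \<open>
  The form of dominated convergence used for averages: uniformly bounded kernels with supports in one ball
  are dominated because \<open>u\<close> is integrable there.
\<close>

lemma integral_bounded_kernels_tendsto:
  fixes u :: "'a::euclidean_space \<Rightarrow> real"
  assumes u: "locally_integrable u" and k: "\<And>n. k n \<in> borel_measurable lebesgue"
    and M: "\<And>n z. \<bar>k n z\<bar> \<le> M" and R: "\<And>n z. norm z > R \<Longrightarrow> k n z = 0"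
    and lim: "\<And>z. (\<lambda>n. k n z) \<longlonglongrightarrow> k' z"
  shows "(\<lambda>n. LINT z|lebesgue. u z * k n z) \<longlonglongrightarrow> (LINT z|lebesgue. u z * k' z)"
proof (rule integral_dominated_convergence)
  let ?h = "\<lambda>z. M * indicator (cball 0 R) z"
  have M0: "M \<ge> 0" using M[of 0 0] by linarith
  have "integrable lebesgue (\<lambda>z. k n z *\<^sub>R u z)" for n
    by (rule integrable_locally_integrable_scaleR[OF u k M]) (rule R)
  then show m: "(\<lambda>z. u z * k n z) \<in> borel_measurable lebesgue" for n
    by (intro borel_measurable_integrable) (simp add: mult.commute)
  show lim': "AE z in lebesgue. (\<lambda>n. u z * k n z) \<longlonglongrightarrow> u z * k' z"
    by (intro always_eventually allI tendsto_mult tendsto_const lim)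
  show "(\<lambda>z. u z * k' z) \<in> borel_measurable lebesgue"
    by (rule borel_measurable_LIMSEQ_real[of _ "\<lambda>n z. u z * k n z"])
       (intro tendsto_mult tendsto_const lim, rule m)
  have "integrable lebesgue (\<lambda>z. ?h z *\<^sub>R u z)"
  proof (rule integrable_locally_integrable_scaleR[OF u])
    show "?h \<in> borel_measurable lebesgue" using integrable_indicator_cball by (rule borel_measurable_integrable)
    show "\<bar>?h z\<bar> \<le> M" for z using M0 by (auto simp: indicator_def)
    show "?h z = 0" if "norm z > R" for z using that by simp
  qed
  then show "integrable lebesgue (\<lambda>z. norm (?h z *\<^sub>R u z))" by (rule integrable_norm)
  have "\<bar>k n z\<bar> \<le> \<bar>?h z\<bar>" for n z
    using M[of n z] M0 R[of z n] by (cases "norm z > R") auto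
  then show "AE z in lebesgue. norm (u z * k n z) \<le> norm (?h z *\<^sub>R u z)" for n
    by (intro always_eventually allI) (simp add: abs_mult mult.commute[of "\<bar>u _\<bar>"] mult_right_mono)
qed

text \<open>
  Differentiation under the integral sign. It suffices to let the parameter tend to \<open>s\<close> inside
  \<open>(s/2, 2s)\<close>: there the mean value theorem bounds the difference quotients of the kernel uniformly, and
  their supports lie in a fixed ball.
\<close>

lemma kernel_average_has_derivative:
  fixes u :: "'a::euclidean_space \<Rightarrow> real"
  assumes \<kappa>: "test_function \<kappa>" and u: "locally_integrable u" and s: "s > 0"
  shows "(kernel_average \<kappa> u x has_real_derivative
     s ^ (DIM('a) - 1) * (LINT z|lebesgue. u z * dilation_divergence \<kappa> (s *\<^sub>R (z - x)))) (at s)"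
proof -
  let ?\<eta> = "dilation_divergence \<kappa>"
  let ?I = "{s / 2<..<2 * s}"
  let ?k = "\<lambda>z s. s ^ DIM('a) * \<kappa> (s *\<^sub>R (z - x))"
  have \<eta>: "test_function ?\<eta>" by (rule test_function_dilation_divergence[OF \<kappa>])
  obtain N where N: "N > 0" "\<And>w. \<bar>?\<eta> w\<bar> \<le> N" using test_function_bounded[OF \<eta>] by blast
  obtain R where R: "R > 0" "\<And>w. norm w > R \<Longrightarrow> ?\<eta> w = 0" using test_function_support[OF \<eta>] by blast
  have int: "integrable lebesgue (\<lambda>z. u z * ?k z t)" if "t > 0" for t
  proof -
    have "test_function (\<lambda>z. \<kappa> (t *\<^sub>R (z - x)))" by (rule test_function_scaled[OF \<kappa> that])
    from integrable_mult_right[OF integrable_locally_integrable_test[OF u this], of "t ^ DIM('a)"]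
    show ?thesis by (simp add: mult_ac)
  qed
  have "((\<lambda>t. (kernel_average \<kappa> u x t - kernel_average \<kappa> u x s) / (t - s)) \<longlongrightarrow>
      s ^ (DIM('a) - 1) * (LINT z|lebesgue. u z * ?\<eta> (s *\<^sub>R (z - x)))) (at s within ?I)"
    unfolding tendsto_at_iff_sequentially comp_def
  proof (intro allI impI)
    fix X :: "nat \<Rightarrow> real" assume X: "\<forall>i. X i \<in> ?I - {s}" "X \<longlonglongrightarrow> s"
    have Xn: "X n \<in> ?I" "X n \<noteq> s" "X n > 0" for n using X s by (auto simp: less_trans[of 0 "s/2"])
    have quot: "\<exists>t\<in>?I. (?k z (X n) - ?k z s) / (X n - s) = t ^ (DIM('a) - 1) * ?\<eta> (t *\<^sub>R (z - x))" for n z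
    proof (cases "X n < s")
      case True
      obtain t where t: "X n < t" "t < s" "?k z s - ?k z (X n) = (s - X n) * (t ^ (DIM('a) - 1) * ?\<eta> (t *\<^sub>R (z - x)))"
        using MVT2[OF True dilated_kernel_derivative[OF \<kappa>, of "z - x"]] by blast
      have "(?k z (X n) - ?k z s) / (X n - s) = (?k z s - ?k z (X n)) / (s - X n)"
        using True by (subst minus_divide_divide[symmetric]) simp
      also have "\<dots> = t ^ (DIM('a) - 1) * ?\<eta> (t *\<^sub>R (z - x))" using t True by simp
      finally show ?thesis using t Xn(1)[of n] s by (intro bexI[of _ t]) auto
    next
      case False
      then have lt: "s < X n" using Xn(2)[of n] by simp
      obtain t where t: "s < t" "t < X n" "?k z (X n) - ?k z s = (X n - s) * (t ^ (DIM('a) - 1) * ?\<eta> (t *\<^sub>R (z - x)))"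
        using MVT2[OF lt dilated_kernel_derivative[OF \<kappa>, of "z - x"]] by blast
      then show ?thesis using lt Xn(1)[of n] s by (intro bexI[of _ t]) auto
    qed
    have "(\<lambda>n. LINT z|lebesgue. u z * ((?k z (X n) - ?k z s) / (X n - s)))
        \<longlonglongrightarrow> (LINT z|lebesgue. u z * (s ^ (DIM('a) - 1) * ?\<eta> (s *\<^sub>R (z - x))))"
    proof (rule integral_bounded_kernels_tendsto[OF u])
      show "(\<lambda>z. (?k z (X n) - ?k z s) / (X n - s)) \<in> borel_measurable lebesgue" for n
        using Xn(3) s
        by (intro borel_measurable_divide borel_measurable_diff borel_measurable_times borel_measurable_const
            test_functionD(5)[OF test_function_scaled[OF \<kappa>]])
      fix z
      have "((\<lambda>t. (?k z t - ?k z s) / (t - s)) \<longlongrightarrow> s ^ (DIM('a) - 1) * ?\<eta> (s *\<^sub>R (z - x))) (at s)"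
        using dilated_kernel_derivative[OF \<kappa>, of "z - x" s] by (simp add: has_field_derivative_iff)
      then show "(\<lambda>n. (?k z (X n) - ?k z s) / (X n - s)) \<longlonglongrightarrow> s ^ (DIM('a) - 1) * ?\<eta> (s *\<^sub>R (z - x))"
        by (rule filterlim_compose) (use X Xn in \<open>simp add: filterlim_at\<close>)
      fix n
      obtain t where t: "t \<in> ?I" "(?k z (X n) - ?k z s) / (X n - s) = t ^ (DIM('a) - 1) * ?\<eta> (t *\<^sub>R (z - x))"
        using quot by blast
      have "t ^ (DIM('a) - 1) \<le> (2 * s) ^ (DIM('a) - 1)" using t s by (intro power_mono) auto
      then have "t ^ (DIM('a) - 1) * \<bar>?\<eta> (t *\<^sub>R (z - x))\<bar> \<le> (2 * s) ^ (DIM('a) - 1) * N"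
        using N s by (intro mult_mono) auto
      then show "\<bar>(?k z (X n) - ?k z s) / (X n - s)\<bar> \<le> (2 * s) ^ (DIM('a) - 1) * N"
        unfolding t(2) using t s by (simp add: abs_mult)
      assume "norm z > norm x + 2 * R / s"
      then have far: "2 * R / s < norm (z - x)" using norm_triangle_ineq2[of z x] by linarith
      have "R = s / 2 * (2 * R / s)" using s by simp
      also have "\<dots> \<le> t * (2 * R / s)" using t s R by (intro mult_right_mono) auto
      also have "\<dots> < t * norm (z - x)" using t s far by (intro mult_strict_left_mono) auto
      also have "\<dots> = norm (t *\<^sub>R (z - x))" using t s by (simp del: scaleR_diff_right)
      finally show "(?k z (X n) - ?k z s) / (X n - s) = 0" unfolding t(2) by (simp add: R(2))
    qed
    moreover have "(LINT z|lebesgue. u z * ((?k z (X n) - ?k z s) / (X n - s)))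
        = (kernel_average \<kappa> u x (X n) - kernel_average \<kappa> u x s) / (X n - s)" for n
    proof -
      have "(LINT z|lebesgue. u z * ((?k z (X n) - ?k z s) / (X n - s)))
          = (LINT z|lebesgue. (u z * ?k z (X n) - u z * ?k z s) / (X n - s))"
        by (simp add: right_diff_distrib)
      also have "\<dots> = ((LINT z|lebesgue. u z * ?k z (X n)) - (LINT z|lebesgue. u z * ?k z s)) / (X n - s)"
        using int[OF Xn(3)] int[OF s] by simp
      finally show ?thesis by (simp add: kernel_average_def)
    qed
    moreover have "(LINT z|lebesgue. u z * (s ^ (DIM('a) - 1) * ?\<eta> (s *\<^sub>R (z - x))))
        = s ^ (DIM('a) - 1) * (LINT z|lebesgue. u z * ?\<eta> (s *\<^sub>R (z - x)))"
      by (subst integral_mult_right_zero[symmetric]) (simp add: mult_ac)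
    ultimately show "(\<lambda>n. (kernel_average \<kappa> u x (X n) - kernel_average \<kappa> u x s) / (X n - s))
      \<longlonglongrightarrow> s ^ (DIM('a) - 1) * (LINT z|lebesgue. u z * ?\<eta> (s *\<^sub>R (z - x)))"
      by (simp only:)
  qed
  moreover have "at s within ?I = at s" using s by (intro at_within_open) auto
  ultimately show ?thesis unfolding has_field_derivative_iff by (simp only:)
qed

text \<open>
  Since \<open>\<kappa>(s(z-x)) s(z-x)\<close> is a test field, its divergence can be moved onto the weak gradient. The factor
  \<open>1 / s\<close> comes from the chain rule.
\<close>

lemma integral_against_dilation_divergence:
  fixes u :: "'a::euclidean_space \<Rightarrow> real"
  assumes \<kappa>: "test_function \<kappa>" and u: "has_weak_gradient u g" and s: "s > 0"
  shows "(LINT z|lebesgue. u z * dilation_divergence \<kappa> (s *\<^sub>R (z - x)))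
     = - (1 / s) * (LINT z|lebesgue. \<kappa> (s *\<^sub>R (z - x)) * (g z \<bullet> (s *\<^sub>R (z - x))))"
proof -
  let ?w = "\<lambda>z. s *\<^sub>R (z - x)"
  have t: "test_function (\<lambda>y. \<kappa> y * (y \<bullet> b))" for b
    by (intro test_function_mult \<kappa> C_k_inner)
  have tw: "test_function (\<lambda>z. \<kappa> (?w z) * (?w z \<bullet> b))" for b
    using test_function_scaled[OF t[of b] s, of x] .
  note locg = has_weak_gradientD(2)[OF u]
  have part: "s * (LINT z|lebesgue. u z * partial_deriv (\<lambda>y. \<kappa> y * (y \<bullet> b)) b (?w z))
      = - (LINT z|lebesgue. (g z \<bullet> b) * (\<kappa> (?w z) * (?w z \<bullet> b)))" if b: "b \<in> Basis" for b
  proof -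
    have "partial_deriv (\<lambda>z. \<kappa> (?w z) * (?w z \<bullet> b)) b z = s * partial_deriv (\<lambda>y. \<kappa> y * (y \<bullet> b)) b (?w z)" for z
      by (rule partial_deriv_scaled[of "\<lambda>y. \<kappa> y * (y \<bullet> b)"]) (rule test_functionD[OF t])
    then have "s * (LINT z|lebesgue. u z * partial_deriv (\<lambda>y. \<kappa> y * (y \<bullet> b)) b (?w z))
        = (LINT z|lebesgue. u z * partial_deriv (\<lambda>z. \<kappa> (?w z) * (?w z \<bullet> b)) b z)"
      by (subst integral_mult_right_zero[symmetric]) (simp add: mult_ac)
    also have "\<dots> = - (LINT z|lebesgue. (g z \<bullet> b) * (\<kappa> (?w z) * (?w z \<bullet> b)))"
      by (rule has_weak_gradientD(3)[OF u tw b])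
    finally show ?thesis .
  qed
  have i1: "integrable lebesgue (\<lambda>z. u z * partial_deriv (\<lambda>y. \<kappa> y * (y \<bullet> b)) b (?w z))" if b: "b \<in> Basis" for b
    using integrable_locally_integrable_test[OF has_weak_gradientD(1)[OF u] test_function_scaled[OF test_function_partial_deriv[OF t b] s]]
    by (simp add: mult.commute)
  have i2: "integrable lebesgue (\<lambda>z. (g z \<bullet> b) * (\<kappa> (?w z) * (?w z \<bullet> b)))" for b
    using integrable_locally_integrable_test[OF locally_integrable_inner[OF locg] tw]
    by (simp add: mult.commute)
  have "s * (LINT z|lebesgue. u z * dilation_divergence \<kappa> (?w z))
      = (\<Sum>b\<in>Basis. s * (LINT z|lebesgue. u z * partial_deriv (\<lambda>y. \<kappa> y * (y \<bullet> b)) b (?w z)))"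
    unfolding dilation_divergence_def sum_distrib_left
    by (subst Bochner_Integration.integral_sum[OF i1]) (auto simp: sum_distrib_left)
  also have "\<dots> = - (\<Sum>b\<in>Basis. (LINT z|lebesgue. (g z \<bullet> b) * (\<kappa> (?w z) * (?w z \<bullet> b))))"
    by (simp add: part sum_negf)
  also have "(\<Sum>b\<in>Basis. (LINT z|lebesgue. (g z \<bullet> b) * (\<kappa> (?w z) * (?w z \<bullet> b))))
      = (LINT z|lebesgue. (\<Sum>b\<in>Basis. (g z \<bullet> b) * (\<kappa> (?w z) * (?w z \<bullet> b))))"
    by (rule Bochner_Integration.integral_sum[OF i2, symmetric])
  also have "\<dots> = (LINT z|lebesgue. \<kappa> (?w z) * (g z \<bullet> ?w z))"
    by (subst euclidean_inner) (simp add: sum_distrib_left mult_ac)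
  finally show "(LINT z|lebesgue. u z * dilation_divergence \<kappa> (?w z))
     = - (1 / s) * (LINT z|lebesgue. \<kappa> (?w z) * (g z \<bullet> ?w z))"
    using s by (simp add: field_simps)
qed

section \<open>Pointwise estimates for Sobolev functions\<close>

text \<open>
  Hoelder's inequality against an indicator function, up to a factor 2. It follows from the pointwise
  bound \<open>y \<le> e + e^(1-p) y^p\<close> for \<open>y \<ge> 0\<close> by choosing \<open>e\<close>.
\<close>

lemma integral_over_set_le_Lp:
  fixes f :: "'a::euclidean_space \<Rightarrow> 'b::euclidean_space"
  assumes f: "in_Lp p f" and p: "p > 1" and K: "K \<in> lmeasurable" and le: "measure lebesgue K \<le> m" and m: "m > 0"
  shows "(LINT x|lebesgue. indicator K x * norm (f x))
    \<le> 2 * m powr (1 - 1 / p) * Lp_norm p f"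
proof -
  define A where "A = (LINT x|lebesgue. norm (f x) powr p)"
  have [measurable]: "f \<in> borel_measurable lebesgue" and fp: "integrable lebesgue (\<lambda>x. norm (f x) powr p)"
    using f by (auto simp: in_Lp_def)
  have A0: "A \<ge> 0" unfolding A_def by (intro Bochner_Integration.integral_nonneg) auto
  have i1: "integrable lebesgue (\<lambda>x. indicator K x :: real)"
    using K by (intro integrable_real_indicator) (auto simp: fmeasurable_def)
  have bound: "(LINT x|lebesgue. indicator K x * norm (f x)) \<le> e * m + e powr (1 - p) * A" if e: "e > 0" for e
  proof -
    have pt: "indicator K x * norm (f x) \<le> e * indicator K x + e powr (1 - p) * norm (f x) powr p" for x
    proof (cases "norm (f x) \<le> e")
      case True
      then show ?thesis using e by (auto simp: indicator_def intro: add_increasing2)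
    next
      case False
      then have fx: "norm (f x) > e" by simp
      have "norm (f x) = norm (f x) powr (1 - p) * norm (f x) powr p"
        using fx e by (subst powr_add[symmetric]) simp
      also have "\<dots> \<le> e powr (1 - p) * norm (f x) powr p"
        using fx e p by (intro mult_right_mono powr_mono2') auto
      finally have "norm (f x) \<le> e powr (1 - p) * norm (f x) powr p" .
      then show ?thesis using e by (auto simp: indicator_def)
    qed
    have i2: "integrable lebesgue (\<lambda>x. e * indicator K x + e powr (1 - p) * norm (f x) powr p)"
      using i1 fp by auto
    have "(LINT x|lebesgue. indicator K x * norm (f x))
        \<le> (LINT x|lebesgue. e * indicator K x + e powr (1 - p) * norm (f x) powr p)"
      using e by (intro integral_mono_AE' i2 always_eventually allI pt) auto
    also have "\<dots> = e * measure lebesgue K + e powr (1 - p) * A"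
      using i1 fp K by (simp add: A_def fmeasurable_def)
    also have "\<dots> \<le> e * m + e powr (1 - p) * A" using e le by simp
    finally show ?thesis .
  qed
  show ?thesis
  proof (cases "A = 0")
    case True
    have "((\<lambda>e. e * m) \<longlongrightarrow> 0 * m) (at_right 0)"
      by (intro tendsto_mult tendsto_const tendsto_ident_at)
    then have "((\<lambda>e. e * m + e powr (1 - p) * A) \<longlongrightarrow> 0 * m) (at_right 0)"
      unfolding True by simp
    then have "(LINT x|lebesgue. indicator K x * norm (f x)) \<le> 0 * m"
      by (rule tendsto_lowerbound) (auto simp: eventually_at_right_less intro: eventually_mono[OF eventually_at_right_less] bound)
    then show ?thesis using True p by (simp add: A_def Lp_norm_def)
  next
    case False
    then have A: "A > 0" using A0 by simp
    \<comment> \<open>This value balances the two terms of the bound.\<close>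
    define e where "e = (A / m) powr (1 / p)"
    have e: "e > 0" using A m by (simp add: e_def)
    have pp: "(1 - p) / p = 1 / p - 1" using p by (simp add: diff_divide_distrib)
    have "e * m = m powr (1 - 1 / p) * A powr (1 / p)"
      using A m by (simp add: e_def powr_divide powr_diff)
    moreover have "e powr (1 - p) * A = m powr (1 - 1 / p) * A powr (1 / p)"
    proof -
      have "e powr (1 - p) = (A / m) powr (1 / p - 1)" by (simp add: e_def powr_powr pp)
      also have "\<dots> = (A powr (1 / p) / A) * m powr (1 - 1 / p)"
        using A m powr_minus_divide[of m "1 - 1 / p"] by (simp add: powr_divide powr_diff[of A "1 / p" 1])
      finally show ?thesis using A by simp
    qed
    ultimately show ?thesis using bound[OF e] by (simp add: A_def Lp_norm_def)
  qed
qed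

text \<open>The constant in the pointwise estimates for a kernel bounded by \<open>M\<close> and supported in the ball
  of radius \<open>R\<close>.\<close>

definition kernel_const :: "'a::euclidean_space itself \<Rightarrow> real \<Rightarrow> real \<Rightarrow> real \<Rightarrow> real" where
  "kernel_const _ p M R = 2 * M * (measure lebesgue (cball (0::'a) 1) * R ^ DIM('a)) powr (1 - 1 / p)"

lemma content_unit_cball_pos: "measure lebesgue (cball (0::'a::euclidean_space) 1) > 0"
  by (simp add: content_cball_pos)

lemma integral_scaled_kernel_le:
  fixes f :: "'a::euclidean_space \<Rightarrow> 'b::euclidean_space"
  assumes f: "in_Lp p f" and p: "p > 1" and s: "s > 0" and R: "R > 0" and M: "M > 0"
    and h: "\<And>z. norm (h z) \<le> M * norm (f z)" "\<And>z. norm (s *\<^sub>R (z - x)) > R \<Longrightarrow> h z = 0"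
  shows "norm (LINT z|lebesgue. (h z :: real))
    \<le> kernel_const TYPE('a) p M R * s powr (real DIM('a) / p - real DIM('a))
        * Lp_norm p f"
proof -
  let ?K = "cball x (R / s)"
  let ?\<omega> = "measure lebesgue (cball (0::'a) 1)"
  have hK: "norm (h z) \<le> M * (indicator ?K z * norm (f z))" for z
  proof (cases "z \<in> ?K")
    case False
    then have "norm (s *\<^sub>R (z - x)) > R"
      using s by (simp add: dist_norm norm_minus_commute pos_divide_less_eq mult.commute not_le del: scaleR_diff_right)
    then have "h z = 0" by (rule h(2))
    then show ?thesis using M by simp
  qed (use h(1) in simp)
  have int: "integrable lebesgue (\<lambda>z. indicator ?K z * norm (f z))"
  proof (rule Bochner_Integration.integrable_bound)
    have [measurable]: "f \<in> borel_measurable lebesgue" using f by (simp add: in_Lp_def)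
    show "(\<lambda>z. indicator ?K z * norm (f z)) \<in> borel_measurable lebesgue"
      using borel_measurable_integrable[OF integrable_indicator_cball[of 1 x "R / s"]]
      by (intro borel_measurable_times borel_measurable_norm) simp_all
    show "integrable lebesgue (\<lambda>z. 1 * indicator ?K z + norm (f z) powr p)"
      using f by (intro Bochner_Integration.integrable_add integrable_indicator_cball) (simp add: in_Lp_def)
    show "AE z in lebesgue. norm (indicator ?K z * norm (f z)) \<le> norm (1 * indicator ?K z + norm (f z) powr p)"
    proof (intro always_eventually allI)
      fix z show "norm (indicator ?K z * norm (f z)) \<le> norm (1 * indicator ?K z + norm (f z) powr p)"
      proof (cases "norm (f z) \<le> 1")
        case True then show ?thesis by (auto simp: indicator_def intro: add_increasing2)
      next
        case False
        then have "norm (f z) powr 1 \<le> norm (f z) powr p" using p by (intro powr_mono) auto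
        then show ?thesis using False by (auto simp: indicator_def)
      qed
    qed
  qed
  have content: "measure lebesgue ?K = ?\<omega> * R ^ DIM('a) / s ^ DIM('a)"
    using content_cball[of "R / s" x] content_cball[of 1 "0::'a"] s R by (simp add: power_divide)
  have "norm (LINT z|lebesgue. h z) \<le> (LINT z|lebesgue. norm (h z))" by (rule integral_norm_bound)
  also have "\<dots> \<le> (LINT z|lebesgue. M * (indicator ?K z * norm (f z)))"
    using M by (intro integral_mono_AE' integrable_mult_right int always_eventually allI hK) auto
  also have "\<dots> = M * (LINT z|lebesgue. indicator ?K z * norm (f z))" by simp
  also have "\<dots> \<le> M * (2 * (?\<omega> * R ^ DIM('a) / s ^ DIM('a)) powr (1 - 1 / p)
      * Lp_norm p f)"
    using M R s content content_unit_cball_pos[where 'a='a]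
    by (intro mult_left_mono integral_over_set_le_Lp[OF f p]) auto
  also have "(?\<omega> * R ^ DIM('a) / s ^ DIM('a)) powr (1 - 1 / p)
      = (?\<omega> * R ^ DIM('a)) powr (1 - 1 / p) * s powr (real DIM('a) / p - real DIM('a))"
  proof -
    have "(s ^ DIM('a)) powr (1 - 1 / p) = s powr (real DIM('a) - real DIM('a) / p)"
      using s by (simp add: powr_realpow[symmetric] powr_powr right_diff_distrib)
    then show ?thesis using s R by (simp add: powr_divide powr_diff field_simps)
  qed
  finally show ?thesis by (simp add: kernel_const_def mult_ac)
qed

lemma kernel_average_bound:
  fixes u :: "'a::euclidean_space \<Rightarrow> real"
  assumes u: "in_Lp p u" and p: "p > 1" and s: "s > 0"
    and M: "M > 0" "\<And>w. \<bar>\<kappa> w\<bar> \<le> M" and R: "R > 0" "\<And>w. norm w > R \<Longrightarrow> \<kappa> w = 0"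
  shows "\<bar>kernel_average \<kappa> u x s\<bar> \<le> kernel_const TYPE('a) p M R * s powr (real DIM('a) / p)
    * Lp_norm p u"
proof -
  let ?B = "Lp_norm p u"
  have "norm (LINT z|lebesgue. u z * \<kappa> (s *\<^sub>R (z - x)))
      \<le> kernel_const TYPE('a) p M R * s powr (real DIM('a) / p - real DIM('a)) * Lp_norm p u"
  proof (rule integral_scaled_kernel_le[where x=x, OF u p s R(1) M(1)])
    show "norm (u z * \<kappa> (s *\<^sub>R (z - x))) \<le> M * norm (u z)" for z
      using mult_left_mono[OF M(2)[of "s *\<^sub>R (z - x)"], of "\<bar>u z\<bar>"] by (simp add: abs_mult mult.commute)
    show "u z * \<kappa> (s *\<^sub>R (z - x)) = 0" if "norm (s *\<^sub>R (z - x)) > R" for z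
      using R(2)[OF that] by simp
  qed
  then have "s ^ DIM('a) * \<bar>LINT z|lebesgue. u z * \<kappa> (s *\<^sub>R (z - x))\<bar>
      \<le> s ^ DIM('a) * (kernel_const TYPE('a) p M R * s powr (real DIM('a) / p - real DIM('a)) * ?B)"
    using s by (intro mult_left_mono) auto
  also have "\<dots> = kernel_const TYPE('a) p M R * s powr (real DIM('a) / p) * ?B"
    using s by (simp add: powr_diff powr_realpow)
  finally have "s ^ DIM('a) * \<bar>LINT z|lebesgue. u z * \<kappa> (s *\<^sub>R (z - x))\<bar> \<le> \<dots>" .
  moreover have "kernel_average \<kappa> u x s = s ^ DIM('a) * (LINT z|lebesgue. u z * \<kappa> (s *\<^sub>R (z - x)))"
    unfolding kernel_average_def by (subst integral_mult_right_zero[symmetric]) (simp add: mult_ac)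
  ultimately show ?thesis using s by (simp add: abs_mult)
qed

text \<open>
  The derivative of the average in \<open>s\<close> is bounded by a multiple of \<open>s^(-\<gamma>-1)\<close>; comparing the average with
  an antiderivative of this bound integrates the estimate.
\<close>

lemma kernel_average_diff_bound:
  fixes u :: "'a::euclidean_space \<Rightarrow> real"
  assumes u: "has_weak_gradient u g" and g: "in_Lp p g" and p: "p > real DIM('a)"
    and \<kappa>: "test_function \<kappa>"
    and M: "M > 0" "\<And>w. \<bar>\<kappa> w\<bar> \<le> M" and R: "R > 0" "\<And>w. norm w > R \<Longrightarrow> \<kappa> w = 0"
    and st: "0 < s" "s \<le> t"
  defines "\<gamma> \<equiv> 1 - real DIM('a) / p"
  shows "\<bar>kernel_average \<kappa> u x s - kernel_average \<kappa> u x t\<bar>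
    \<le> kernel_const TYPE('a) p (M * R) R / \<gamma> * Lp_norm p g
        * (s powr - \<gamma> - t powr - \<gamma>)"
proof -
  let ?F = "kernel_average \<kappa> u x"
  let ?F' = "\<lambda>r. r ^ (DIM('a) - 1) * (LINT z|lebesgue. u z * dilation_divergence \<kappa> (r *\<^sub>R (z - x)))"
  define D where "D = kernel_const TYPE('a) p (M * R) R * Lp_norm p g"
  have d: "real DIM('a) \<ge> 1" using DIM_positive[where 'a='a] by linarith
  then have p1: "p > 1" using p by linarith
  have \<gamma>: "\<gamma> > 0" using p p1 by (simp add: \<gamma>_def)
  have der: "(?F has_real_derivative ?F' r) (at r)" if "r > 0" for r
    by (rule kernel_average_has_derivative[OF \<kappa> has_weak_gradientD(1)[OF u] that])
  have der': "((\<lambda>r. - (D / \<gamma>) * r powr - \<gamma>) has_real_derivative D * r powr (- \<gamma> - 1)) (at r)" if "r > 0" for r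
    using that \<gamma> by (auto intro!: derivative_eq_intros)
  have bound: "\<bar>?F' r\<bar> \<le> D * r powr (- \<gamma> - 1)" if r: "r > 0" for r
  proof -
    let ?h = "\<lambda>z. \<kappa> (r *\<^sub>R (z - x)) * (g z \<bullet> (r *\<^sub>R (z - x)))"
    have "norm (LINT z|lebesgue. ?h z)
      \<le> kernel_const TYPE('a) p (M * R) R * r powr (real DIM('a) / p - real DIM('a)) * Lp_norm p g"
    proof (rule integral_scaled_kernel_le[OF g p1 r R(1)])
      show "M * R > 0" using M R by simp
      fix z
      show "?h z = 0" if "norm (r *\<^sub>R (z - x)) > R" using R(2)[OF that] by simp
      show "norm (?h z) \<le> M * R * norm (g z)"
      proof (cases "norm (r *\<^sub>R (z - x)) > R")
        case True
        then show ?thesis using R M by simp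
      next
        case False
        have "norm (?h z) \<le> \<bar>\<kappa> (r *\<^sub>R (z - x))\<bar> * (norm (g z) * norm (r *\<^sub>R (z - x)))"
          unfolding real_norm_def abs_mult by (intro mult_left_mono Cauchy_Schwarz_ineq2) auto
        also have "\<dots> \<le> M * (norm (g z) * R)"
          using False M R by (intro mult_mono) auto
        finally show ?thesis by (simp add: mult_ac)
      qed
    qed
    then have h_le: "\<bar>LINT z|lebesgue. ?h z\<bar> \<le> D * r powr (real DIM('a) / p - real DIM('a))"
      by (simp add: D_def mult_ac)
    have "\<bar>?F' r\<bar> = r ^ (DIM('a) - 1) * (1 / r) * \<bar>LINT z|lebesgue. ?h z\<bar>"
      unfolding integral_against_dilation_divergence[OF \<kappa> u r] using r by (simp add: abs_mult)
    moreover have "r ^ (DIM('a) - 1) * (1 / r) = r powr (real DIM('a) - 2)"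
    proof -
      have "r ^ (DIM('a) - 1) = r powr (real DIM('a) - 1)"
        using r d by (simp add: powr_realpow[symmetric] of_nat_diff)
      then show ?thesis using r powr_diff[of r "real DIM('a) - 1" 1] by simp
    qed
    ultimately have "\<bar>?F' r\<bar> = r powr (real DIM('a) - 2) * \<bar>LINT z|lebesgue. ?h z\<bar>" by (simp only:)
    also have "\<dots> \<le> r powr (real DIM('a) - 2) * (D * r powr (real DIM('a) / p - real DIM('a)))"
      using h_le by (rule mult_left_mono) simp
    also have "\<dots> = D * (r powr (real DIM('a) - 2) * r powr (real DIM('a) / p - real DIM('a)))" by simp
    also have "r powr (real DIM('a) - 2) * r powr (real DIM('a) / p - real DIM('a)) = r powr (- \<gamma> - 1)"
      unfolding powr_add[symmetric] by (simp add: \<gamma>_def)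
    finally show ?thesis .
  qed
  have mono: "c * ?F s + (- (D / \<gamma>) * s powr - \<gamma>) \<le> c * ?F t + (- (D / \<gamma>) * t powr - \<gamma>)" if c: "c = 1 \<or> c = - 1" for c :: real
  proof (rule DERIV_nonneg_imp_nondecreasing[OF st(2)])
    fix r assume "s \<le> r"
    then have r: "r > 0" using st by linarith
    have "((\<lambda>r. c * ?F r + (- (D / \<gamma>) * r powr - \<gamma>)) has_real_derivative c * ?F' r + D * r powr (- \<gamma> - 1)) (at r)"
      by (intro DERIV_add DERIV_cmult der der' r)
    moreover have "0 \<le> c * ?F' r + D * r powr (- \<gamma> - 1)"
      using bound[OF r] c by (auto simp: abs_le_iff)
    ultimately show "\<exists>y. ((\<lambda>r. c * ?F r + (- (D / \<gamma>) * r powr - \<gamma>)) has_real_derivative y) (at r) \<and> 0 \<le> y" by blast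
  qed
  have "\<bar>?F s - ?F t\<bar> \<le> D / \<gamma> * (s powr - \<gamma> - t powr - \<gamma>)"
    using mono[of 1] mono[of "- 1"] by (simp add: abs_le_iff right_diff_distrib)
  then show ?thesis by (simp add: D_def)
qed

lemma continuous_kernel_average:
  fixes u :: "'a::euclidean_space \<Rightarrow> real"
  assumes \<kappa>: "test_function \<kappa>" and u: "locally_integrable u" and s: "s > 0"
  shows "continuous_on UNIV (\<lambda>x. kernel_average \<kappa> u x s)"
proof -
  obtain M where M: "M > 0" "\<And>w. \<bar>\<kappa> w\<bar> \<le> M" using test_function_bounded[OF \<kappa>] by blast
  obtain R where R: "R > 0" "\<And>w. norm w > R \<Longrightarrow> \<kappa> w = 0" using test_function_support[OF \<kappa>] by blast
  have "continuous (at x within ball x 1) (\<lambda>x. kernel_average \<kappa> u x s)" for x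
    unfolding continuous_within_sequentially kernel_average_def comp_def
  proof (intro allI impI, rule integral_bounded_kernels_tendsto[OF u])
    fix X :: "nat \<Rightarrow> 'a" assume X: "(\<forall>n. X n \<in> ball x 1) \<and> X \<longlonglongrightarrow> x"
    show "(\<lambda>z. s ^ DIM('a) * \<kappa> (s *\<^sub>R (z - X n))) \<in> borel_measurable lebesgue" for n
      by (intro borel_measurable_times borel_measurable_const test_functionD(5)[OF test_function_scaled[OF \<kappa> s]])
    show "\<bar>s ^ DIM('a) * \<kappa> (s *\<^sub>R (z - X n))\<bar> \<le> s ^ DIM('a) * M" for n z
      using M s by (simp add: abs_mult)
    fix z
    have "isCont \<kappa> (s *\<^sub>R (z - x))"
      using test_functionD(3)[OF \<kappa>, of UNIV] by (simp add: continuous_on_eq_continuous_at)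
    moreover have "(\<lambda>n. s *\<^sub>R (z - X n)) \<longlonglongrightarrow> s *\<^sub>R (z - x)" using X by (intro tendsto_intros) auto
    ultimately have "(\<lambda>n. \<kappa> (s *\<^sub>R (z - X n))) \<longlonglongrightarrow> \<kappa> (s *\<^sub>R (z - x))"
      by (rule isCont_tendsto_compose)
    then show "(\<lambda>n. s ^ DIM('a) * \<kappa> (s *\<^sub>R (z - X n))) \<longlonglongrightarrow> s ^ DIM('a) * \<kappa> (s *\<^sub>R (z - x))"
      by (intro tendsto_mult tendsto_const)
    fix n
    assume far: "norm z > norm x + 1 + R / s"
    have "norm (X n - x) < 1" using X by (simp add: dist_norm norm_minus_commute)
    then have "R / s < norm (z - X n)"
      using far norm_triangle_ineq2[of z "X n"] norm_triangle_ineq2[of "X n" x] by linarith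
    then have "R < norm (s *\<^sub>R (z - X n))" using s by (simp add: pos_divide_less_eq mult.commute del: scaleR_diff_right)
    then show "s ^ DIM('a) * \<kappa> (s *\<^sub>R (z - X n)) = 0" using R(2) by simp
  qed
  moreover have "at x within ball x 1 = at x" for x :: 'a by (rule at_within_open) auto
  ultimately have "isCont (\<lambda>x. kernel_average \<kappa> u x s) x" for x by (simp only:)
  then show ?thesis by (intro continuous_at_imp_continuous_on) blast
qed

text \<open>
  The exponent \<open>-\<gamma>\<close> is negative precisely because \<open>p > d\<close>, so the averages are uniformly Cauchy as \<open>s\<close>
  tends to infinity, and the limit inherits their continuity.
\<close>

lemma kernel_average_limit:
  fixes u :: "'a::euclidean_space \<Rightarrow> real"
  assumes u: "has_weak_gradient u g" and g: "in_Lp p g" and p: "p > real DIM('a)"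
    and \<kappa>: "test_function \<kappa>"
    and M: "M > 0" "\<And>w. \<bar>\<kappa> w\<bar> \<le> M" and R: "R > 0" "\<And>w. norm w > R \<Longrightarrow> \<kappa> w = 0"
  defines "\<gamma> \<equiv> 1 - real DIM('a) / p"
  obtains v where "continuous_on UNIV v"
    "\<And>x s. s > 0 \<Longrightarrow> \<bar>v x - kernel_average \<kappa> u x s\<bar>
      \<le> kernel_const TYPE('a) p (M * R) R / \<gamma> * Lp_norm p g * s powr - \<gamma>"
proof -
  define D where "D = kernel_const TYPE('a) p (M * R) R / \<gamma> * Lp_norm p g"
  have d: "real DIM('a) \<ge> 1" using DIM_positive[where 'a='a] by linarith
  have \<gamma>: "\<gamma> > 0" using p d by (simp add: \<gamma>_def)
  have D0: "D \<ge> 0" using \<gamma> M R by (simp add: D_def kernel_const_def Lp_norm_def)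
  have diff: "\<bar>kernel_average \<kappa> u x s - kernel_average \<kappa> u x t\<bar> \<le> D * (s powr - \<gamma> - t powr - \<gamma>)"
    if "0 < s" "s \<le> t" for x s t
    using kernel_average_diff_bound[OF u g p \<kappa> M R that, of x] by (simp add: D_def \<gamma>_def)
  define F where "F n x = kernel_average \<kappa> u x (real (Suc n))" for n x
  have diff1: "\<bar>kernel_average \<kappa> u x s - F n x\<bar> \<le> D * s powr - \<gamma>" if "0 < s" "s \<le> real (Suc n)" for x s n
  proof -
    have "\<bar>kernel_average \<kappa> u x s - F n x\<bar> \<le> D * (s powr - \<gamma> - real (Suc n) powr - \<gamma>)"
      unfolding F_def by (rule diff[OF that])
    also have "\<dots> \<le> D * s powr - \<gamma>" using D0 by (intro mult_left_mono) auto
    finally show ?thesis .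
  qed
  have lim0: "(\<lambda>n. D * real (Suc n) powr - \<gamma>) \<longlonglongrightarrow> 0"
  proof -
    have "filterlim (\<lambda>n. real (Suc n)) at_top sequentially"
      using filterlim_Suc filterlim_real_sequentially by (rule filterlim_compose[rotated])
    from tendsto_neg_powr[OF _ this, of "- \<gamma>"] have "(\<lambda>n. real (Suc n) powr - \<gamma>) \<longlonglongrightarrow> 0" using \<gamma> by simp
    from tendsto_mult[OF tendsto_const this, of D] show ?thesis by simp
  qed
  have "Cauchy (\<lambda>n. F n x)" for x
  proof (rule metric_CauchyI)
    fix e :: real assume "e > 0"
    then obtain N where N: "D * real (Suc N) powr - \<gamma> < e / 2"
      using order_tendstoD(2)[OF lim0, of "e / 2"] by (auto simp: eventually_sequentially)
    have "dist (F N x) (F n x) < e / 2" if "n \<ge> N" for n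
      using diff1[of "real (Suc N)" n x] that N by (simp add: F_def dist_real_def)
    then show "\<exists>N. \<forall>m\<ge>N. \<forall>n\<ge>N. dist (F m x) (F n x) < e"
      by (metis dist_triangle_half_r)
  qed
  then have "\<exists>l. (\<lambda>n. F n x) \<longlonglongrightarrow> l" for x by (simp add: Cauchy_convergent_iff convergent_def)
  then obtain v where v: "\<And>x. (\<lambda>n. F n x) \<longlonglongrightarrow> v x" by metis
  have bound: "\<bar>v x - kernel_average \<kappa> u x s\<bar> \<le> D * s powr - \<gamma>" if s: "s > 0" for x s
  proof (rule tendsto_upperbound)
    show "(\<lambda>n. \<bar>F n x - kernel_average \<kappa> u x s\<bar>) \<longlonglongrightarrow> \<bar>v x - kernel_average \<kappa> u x s\<bar>"
      by (intro tendsto_intros v)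
    obtain N where "s \<le> real N" using real_arch_simple by blast
    then have "\<bar>F n x - kernel_average \<kappa> u x s\<bar> \<le> D * s powr - \<gamma>" if "n \<ge> N" for n
      using diff1[of s n x] s that by (simp add: abs_minus_commute)
    then show "\<forall>\<^sub>F n in sequentially. \<bar>F n x - kernel_average \<kappa> u x s\<bar> \<le> D * s powr - \<gamma>"
      by (auto simp: eventually_sequentially)
  qed simp
  have "uniform_limit UNIV F v sequentially"
  proof (rule uniform_limitI)
    fix e :: real assume "e > 0"
    from order_tendstoD(2)[OF lim0 this]
    show "\<forall>\<^sub>F n in sequentially. \<forall>x\<in>UNIV. dist (F n x) (v x) < e"
    proof eventually_elim
      case (elim n)
      have "dist (F n x) (v x) \<le> D * real (Suc n) powr - \<gamma>" for x
        using bound[of "real (Suc n)" x] by (simp add: F_def dist_real_def abs_minus_commute)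
      with elim show ?case by (meson le_less_trans)
    qed
  qed
  then have "continuous_on UNIV v"
    by (rule uniform_limit_theorem[rotated])
       (auto simp: F_def intro!: always_eventually continuous_kernel_average \<kappa> has_weak_gradientD(1)[OF u])
  then show ?thesis using that bound by (simp add: D_def)
qed

text \<open>
  Fubini's theorem is applied on the Borel product measure, to a Borel version of \<open>u\<close> that is cut off outside
  a ball containing the support of \<open>k\<close>.
\<close>

lemma Fubini_kernel:
  fixes u :: "'a::euclidean_space \<Rightarrow> real" and k :: "'a \<times> 'a \<Rightarrow> real"
  assumes u: "locally_integrable u" and k: "continuous_on UNIV k" and M: "\<And>y. \<bar>k y\<bar> \<le> M"
    and R: "\<And>z x. norm z > R \<or> norm x > R \<Longrightarrow> k (z, x) = 0"
  shows "(LINT x|lebesgue. LINT z|lebesgue. u z * k (z, x)) = (LINT z|lebesgue. u z * (LINT x|lebesgue. k (z, x)))"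
    and "(\<lambda>z. LINT x|lebesgue. k (z, x)) \<in> borel_measurable lebesgue"
proof -
  define v where "v z = indicator (cball 0 R) z * u z" for z
  have v: "integrable lebesgue v"
    using u unfolding v_def locally_integrable_def set_integrable_def by auto
  obtain u' where [measurable]: "u' \<in> borel_measurable lborel" and ae: "AE z in lborel. v z = u' z"
    using completion_ex_borel_measurable_real[of v lborel] borel_measurable_integrable[OF v] by blast
  have ae: "AE z in lebesgue. v z = u' z" using ae by (rule AE_completion)
  have u'm: "u' \<in> borel_measurable lebesgue" by (rule measurable_completion) measurable
  have "integrable lebesgue u'"
    using integrable_cong_AE_imp[OF v u'm ae] .
  then have u': "integrable lborel u'" by (simp add: integrable_completion)
  have kb[measurable]: "k \<in> borel_measurable (lborel \<Otimes>\<^sub>M lborel)"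
    unfolding lborel_prod using borel_measurable_continuous_onI[OF k] by simp
  have k1: "(\<lambda>z. k (z, x)) \<in> borel_measurable lborel" for x by measurable
  have k2[measurable]: "(\<lambda>x. k (z, x)) \<in> borel_measurable lborel" for z by measurable
  have kint: "(LINT x|lebesgue. k (z, x)) = (LINT x|lborel. k (z, x))" for z
    by (rule integral_completion) simp
  have I[measurable]: "(\<lambda>z. LINT x|lborel. k (z, x)) \<in> borel_measurable lborel" by measurable
  then show meas: "(\<lambda>z. LINT x|lebesgue. k (z, x)) \<in> borel_measurable lebesgue"
    unfolding kint by (rule measurable_completion)
  have "M \<ge> 0" using M[of undefined] by linarith
  have swap: "(LINT z|lebesgue. u z * h z) = (LINT z|lborel. u' z * h z)"
    if h: "h \<in> borel_measurable lborel" and h0: "\<And>z. norm z > R \<Longrightarrow> h z = 0" for h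
  proof -
    have hm: "h \<in> borel_measurable lebesgue" using h by (rule measurable_completion)
    have "u z * h z = v z * h z" for z
      using h0[of z] by (auto simp: v_def indicator_def not_le)
    then have "(LINT z|lebesgue. u z * h z) = (LINT z|lebesgue. v z * h z)" by (simp only:)
    also have "\<dots> = (LINT z|lebesgue. u' z * h z)"
    proof (rule integral_cong_AE)
      show "AE z in lebesgue. v z * h z = u' z * h z" using ae by eventually_elim simp
    qed (intro borel_measurable_times hm u'm borel_measurable_integrable[OF v])+
    also have "\<dots> = (LINT z|lborel. u' z * h z)"
      by (rule integral_completion) (use h in measurable)
    finally show ?thesis .
  qed
  have kz: "integrable lborel (\<lambda>x. k (z, x))" and kz_le: "(LINT x|lborel. \<bar>k (z, x)\<bar>) \<le> M * measure lebesgue (cball (0::'a) R)" for z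
  proof -
    have pt: "\<bar>k (z, x)\<bar> \<le> M * indicator (cball 0 R) x" for x
      using M[of "(z, x)"] R[of z x] by (cases "norm x \<le> R") auto
    have i: "integrable lborel (\<lambda>x. M * indicator (cball (0::'a) R) x :: real)"
    proof -
      have "(\<lambda>x. M * indicator (cball (0::'a) R) x :: real) \<in> borel_measurable lborel"
        by (intro borel_measurable_times borel_measurable_indicator) auto
      from integrable_completion[OF this, THEN iffD1, OF integrable_indicator_cball] show ?thesis .
    qed
    show "integrable lborel (\<lambda>x. k (z, x))"
      by (rule Bochner_Integration.integrable_bound[OF i]) (use pt in \<open>auto intro: order_trans[OF _ abs_ge_self]\<close>)
    have "(LINT x|lborel. \<bar>k (z, x)\<bar>) \<le> (LINT x|lborel. M * indicator (cball (0::'a) R) x)"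
      by (rule integral_mono_AE'[OF i]) (use pt \<open>M \<ge> 0\<close> in auto)
    then show "(LINT x|lborel. \<bar>k (z, x)\<bar>) \<le> M * measure lebesgue (cball (0::'a) R)"
      by (simp add: measure_completion)
  qed
  have "integrable (lborel \<Otimes>\<^sub>M lborel) (\<lambda>(z, x). u' z * k (z, x))"
  proof (rule lborel_pair.Fubini_integrable)
    show "integrable lborel (\<lambda>z. LINT x|lborel. norm (case (z, x) of (z, x) \<Rightarrow> u' z * k (z, x)))"
    proof (rule Bochner_Integration.integrable_bound)
      show "integrable lborel (\<lambda>z. M * measure lebesgue (cball (0::'a) R) * u' z)" using u' by simp
      show "AE z in lborel. norm (LINT x|lborel. norm (case (z, x) of (z, x) \<Rightarrow> u' z * k (z, x)))
          \<le> norm (M * measure lebesgue (cball (0::'a) R) * u' z)"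
      proof (intro always_eventually allI)
        fix z
        have "norm (LINT x|lborel. norm (case (z, x) of (z, x) \<Rightarrow> u' z * k (z, x)))
            = \<bar>u' z\<bar> * (LINT x|lborel. \<bar>k (z, x)\<bar>)"
          by (simp add: abs_mult integral_nonneg_AE)
        also have "\<dots> \<le> \<bar>u' z\<bar> * (M * measure lebesgue (cball (0::'a) R))"
          by (intro mult_left_mono kz_le) auto
        finally show "norm (LINT x|lborel. norm (case (z, x) of (z, x) \<Rightarrow> u' z * k (z, x)))
          \<le> norm (M * measure lebesgue (cball (0::'a) R) * u' z)"
          using \<open>M \<ge> 0\<close> by (simp add: abs_mult mult_ac)
      qed
    qed measurable
    show "AE z in lborel. integrable lborel (\<lambda>x. case (z, x) of (z, x) \<Rightarrow> u' z * k (z, x))"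
      using kz by simp
  qed measurable
  from lborel_pair.Fubini_integral[OF this]
  have "(LINT x|lborel. LINT z|lborel. u' z * k (z, x)) = (LINT z|lborel. LINT x|lborel. u' z * k (z, x))" .
  moreover have "(LINT x|lebesgue. LINT z|lebesgue. u z * k (z, x)) = (LINT x|lborel. LINT z|lborel. u' z * k (z, x))"
  proof -
    have "(LINT z|lebesgue. u z * k (z, x)) = (LINT z|lborel. u' z * k (z, x))" for x
      by (rule swap[OF k1]) (use R in blast)
    moreover have "(\<lambda>x. LINT z|lborel. u' z * k (z, x)) \<in> borel_measurable lborel" by measurable
    ultimately show ?thesis by (simp add: integral_completion)
  qed
  moreover have "(LINT z|lebesgue. u z * (LINT x|lebesgue. k (z, x))) = (LINT z|lborel. LINT x|lborel. u' z * k (z, x))"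
    unfolding kint by (subst swap[OF I]) (use R in auto)
  ultimately show "(LINT x|lebesgue. LINT z|lebesgue. u z * k (z, x)) = (LINT z|lebesgue. u z * (LINT x|lebesgue. k (z, x)))"
    by simp
qed

text \<open>
  By Fubini's theorem, averaging \<open>u\<close> amounts to averaging the test function against the reflected kernel,
  and the averages of a continuous function converge to it pointwise and boundedly.
\<close>

lemma kernel_average_weak_limit:
  fixes u :: "'a::euclidean_space \<Rightarrow> real"
  assumes \<kappa>: "test_function \<kappa>" and one: "(LINT w|lebesgue. \<kappa> w) = 1"
    and u: "locally_integrable u" and \<phi>: "test_function \<phi>"
  shows "(\<lambda>n. LINT x|lebesgue. kernel_average \<kappa> u x (real (Suc n)) * \<phi> x) \<longlonglongrightarrow> (LINT x|lebesgue. u x * \<phi> x)"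
proof -
  obtain M where M: "M > 0" "\<And>w. \<bar>\<kappa> w\<bar> \<le> M" using test_function_bounded[OF \<kappa>] by blast
  obtain R where R: "R > 0" "\<And>w. norm w > R \<Longrightarrow> \<kappa> w = 0" using test_function_support[OF \<kappa>] by blast
  obtain M' where M': "M' > 0" "\<And>w. \<bar>\<phi> w\<bar> \<le> M'" using test_function_bounded[OF \<phi>] by blast
  obtain R' where R': "R' > 0" "\<And>w. norm w > R' \<Longrightarrow> \<phi> w = 0" using test_function_support[OF \<phi>] by blast
  define s where "s n = real (Suc n)" for n
  have s: "s n \<ge> 1" "s n > 0" for n by (auto simp: s_def)
  define k where "k n y = s n ^ DIM('a) * \<kappa> (s n *\<^sub>R (fst y - snd y)) * \<phi> (snd y)" for n and y :: "'a \<times> 'a"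
  define I where "I n z = (LINT x|lebesgue. k n (z, x))" for n z
  have k_supp: "k n (z, x) = 0" if "norm z > R + R' \<or> norm x > R + R'" for n z x
  proof (rule ccontr)
    assume "k n (z, x) \<noteq> 0"
    then have "norm x \<le> R'" "norm (s n *\<^sub>R (z - x)) \<le> R"
      using R(2)[of "s n *\<^sub>R (z - x)"] R'(2)[of x] by (auto simp: k_def not_le[symmetric] simp del: scaleR_diff_right)
    moreover have "norm (z - x) \<le> norm (s n *\<^sub>R (z - x))" using s[of n] mult_right_mono[of 1 "s n" "norm (z - x)"] by simp
    moreover have "norm z \<le> norm (z - x) + norm x" using norm_triangle_ineq[of "z - x" x] by simp
    ultimately show False using that R R' by linarith
  qed
  have k_cont: "continuous_on UNIV (k n)" for n
    unfolding k_def
    by (intro continuous_intros continuous_on_compose2[OF test_functionD(3)[OF \<kappa>, of UNIV]]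
        continuous_on_compose2[OF test_functionD(3)[OF \<phi>, of UNIV]]) auto
  have k_bd: "\<bar>k n y\<bar> \<le> s n ^ DIM('a) * M * M'" for n y
    unfolding k_def abs_mult using M M' s[of n] by (intro mult_mono) auto
  have fub: "(LINT x|lebesgue. LINT z|lebesgue. u z * k n (z, x)) = (LINT z|lebesgue. u z * (LINT x|lebesgue. k n (z, x)))"
    "(\<lambda>z. LINT x|lebesgue. k n (z, x)) \<in> borel_measurable lebesgue" for n
    using Fubini_kernel[OF u k_cont[of n] k_bd[of n], of "R + R'"] k_supp[of _ _ n] by blast+
  have eq: "(LINT x|lebesgue. kernel_average \<kappa> u x (s n) * \<phi> x) = (LINT z|lebesgue. u z * I n z)" for n
  proof -
    have "kernel_average \<kappa> u x (s n) * \<phi> x = (LINT z|lebesgue. u z * k n (z, x))" for x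
      unfolding kernel_average_def k_def
      by (subst integral_mult_left_zero[symmetric]) (simp add: mult_ac)
    then show ?thesis using fub(1)[of n] by (simp add: I_def)
  qed
  have I_eq: "I n z = (LINT w|lebesgue. \<kappa> w * \<phi> (z - (1 / s n) *\<^sub>R w))" for n z
  proof -
    have sn: "- s n \<noteq> 0" using s[of n] by simp
    have "z - (1 / s n) *\<^sub>R (- s n *\<^sub>R (x - z)) = x" for x using s(2)[of n] by simp
    moreover have "- s n *\<^sub>R (x - z) = s n *\<^sub>R (z - x)" for x by (simp add: algebra_simps)
    ultimately have "I n z = s n ^ DIM('a) * (LINT x|lebesgue. \<kappa> (- s n *\<^sub>R (x - z)) * \<phi> (z - (1 / s n) *\<^sub>R (- s n *\<^sub>R (x - z))))"
      unfolding I_def k_def by (subst integral_mult_right_zero[symmetric]) (simp only: fst_conv snd_conv mult.assoc)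
    also have "\<dots> = (LINT w|lebesgue. \<kappa> w * \<phi> (z - (1 / s n) *\<^sub>R w))"
      using s(2)[of n] by (subst integral_scaled[OF sn, of "\<lambda>w. \<kappa> w * \<phi> (z - (1 / s n) *\<^sub>R w)"]) simp
    finally show ?thesis .
  qed
  have m: "(\<lambda>w. \<kappa> w * \<phi> (z - (1 / s n) *\<^sub>R w)) \<in> borel_measurable lebesgue" for n z
  proof -
    have "continuous_on UNIV (\<lambda>w. \<kappa> w * \<phi> (z - (1 / s n) *\<^sub>R w))"
      by (intro continuous_intros test_functionD(3)[OF \<kappa>] continuous_on_compose2[OF test_functionD(3)[OF \<phi>, of UNIV]]) auto
    from borel_measurable_continuous_onI[OF this] show ?thesis by (intro measurable_completion) simp
  qed
  have pt: "norm (\<kappa> w * \<phi> (z - (1 / s n) *\<^sub>R w)) \<le> M' * \<bar>\<kappa> w\<bar>" for n z w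
    using mult_left_mono[OF M'(2)[of "z - (1 / s n) *\<^sub>R w"], of "\<bar>\<kappa> w\<bar>"] by (simp add: abs_mult mult.commute)
  have \<kappa>_int: "integrable lebesgue (\<lambda>w. M' * \<bar>\<kappa> w\<bar>)"
    using test_function_integrable[OF \<kappa>] by simp
  have I_lim: "(\<lambda>n. I n z) \<longlonglongrightarrow> \<phi> z" for z
  proof -
    have "(\<lambda>n. LINT w|lebesgue. \<kappa> w * \<phi> (z - (1 / s n) *\<^sub>R w)) \<longlonglongrightarrow> (LINT w|lebesgue. \<kappa> w * \<phi> z)"
    proof (rule integral_dominated_convergence[OF _ m \<kappa>_int])
      show "(\<lambda>w. \<kappa> w * \<phi> z) \<in> borel_measurable lebesgue" using test_functionD(5)[OF \<kappa>] by (intro borel_measurable_times) auto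
      show "AE w in lebesgue. (\<lambda>n. \<kappa> w * \<phi> (z - (1 / s n) *\<^sub>R w)) \<longlonglongrightarrow> \<kappa> w * \<phi> z"
      proof (intro always_eventually allI tendsto_mult tendsto_const)
        fix w
        have "(\<lambda>n. 1 / s n) \<longlonglongrightarrow> 0" unfolding s_def using LIMSEQ_inverse_real_of_nat by (simp add: inverse_eq_divide)
        then have "(\<lambda>n. z - (1 / s n) *\<^sub>R w) \<longlonglongrightarrow> z - 0 *\<^sub>R w" by (intro tendsto_intros)
        then have "(\<lambda>n. z - (1 / s n) *\<^sub>R w) \<longlonglongrightarrow> z" by simp
        moreover have "isCont \<phi> z" using test_functionD(3)[OF \<phi>, of UNIV] by (simp add: continuous_on_eq_continuous_at)
        ultimately show "(\<lambda>n. \<phi> (z - (1 / s n) *\<^sub>R w)) \<longlonglongrightarrow> \<phi> z" by (rule isCont_tendsto_compose[rotated])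
      qed
      show "AE w in lebesgue. norm (\<kappa> w * \<phi> (z - (1 / s n) *\<^sub>R w)) \<le> M' * \<bar>\<kappa> w\<bar>" for n using pt by simp
    qed
    then show ?thesis unfolding I_eq using one by simp
  qed
  define L where "L = (LINT w|lebesgue. M' * \<bar>\<kappa> w\<bar>)"
  have I_bd: "\<bar>I n z\<bar> \<le> L" for n z
  proof -
    have "norm (LINT w|lebesgue. \<kappa> w * \<phi> (z - (1 / s n) *\<^sub>R w)) \<le> (LINT w|lebesgue. norm (\<kappa> w * \<phi> (z - (1 / s n) *\<^sub>R w)))"
      by (rule integral_norm_bound)
    also have "\<dots> \<le> L" unfolding L_def by (rule integral_mono_AE'[OF \<kappa>_int]) (use pt M' in auto)
    finally show ?thesis unfolding I_eq by simp
  qed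
  have "(\<lambda>n. LINT z|lebesgue. u z * I n z) \<longlonglongrightarrow> (LINT z|lebesgue. u z * \<phi> z)"
  proof (rule integral_bounded_kernels_tendsto[OF u _ I_bd _ I_lim])
    show "I n z = 0" if "norm z > R + R'" for n z
      unfolding I_def using k_supp that by simp
  qed (rule fub(2)[folded I_def])
  then show ?thesis using eq by (simp only: s_def)
qed

section \<open>Morrey's inequality and the sharp Sobolev constant\<close>

lemma continuous_AE_eq:
  fixes f g :: "'a::euclidean_space \<Rightarrow> real"
  assumes "continuous_on UNIV f" "continuous_on UNIV g" "AE x in lebesgue. f x = g x"
  shows "f x = g x"
proof -
  have "closed {x. f x = g x}" using assms by (intro closed_Collect_eq)
  from mem_closed_if_AE_lebesgue[OF this, of x] assms(3) show ?thesis by simp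
qed

text \<open>
  A uniform limit of the averages is also their weak limit, which is \<open>u\<close>.
\<close>

lemma limit_of_averages_AE_eq:
  fixes u v :: "'a::euclidean_space \<Rightarrow> real"
  assumes \<kappa>: "test_function \<kappa>" "(LINT w|lebesgue. \<kappa> w) = 1"
    and u: "locally_integrable u" and v: "continuous_on UNIV v"
    and c: "c \<longlonglongrightarrow> 0" "\<And>x n. \<bar>v x - kernel_average \<kappa> u x (real (Suc n))\<bar> \<le> c n"
  shows "AE x in lebesgue. u x = v x"
proof -
  have vl: "locally_integrable v" by (rule locally_integrable_continuous[OF v])
  have "AE x in lebesgue. u x - v x = 0"
  proof (rule fundamental_lemma)
    show "locally_integrable (\<lambda>x. u x - v x)" by (intro locally_integrable_diff u vl)
    fix \<phi> :: "'a \<Rightarrow> real" assume \<phi>: "test_function \<phi>"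
    have int: "integrable lebesgue (\<lambda>x. w x * \<phi> x)" if "locally_integrable w" for w :: "'a \<Rightarrow> real"
      using integrable_locally_integrable_test[OF that \<phi>] by (simp add: mult.commute)
    let ?F = "\<lambda>n x. kernel_average \<kappa> u x (real (Suc n))"
    have F: "locally_integrable (?F n)" for n
      by (intro locally_integrable_continuous continuous_kernel_average \<kappa> u) simp
    have "(\<lambda>n. LINT x|lebesgue. ?F n x * \<phi> x) \<longlonglongrightarrow> (LINT x|lebesgue. v x * \<phi> x)"
    proof (rule LIM_zero_cancel, rule Lim_null_comparison)
      have "norm ((LINT x|lebesgue. ?F n x * \<phi> x) - (LINT x|lebesgue. v x * \<phi> x)) \<le> c n * (LINT x|lebesgue. \<bar>\<phi> x\<bar>)" for n
      proof -
        have "(LINT x|lebesgue. ?F n x * \<phi> x) - (LINT x|lebesgue. v x * \<phi> x) = (LINT x|lebesgue. ?F n x * \<phi> x - v x * \<phi> x)"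
          by (rule Bochner_Integration.integral_diff[symmetric]) (intro int F vl)+
        then have "norm ((LINT x|lebesgue. ?F n x * \<phi> x) - (LINT x|lebesgue. v x * \<phi> x))
            \<le> (LINT x|lebesgue. norm (?F n x * \<phi> x - v x * \<phi> x))" by (simp only: integral_norm_bound)
        also have "\<dots> \<le> (LINT x|lebesgue. c n * \<bar>\<phi> x\<bar>)"
        proof (rule integral_mono_AE')
          show "integrable lebesgue (\<lambda>x. c n * \<bar>\<phi> x\<bar>)" using test_function_integrable[OF \<phi>] by simp
          have "norm (?F n x * \<phi> x - v x * \<phi> x) \<le> c n * \<bar>\<phi> x\<bar>" for x
            using mult_right_mono[OF c(2)[of x n], of "\<bar>\<phi> x\<bar>"]
            by (simp add: abs_minus_commute abs_mult[symmetric] left_diff_distrib)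
          then show "AE x in lebesgue. norm (?F n x * \<phi> x - v x * \<phi> x) \<le> c n * \<bar>\<phi> x\<bar>" by simp
          have "0 \<le> c n" using c(2)[of undefined n] by linarith
          then show "AE x in lebesgue. 0 \<le> c n * \<bar>\<phi> x\<bar>" by simp
        qed
        finally show ?thesis by simp
      qed
      then show "\<forall>\<^sub>F n in sequentially. norm ((LINT x|lebesgue. ?F n x * \<phi> x) - (LINT x|lebesgue. v x * \<phi> x)) \<le> c n * (LINT x|lebesgue. \<bar>\<phi> x\<bar>)"
        by simp
      show "(\<lambda>n. c n * (LINT x|lebesgue. \<bar>\<phi> x\<bar>)) \<longlonglongrightarrow> 0" using c(1) by (rule tendsto_mult_left_zero)
    qed
    from LIMSEQ_unique[OF this kernel_average_weak_limit[OF \<kappa> u \<phi>]]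
    show "(LINT x|lebesgue. (u x - v x) * \<phi> x) = 0"
      using int[OF u] int[OF vl] by (simp add: left_diff_distrib)
  qed
  then show ?thesis by eventually_elim simp
qed

lemma exists_normalized_kernel:
  obtains \<kappa> :: "'a::euclidean_space \<Rightarrow> real" where "test_function \<kappa>" "(LINT w|lebesgue. \<kappa> w) = 1"
proof -
  define f where "f = box_bump (- One) (One::'a) 0"
  have f: "test_function f" unfolding f_def by (rule test_function_box_bump)
  have nn: "0 \<le> f x" for x unfolding f_def by (rule box_bump_bounds)
  have "f 0 > 0" unfolding f_def by (rule box_bump_pos) (simp add: mem_box)
  then have "\<not> (AE x in lebesgue. f x = 0)"
    using continuous_AE_eq[OF test_functionD(3)[OF f, of UNIV], of "\<lambda>_. 0" 0] by auto
  then have "(LINT w|lebesgue. f w) \<noteq> 0"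
    using integral_nonneg_eq_0_iff_AE[OF test_function_integrable[OF f]] nn by simp
  then have "(LINT x|lebesgue. f x * (1 / (LINT w|lebesgue. f w))) = 1"
    by (subst integral_mult_left_zero) simp
  moreover have "test_function (\<lambda>x. f x * (1 / (LINT w|lebesgue. f w)))"
    by (intro test_function_mult f C_k_const)
  ultimately show ?thesis by (intro that)
qed

abbreviation gradient_energy :: "real \<Rightarrow> ('a::euclidean_space \<Rightarrow> real) \<Rightarrow> real" where
  "gradient_energy p u \<equiv> LINT x|lebesgue. norm (weak_gradient u x) powr p"

abbreviation Lp_mass :: "real \<Rightarrow> ('a::euclidean_space \<Rightarrow> real) \<Rightarrow> real" where
  "Lp_mass p u \<equiv> LINT x|lebesgue. \<bar>u x\<bar> powr p"

lemma gradient_energy_nonneg: "0 \<le> gradient_energy p u" and Lp_mass_nonneg: "0 \<le> Lp_mass p u"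
  by (intro Bochner_Integration.integral_nonneg; simp)+

definition continuous_version :: "('a::euclidean_space \<Rightarrow> real) \<Rightarrow> ('a \<Rightarrow> real) \<Rightarrow> bool" where
  "continuous_version u v \<longleftrightarrow> continuous_on UNIV v \<and> (AE x in lebesgue. u x = v x)"

lemma kernel_average_translate:
  fixes \<kappa> :: "'a::euclidean_space \<Rightarrow> real"
  assumes "s > 0"
  shows "kernel_average (\<lambda>w. \<kappa> (w - s *\<^sub>R (y - x))) u x s = kernel_average \<kappa> u y s"
  unfolding kernel_average_def by (simp add: algebra_simps)

text \<open>
  The first estimate compares the continuous version with its average at length \<open>1 / s\<close>, and bounds the
  average by the \<open>L^p\<close> norm. For the second, let \<open>t = s(y - x)\<close>: the average of \<open>u\<close> about \<open>y\<close> with kernel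
  \<open>\<kappa>\<close> is its average about \<open>x\<close> with the kernel translated by \<open>t\<close>. For \<open>|t| \<le> 1\<close> the translated kernels
  share one bound and one support radius, hence one constant, so both \<open>v x\<close> and \<open>v y\<close> are close to this
  common average.
\<close>

theorem Morrey:
  assumes p: "p > real DIM('a)"
  defines "\<gamma> \<equiv> 1 - real DIM('a) / p"
  obtains C where "C > 0"
    "\<And>u :: 'a::euclidean_space \<Rightarrow> real. u \<in> W1p p \<Longrightarrow> \<exists>v. continuous_version u v \<and>
       (\<forall>x s. s > 0 \<longrightarrow> \<bar>v x\<bar> \<le> C * (gradient_energy p u powr (1 / p) * s powr - \<gamma>
                                         + Lp_mass p u powr (1 / p) * s powr (real DIM('a) / p))) \<and>
       (\<forall>x y s. s > 0 \<longrightarrow> s * norm (y - x) \<le> 1 \<longrightarrow>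
          \<bar>v x - v y\<bar> \<le> C * (gradient_energy p u powr (1 / p) * s powr - \<gamma>))"
proof -
  have d: "real DIM('a) \<ge> 1" using DIM_positive[where 'a='a] by linarith
  then have p1: "p > 1" using p by linarith
  have \<gamma>: "\<gamma> > 0" using p p1 by (simp add: \<gamma>_def)
  obtain \<kappa> :: "'a \<Rightarrow> real" where \<kappa>: "test_function \<kappa>" "(LINT w|lebesgue. \<kappa> w) = 1"
    by (rule exists_normalized_kernel)
  obtain M where M: "M > 0" "\<And>w. \<bar>\<kappa> w\<bar> \<le> M" using test_function_bounded[OF \<kappa>(1)] by blast
  obtain R where R: "R > 0" "\<And>w. norm w > R \<Longrightarrow> \<kappa> w = 0" using test_function_support[OF \<kappa>(1)] by blast
  have R1: "R + 1 > 0" using R by simp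
  define K where "K = kernel_const TYPE('a) p (M * (R + 1)) (R + 1) / \<gamma>"
  define K' where "K' = kernel_const TYPE('a) p M (R + 1)"
  have K: "K \<ge> 0" "K' \<ge> 0" using M R \<gamma> by (auto simp: K_def K'_def kernel_const_def)
  \<comment> \<open>Translates by at most 1 are supported in the ball of radius \<open>R + 1\<close>.\<close>
  define \<kappa>t where "\<kappa>t t w = \<kappa> (w - t)" for t w
  have \<kappa>t: "test_function (\<kappa>t t)" "(LINT w|lebesgue. \<kappa>t t w) = 1" for t
    using test_function_scaled[OF \<kappa>(1), of 1 t] integral_scaled[of 1 \<kappa> t] \<kappa>(2) by (simp_all add: \<kappa>t_def[abs_def])
  have \<kappa>tM: "\<bar>\<kappa>t t w\<bar> \<le> M" for t w by (simp add: \<kappa>t_def M)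
  have \<kappa>tR: "\<kappa>t t w = 0" if "norm t \<le> 1" "norm w > R + 1" for t w
  proof -
    have "norm (w - t) > R" using that norm_triangle_ineq2[of w t] by linarith
    then show ?thesis by (simp add: \<kappa>t_def R)
  qed
  have main: "\<exists>v. continuous_version u v \<and>
       (\<forall>x s. s > 0 \<longrightarrow> \<bar>v x\<bar> \<le> (2 * K + K' + 1) * (gradient_energy p u powr (1 / p) * s powr - \<gamma>
                                         + Lp_mass p u powr (1 / p) * s powr (real DIM('a) / p))) \<and>
       (\<forall>x y s. s > 0 \<longrightarrow> s * norm (y - x) \<le> 1 \<longrightarrow>
          \<bar>v x - v y\<bar> \<le> (2 * K + K' + 1) * (gradient_energy p u powr (1 / p) * s powr - \<gamma>))"
    if uW: "u \<in> W1p p" for u :: "'a \<Rightarrow> real"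
  proof -
    note u = W1p_weak_gradient[OF uW]
    define a where "a = gradient_energy p u powr (1 / p)"
    define b where "b = Lp_mass p u powr (1 / p)"
    have a0: "a \<ge> 0" and b0: "b \<ge> 0" by (simp_all add: a_def b_def)
    have lim: "\<exists>v. continuous_version u v \<and> (\<forall>x s. s > 0 \<longrightarrow> \<bar>v x - kernel_average (\<kappa>t t) u x s\<bar> \<le> K * a * s powr - \<gamma>)"
      if t: "norm t \<le> 1" for t
    proof -
      obtain v where v: "continuous_on UNIV v"
        "\<And>x s. s > 0 \<Longrightarrow> \<bar>v x - kernel_average (\<kappa>t t) u x s\<bar> \<le> K * a * s powr - \<gamma>"
        using kernel_average_limit[OF u(1,2) p \<kappa>t(1) M(1) \<kappa>tM R1 \<kappa>tR[OF t]]
        unfolding K_def a_def \<gamma>_def Lp_norm_def by metis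
      have c0: "(\<lambda>n. K * a * real (Suc n) powr - \<gamma>) \<longlonglongrightarrow> 0"
      proof -
        have "filterlim (\<lambda>n. real (Suc n)) at_top sequentially"
          using filterlim_Suc filterlim_real_sequentially by (rule filterlim_compose[rotated])
        from tendsto_neg_powr[OF _ this, of "- \<gamma>"] have "(\<lambda>n. real (Suc n) powr - \<gamma>) \<longlonglongrightarrow> 0" using \<gamma> by simp
        from tendsto_mult[OF tendsto_const this, of "K * a"] show ?thesis by simp
      qed
      have "AE x in lebesgue. u x = v x"
        by (rule limit_of_averages_AE_eq[OF \<kappa>t has_weak_gradientD(1)[OF u(1)] v(1) c0 v(2)]) simp
      with v show ?thesis unfolding continuous_version_def by blast
    qed
    have \<kappa>t0: "\<kappa>t 0 = \<kappa>" by (simp add: \<kappa>t_def fun_eq_iff)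
    obtain v where v: "continuous_version u v"
      "\<And>x s. s > 0 \<Longrightarrow> \<bar>v x - kernel_average \<kappa> u x s\<bar> \<le> K * a * s powr - \<gamma>"
      using lim[of 0] unfolding \<kappa>t0 by auto
    have "\<bar>v x\<bar> \<le> (2 * K + K' + 1) * (a * s powr - \<gamma> + b * s powr (real DIM('a) / p))" if s: "s > 0" for x s
    proof -
      have "\<bar>kernel_average \<kappa> u x s\<bar> \<le> K' * s powr (real DIM('a) / p) * b"
        using kernel_average_bound[where x=x, OF u(3) p1 s M R1] R unfolding K'_def b_def Lp_norm_def by simp
      with v(2)[OF s, of x] have "\<bar>v x\<bar> \<le> K * (a * s powr - \<gamma>) + K' * (b * s powr (real DIM('a) / p))"
        by (simp add: mult_ac)
      also have "\<dots> \<le> (2 * K + K' + 1) * (a * s powr - \<gamma>) + (2 * K + K' + 1) * (b * s powr (real DIM('a) / p))"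
        using K a0 b0 by (intro add_mono mult_right_mono) auto
      finally show ?thesis by (simp add: distrib_left)
    qed
    moreover have "\<bar>v x - v y\<bar> \<le> (2 * K + K' + 1) * (a * s powr - \<gamma>)" if s: "s > 0" and xy: "s * norm (y - x) \<le> 1" for x y s
    proof -
      define t where "t = s *\<^sub>R (y - x)"
      have t: "norm t \<le> 1" using s xy by (simp add: t_def)
      obtain v' where v': "continuous_version u v'"
        "\<And>x s. s > 0 \<Longrightarrow> \<bar>v' x - kernel_average (\<kappa>t t) u x s\<bar> \<le> K * a * s powr - \<gamma>"
        using lim[OF t] by auto
      have "v' x = v x"
      proof (rule continuous_AE_eq[of v' v])
        show "AE x in lebesgue. v' x = v x"
          using v(1) v'(1) unfolding continuous_version_def by (auto elim: eventually_elim2)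
      qed (use v(1) v'(1) in \<open>auto simp: continuous_version_def\<close>)
      moreover have "kernel_average (\<kappa>t t) u x s = kernel_average \<kappa> u y s"
        unfolding \<kappa>t_def[abs_def] t_def by (rule kernel_average_translate[OF s])
      ultimately have "\<bar>v x - v y\<bar> \<le> 2 * K * (a * s powr - \<gamma>)"
        using v'(2)[OF s, of x] v(2)[OF s, of y] by (simp add: abs_le_iff)
      also have "\<dots> \<le> (2 * K + K' + 1) * (a * s powr - \<gamma>)"
        using K a0 by (intro mult_right_mono) auto
      finally show ?thesis .
    qed
    ultimately show ?thesis using v(1) unfolding a_def b_def by blast
  qed
  show ?thesis
    by (rule that[of "2 * K + K' + 1"]) (use K main in \<open>auto intro: add_nonneg_pos\<close>)
qed

text \<open>
  The choice \<open>s^p = A / B\<close> makes the two terms equal. Replacing \<open>A\<close> and \<open>B\<close> by \<open>A + e\<close> and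
  \<open>B + e\<close> makes this choice possible when one of them vanishes.
\<close>

lemma powr_interpolation:
  fixes A B C \<theta> p q :: real
  assumes A: "A \<ge> 0" and B: "B \<ge> 0" and \<theta>: "0 < \<theta>" "\<theta> < 1" and p: "p > 0"
    and bound: "\<And>s. s > 0 \<Longrightarrow> q \<le> C * (A powr (1 / p) * s powr - (1 - \<theta>) + B powr (1 / p) * s powr \<theta>)"
    and C: "C > 0"
  shows "q \<le> 2 * C * (A powr (\<theta> / p) * B powr ((1 - \<theta>) / p))"
proof -
  have step: "q \<le> 2 * C * ((A + e) powr (\<theta> / p) * (B + e) powr ((1 - \<theta>) / p))" if e: "e > 0" for e
  proof -
    define a b where "a = A + e" and "b = B + e"
    have ab: "a > 0" "b > 0" "A \<le> a" "B \<le> b" using A B e by (auto simp: a_def b_def)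
    define s where "s = (a / b) powr (1 / p)"
    have s: "s > 0" using ab by (simp add: s_def)
    have "q \<le> C * (A powr (1 / p) * s powr - (1 - \<theta>) + B powr (1 / p) * s powr \<theta>)" by (rule bound[OF s])
    also have "\<dots> \<le> C * (a powr (1 / p) * s powr - (1 - \<theta>) + b powr (1 / p) * s powr \<theta>)"
      using C A B ab p by (intro mult_left_mono add_mono mult_right_mono powr_mono2) auto
    also have "a powr (1 / p) * s powr - (1 - \<theta>) = a powr (\<theta> / p) * b powr ((1 - \<theta>) / p)"
    proof -
      have "s powr - (1 - \<theta>) = (b / a) powr ((1 - \<theta>) / p)"
        using ab unfolding s_def powr_powr powr_minus by (simp add: powr_divide powr_minus divide_simps)
      also have "\<dots> = b powr ((1 - \<theta>) / p) / a powr ((1 - \<theta>) / p)" using ab by (simp add: powr_divide)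
      finally have "a powr (1 / p) * s powr - (1 - \<theta>) = a powr (1 / p) / a powr ((1 - \<theta>) / p) * b powr ((1 - \<theta>) / p)" by simp
      also have "a powr (1 / p) / a powr ((1 - \<theta>) / p) = a powr (\<theta> / p)"
        unfolding powr_diff[symmetric] by (simp add: diff_divide_distrib[symmetric])
      finally show ?thesis .
    qed
    also have "b powr (1 / p) * s powr \<theta> = a powr (\<theta> / p) * b powr ((1 - \<theta>) / p)"
    proof -
      have "s powr \<theta> = a powr (\<theta> / p) / b powr (\<theta> / p)" using ab by (simp add: s_def powr_powr powr_divide)
      then have "b powr (1 / p) * s powr \<theta> = b powr (1 / p) / b powr (\<theta> / p) * a powr (\<theta> / p)" by simp
      also have "b powr (1 / p) / b powr (\<theta> / p) = b powr ((1 - \<theta>) / p)"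
        unfolding powr_diff[symmetric] by (simp add: diff_divide_distrib[symmetric])
      finally show ?thesis by (simp add: mult.commute)
    qed
    finally show ?thesis by (simp add: a_def b_def)
  qed
  have "((\<lambda>e. 2 * C * ((A + e) powr (\<theta> / p) * (B + e) powr ((1 - \<theta>) / p))) \<longlongrightarrow>
      2 * C * ((A + 0) powr (\<theta> / p) * (B + 0) powr ((1 - \<theta>) / p))) (at_right 0)"
    using A B \<theta> p by (intro tendsto_mult tendsto_const tendsto_powr' tendsto_add tendsto_ident_at)
      (auto simp: eventually_at_filter)
  then have "q \<le> 2 * C * ((A + 0) powr (\<theta> / p) * (B + 0) powr ((1 - \<theta>) / p))"
    by (rule tendsto_lowerbound) (auto simp: eventually_at_filter step)
  then show ?thesis by simp
qed

text \<open>
  A bound that holds almost everywhere for a continuous function holds everywhere, so the essential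
  supremum is the supremum of the continuous version.
\<close>

lemma Linf_norm_continuous_version:
  assumes u: "u \<in> borel_measurable lebesgue" and v: "continuous_version u v" and K: "\<And>x. \<bar>v x\<bar> \<le> K"
  shows "in_Linf u" "\<bar>v x\<bar> \<le> Linf_norm u" "Linf_norm u \<le> K"
proof -
  let ?E = "esssup lebesgue (\<lambda>x. ereal \<bar>u x\<bar>)"
  have cont: "continuous_on UNIV v" and ae: "AE x in lebesgue. u x = v x"
    using v by (auto simp: continuous_version_def)
  have m: "(\<lambda>x. ereal \<bar>u x\<bar>) \<in> borel_measurable lebesgue" using u by measurable
  have le: "?E \<le> ereal K"
    using m by (rule esssup_I) (use ae K in \<open>auto elim!: eventually_mono\<close>)
  have E: "AE x in lebesgue. ereal \<bar>u x\<bar> \<le> ?E" by (rule esssup_AE)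
  \<comment> \<open>A negative essential supremum would make the whole space a null set.\<close>
  have ge: "?E \<ge> 0"
  proof (rule ccontr)
    assume "\<not> ?E \<ge> 0"
    have "AE x in lebesgue. (x::'a) \<in> {}"
      using E
    proof eventually_elim
      case (elim x)
      have "(0::ereal) \<le> ereal \<bar>u x\<bar>" by simp
      with elim \<open>\<not> ?E \<ge> 0\<close> show ?case using order_trans by blast
    qed
    from mem_closed_if_AE_lebesgue[OF closed_empty this] show False by simp
  qed
  show "in_Linf u" unfolding in_Linf_def using u le by (auto simp: le_less_trans)
  have fin: "?E = ereal (Linf_norm u)"
    unfolding Linf_norm_def using le ge by (cases ?E) auto
  show "Linf_norm u \<le> K" using le unfolding fin by simp
  have "closed {x. \<bar>v x\<bar> \<le> Linf_norm u}" using cont by (intro closed_Collect_le continuous_intros) auto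
  moreover have "AE x in lebesgue. x \<in> {x. \<bar>v x\<bar> \<le> Linf_norm u}"
    using E ae unfolding fin by eventually_elim simp
  ultimately show "\<bar>v x\<bar> \<le> Linf_norm u" using mem_closed_if_AE_lebesgue by blast
qed

text \<open>
  The right-hand side of the Sobolev inequality, without its constant, in terms of the energies instead of
  the norms.
\<close>

definition interpolation_product :: "real \<Rightarrow> ('a::euclidean_space \<Rightarrow> real) \<Rightarrow> real" where
  "interpolation_product p u =
    gradient_energy p u powr (real DIM('a) / p) * Lp_mass p u powr (1 - real DIM('a) / p)"

lemma interpolation_product_nonneg: "0 \<le> interpolation_product p u"
  by (simp add: interpolation_product_def)

lemma continuous_versionD:
  assumes "continuous_version u v"
  shows "continuous_on UNIV v" "AE x in lebesgue. u x = v x"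
  using assms by (auto simp: continuous_version_def)

lemma sobolev_bound_iff:
  assumes "p > real DIM('a)"
  shows "sobolev_bound TYPE('a::euclidean_space) p C \<longleftrightarrow>
    (\<forall>u::'a \<Rightarrow> real. u \<in> W1p p \<longrightarrow> in_Linf u \<and> Linf_norm u powr p \<le> C * interpolation_product p u)"
proof -
  have p: "p > 0" using assms DIM_positive[where 'a='a] by linarith
  have "Lp_norm p (weak_gradient u) ^ DIM('a) = gradient_energy p u powr (real DIM('a) / p)" for u :: "'a \<Rightarrow> real"
    by (cases "gradient_energy p u = 0")
       (auto simp: Lp_norm_def powr_realpow[symmetric] powr_powr)
  moreover have "Lp_norm p u powr (p - real DIM('a)) = Lp_mass p u powr (1 - real DIM('a) / p)" for u :: "'a \<Rightarrow> real"
    using p by (simp add: Lp_norm_def powr_powr diff_divide_distrib)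
  ultimately show ?thesis unfolding sobolev_bound_def interpolation_product_def by (simp add: mult.assoc)
qed

lemma le_powr_inverse:
  fixes a P p :: real
  assumes "p > 0" "\<bar>a\<bar> powr p \<le> P"
  shows "\<bar>a\<bar> \<le> P powr (1 / p)"
  using powr_mono2[OF _ _ assms(2), of "1 / p"] assms(1) by (simp add: powr_powr)

lemma pointwise_interpolation:
  assumes p: "p > real DIM('a)"
  obtains C\<^sub>0 where "C\<^sub>0 > 0"
    "\<And>u :: 'a::euclidean_space \<Rightarrow> real. u \<in> W1p p \<Longrightarrow> \<exists>v. continuous_version u v \<and>
       (\<forall>x. \<bar>v x\<bar> powr p \<le> C\<^sub>0 * interpolation_product p u)"
proof -
  have d: "real DIM('a) \<ge> 1" using DIM_positive[where 'a='a] by linarith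
  then have p1: "p > 1" using p by linarith
  define \<theta> where "\<theta> = real DIM('a) / p"
  have \<theta>: "0 < \<theta>" "\<theta> < 1" using p p1 d by (auto simp: \<theta>_def)
  obtain C where C: "C > 0"
    "\<And>u :: 'a \<Rightarrow> real. u \<in> W1p p \<Longrightarrow> \<exists>v. continuous_version u v \<and>
       (\<forall>x s. s > 0 \<longrightarrow> \<bar>v x\<bar> \<le> C * (gradient_energy p u powr (1 / p) * s powr - (1 - \<theta>)
                                         + Lp_mass p u powr (1 / p) * s powr \<theta>))"
    using Morrey[OF p] unfolding \<theta>_def by metis
  show ?thesis
  proof (rule that[of "(2 * C) powr p"])
    show "(2 * C) powr p > 0" using C by simp
    fix u :: "'a \<Rightarrow> real" assume "u \<in> W1p p"
    then obtain v where v: "continuous_version u v"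
      "\<And>x s. s > 0 \<Longrightarrow> \<bar>v x\<bar> \<le> C * (gradient_energy p u powr (1 / p) * s powr - (1 - \<theta>)
                                         + Lp_mass p u powr (1 / p) * s powr \<theta>)"
      using C(2) by blast
    have "\<bar>v x\<bar> powr p \<le> (2 * C) powr p * interpolation_product p u" for x
    proof -
      have "\<bar>v x\<bar> \<le> 2 * C * (gradient_energy p u powr (\<theta> / p) * Lp_mass p u powr ((1 - \<theta>) / p))"
        by (rule powr_interpolation[OF gradient_energy_nonneg Lp_mass_nonneg \<theta> _ v(2) C(1)]) (use p1 in auto)
      then have "\<bar>v x\<bar> powr p \<le> (2 * C * (gradient_energy p u powr (\<theta> / p) * Lp_mass p u powr ((1 - \<theta>) / p))) powr p"
        using p1 by (intro powr_mono2) auto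
      also have "\<dots> = (2 * C) powr p * (gradient_energy p u powr \<theta> * Lp_mass p u powr (1 - \<theta>))"
        using p1 C by (simp add: powr_mult powr_powr)
      finally show ?thesis by (simp add: interpolation_product_def \<theta>_def)
    qed
    with v(1) show "\<exists>v. continuous_version u v \<and> (\<forall>x. \<bar>v x\<bar> powr p \<le> (2 * C) powr p * interpolation_product p u)"
      by blast
  qed
qed

lemma continuous_version_bounded:
  fixes u :: "'a::euclidean_space \<Rightarrow> real"
  assumes p: "p > real DIM('a)" and u: "u \<in> W1p p" and v: "continuous_version u v"
  obtains K where "\<And>x. \<bar>v x\<bar> \<le> K"
proof -
  have p0: "p > 0" using p DIM_positive[where 'a='a] by linarith
  obtain C v' where v': "continuous_version u v'" "\<And>x. \<bar>v' x\<bar> powr p \<le> C * interpolation_product p u"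
    using pointwise_interpolation[OF p] u by metis
  have "v x = v' x" for x
    using v v'(1) unfolding continuous_version_def by (intro continuous_AE_eq[of v v']) (auto elim: eventually_elim2)
  then have "\<bar>v x\<bar> \<le> (C * interpolation_product p u) powr (1 / p)" for x
    using le_powr_inverse[OF p0 v'(2)[of x]] by simp
  then show ?thesis by (rule that)
qed

lemma Linf_norm_Sobolev:
  fixes u :: "'a::euclidean_space \<Rightarrow> real"
  assumes p: "p > real DIM('a)" and u: "u \<in> W1p p" and v: "continuous_version u v"
  shows "in_Linf u" "\<bar>v x\<bar> \<le> Linf_norm u" "(\<And>x. \<bar>v x\<bar> \<le> K) \<Longrightarrow> Linf_norm u \<le> K"
proof -
  have m: "u \<in> borel_measurable lebesgue" using u by (simp add: W1p_def in_Lp_def)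
  obtain K' where K': "\<And>x. \<bar>v x\<bar> \<le> K'" using continuous_version_bounded[OF p u v] by metis
  note * = Linf_norm_continuous_version[OF m v]
  show "in_Linf u" by (rule *(1)[OF K'])
  show "\<bar>v x\<bar> \<le> Linf_norm u" by (rule *(2)[OF K'])
  show "Linf_norm u \<le> K" if "\<And>x. \<bar>v x\<bar> \<le> K" by (rule *(3)[OF that])
qed

lemma exists_continuous_version:
  fixes u :: "'a::euclidean_space \<Rightarrow> real"
  assumes "p > real DIM('a)" "u \<in> W1p p"
  obtains v where "continuous_version u v"
  using pointwise_interpolation[OF assms(1)] assms(2) by metis

lemma exists_positive_Linf_norm:
  assumes p: "p > real DIM('a)"
  obtains f :: "'a::euclidean_space \<Rightarrow> real" where "f \<in> W1p p" "0 < Linf_norm f powr p"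
proof -
  have p0: "p > 0" using p DIM_positive[where 'a='a] by linarith
  define f where "f = box_bump (- One) (One::'a) 0"
  have f: "test_function f" unfolding f_def by (rule test_function_box_bump)
  have fW: "f \<in> W1p p" by (rule test_function_in_W1p[OF f p0])
  have "f 0 > 0" unfolding f_def by (rule box_bump_pos) (simp add: mem_box)
  moreover have "continuous_version f f"
    unfolding continuous_version_def using test_functionD(3)[OF f] by simp
  ultimately have "Linf_norm f > 0" using Linf_norm_Sobolev(2)[OF p fW, of f 0] by simp
  then have "0 < Linf_norm f powr p" by simp
  with fW show ?thesis by (rule that)
qed

lemma sobolev_bound_nonneg:
  assumes p: "p > real DIM('a::euclidean_space)" and C: "sobolev_bound TYPE('a) p C"
  shows "0 \<le> C"
proof (rule ccontr)
  assume neg: "\<not> 0 \<le> C"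
  obtain f :: "'a \<Rightarrow> real" where fW: "f \<in> W1p p" and f: "0 < Linf_norm f powr p"
    by (rule exists_positive_Linf_norm[OF p])
  note f
  also have "\<dots> \<le> C * interpolation_product p f"
    using C fW unfolding sobolev_bound_iff[OF p] by blast
  also have "\<dots> \<le> 0" using neg interpolation_product_nonneg[of p f]
    by (intro mult_nonpos_nonneg) auto
  finally show False by simp
qed

text \<open>
  The condition on \<open>C\<close> is a family of non-strict linear inequalities, so it passes to the infimum. Some bound
  exists by Morrey's inequality. Positivity holds because a nonzero function gives a positive lower bound.
\<close>

theorem sobolev_const_attained_pos:
  assumes p: "p > real DIM('a)"
  shows "sobolev_bound TYPE('a::euclidean_space) p (sobolev_const TYPE('a) p)"
    and "sobolev_const TYPE('a) p > 0"
proof -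
  let ?S = "sobolev_const TYPE('a) p"
  have p0: "p > 0" using p DIM_positive[where 'a='a] by linarith
  note iff = sobolev_bound_iff[OF p]
  obtain C\<^sub>0 where C0: "C\<^sub>0 > 0"
    "\<And>u :: 'a \<Rightarrow> real. u \<in> W1p p \<Longrightarrow> \<exists>v. continuous_version u v \<and> (\<forall>x. \<bar>v x\<bar> powr p \<le> C\<^sub>0 * interpolation_product p u)"
    using pointwise_interpolation[OF p] by metis
  have bound0: "sobolev_bound TYPE('a) p C\<^sub>0"
    unfolding iff
  proof (intro allI impI conjI)
    fix u :: "'a \<Rightarrow> real" assume u: "u \<in> W1p p"
    obtain v where v: "continuous_version u v" "\<And>x. \<bar>v x\<bar> powr p \<le> C\<^sub>0 * interpolation_product p u"
      using C0(2)[OF u] by blast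
    show "in_Linf u" by (rule Linf_norm_Sobolev[OF p u v(1)])
    have X: "C\<^sub>0 * interpolation_product p u \<ge> 0" using C0(1) interpolation_product_nonneg[of p u] by simp
    have "\<bar>v x\<bar> \<le> (C\<^sub>0 * interpolation_product p u) powr (1 / p)" for x
      by (rule le_powr_inverse[OF p0 v(2)])
    then have "Linf_norm u \<le> (C\<^sub>0 * interpolation_product p u) powr (1 / p)"
      by (rule Linf_norm_Sobolev(3)[OF p u v(1)])
    moreover have "0 \<le> Linf_norm u" using Linf_norm_Sobolev(2)[OF p u v(1), of 0] by linarith
    ultimately have "Linf_norm u powr p \<le> ((C\<^sub>0 * interpolation_product p u) powr (1 / p)) powr p"
      using p0 by (intro powr_mono2) auto
    also have "\<dots> = C\<^sub>0 * interpolation_product p u" using X p0 by (simp add: powr_powr)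
    finally show "Linf_norm u powr p \<le> C\<^sub>0 * interpolation_product p u" .
  qed
  obtain f :: "'a \<Rightarrow> real" where fW: "f \<in> W1p p" and fpos: "0 < Linf_norm f powr p"
    by (rule exists_positive_Linf_norm[OF p])
  have fX: "interpolation_product p f > 0"
  proof (rule ccontr)
    assume "\<not> interpolation_product p f > 0"
    then have "interpolation_product p f = 0" using interpolation_product_nonneg[of p f] by simp
    then show False using bound0 fW fpos unfolding iff by force
  qed
  have lower: "C \<ge> Linf_norm f powr p / interpolation_product p f" if "sobolev_bound TYPE('a) p C" for C
    using that fW fX unfolding iff by (auto simp: pos_divide_le_eq)
  have "Linf_norm f powr p / interpolation_product p f \<le> ?S"
    unfolding sobolev_const_def by (rule cInf_greatest) (use bound0 lower in auto)
  then show "?S > 0" using fpos fX by (meson divide_pos_pos less_le_trans)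
  show "sobolev_bound TYPE('a) p ?S"
    unfolding iff
  proof (intro allI impI conjI)
    fix u :: "'a \<Rightarrow> real" assume u: "u \<in> W1p p"
    show "in_Linf u" using bound0 u unfolding iff by blast
    show "Linf_norm u powr p \<le> ?S * interpolation_product p u"
    proof (cases "interpolation_product p u = 0")
      case True
      then show ?thesis using bound0 u unfolding iff by fastforce
    next
      case False
      then have X: "interpolation_product p u > 0" using interpolation_product_nonneg[of p u] by simp
      have "Linf_norm u powr p / interpolation_product p u \<le> ?S"
        unfolding sobolev_const_def
      proof (rule cInf_greatest)
        show "{C. sobolev_bound TYPE('a) p C} \<noteq> {}" using bound0 by blast
        fix C assume "C \<in> {C. sobolev_bound TYPE('a) p C}"
        then show "Linf_norm u powr p / interpolation_product p u \<le> C"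
          using u X unfolding iff mem_Collect_eq by (simp add: pos_divide_le_eq)
      qed
      then show ?thesis using X by (simp add: pos_divide_le_eq)
    qed
  qed
qed

lemma sharp_sobolev_pointwise:
  fixes u :: "'a::euclidean_space \<Rightarrow> real"
  assumes p: "p > real DIM('a)" and u: "u \<in> W1p p" and v: "continuous_version u v"
  shows "\<bar>v x\<bar> powr p \<le> sobolev_const TYPE('a) p * interpolation_product p u"
proof -
  have p0: "p > 0" using p DIM_positive[where 'a='a] by linarith
  have "\<bar>v x\<bar> powr p \<le> Linf_norm u powr p"
    using Linf_norm_Sobolev(2)[OF p u v] p0 by (intro powr_mono2) auto
  also have "\<dots> \<le> sobolev_const TYPE('a) p * interpolation_product p u"
    using sobolev_const_attained_pos(1)[OF p] u unfolding sobolev_bound_iff[OF p] by blast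
  finally show ?thesis .
qed

text \<open>
  The supremum of \<open>|v|\<close> need not be attained, so \<open>x\<^sub>0\<close> is only a point where the inequality with the smaller
  constant \<open>C\<close> already fails. The energies are positive, since otherwise the Sobolev inequality would
  force \<open>v\<close> to vanish.
\<close>

lemma near_optimal_function:
  assumes p: "p > real DIM('a::euclidean_space)" and C: "0 < C" "C < sobolev_const TYPE('a) p"
  obtains u v :: "'a::euclidean_space \<Rightarrow> real" and x\<^sub>0 where "u \<in> W1p p" "continuous_version u v"
    "gradient_energy p u > 0" "Lp_mass p u > 0" "C * interpolation_product p u < \<bar>v x\<^sub>0\<bar> powr p"
proof -
  have p0: "p > 0" using p DIM_positive[where 'a='a] by linarith
  have "\<not> sobolev_bound TYPE('a) p C"
  proof
    assume C': "sobolev_bound TYPE('a) p C"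
    have "bdd_below {C. sobolev_bound TYPE('a) p C}"
      using sobolev_bound_nonneg[OF p] by (intro bdd_belowI[of _ 0]) auto
    then have "sobolev_const TYPE('a) p \<le> C"
      unfolding sobolev_const_def using C' by (intro cInf_lower) auto
    then show False using C by simp
  qed
  then obtain u :: "'a \<Rightarrow> real" where u: "u \<in> W1p p"
    and big: "\<not> (in_Linf u \<and> Linf_norm u powr p \<le> C * interpolation_product p u)"
    unfolding sobolev_bound_iff[OF p] by blast
  obtain v where v: "continuous_version u v" by (rule exists_continuous_version[OF p u])
  have "\<exists>x. C * interpolation_product p u < \<bar>v x\<bar> powr p"
  proof (rule ccontr)
    assume "\<not> ?thesis"
    then have le: "\<bar>v x\<bar> powr p \<le> C * interpolation_product p u" for x by (simp add: not_less)
    have X: "C * interpolation_product p u \<ge> 0" using C interpolation_product_nonneg[of p u] by simp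
    have "\<bar>v x\<bar> \<le> (C * interpolation_product p u) powr (1 / p)" for x
      by (rule le_powr_inverse[OF p0 le])
    then have "Linf_norm u \<le> (C * interpolation_product p u) powr (1 / p)"
      by (rule Linf_norm_Sobolev(3)[OF p u v])
    moreover have "0 \<le> Linf_norm u" using Linf_norm_Sobolev(2)[OF p u v, of 0] by linarith
    ultimately have "Linf_norm u powr p \<le> ((C * interpolation_product p u) powr (1 / p)) powr p"
      using p0 by (intro powr_mono2) auto
    then show False using big Linf_norm_Sobolev(1)[OF p u v] X p0 by (simp add: powr_powr)
  qed
  then obtain x where x: "C * interpolation_product p u < \<bar>v x\<bar> powr p" by blast
  also have "\<dots> \<le> sobolev_const TYPE('a) p * interpolation_product p u"
    by (rule sharp_sobolev_pointwise[OF p u v])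
  finally have "interpolation_product p u \<noteq> 0" by auto
  then have "gradient_energy p u \<noteq> 0" "Lp_mass p u \<noteq> 0" by (auto simp: interpolation_product_def)
  then have "gradient_energy p u > 0" "Lp_mass p u > 0"
    using gradient_energy_nonneg[of u p] Lp_mass_nonneg[of u p] by (metis order_le_imp_less_or_eq)+
  then show ?thesis using that u v x by blast
qed

section \<open>Two elementary inequalities for powers\<close>

text \<open>
  The difference is at most \<open>p P^(p-1) |a - b|\<close>. If \<open>|a - b| \<le> (e/p) P\<close> this is at most \<open>e P^p\<close>; otherwise \<open>P\<close>
  itself is dominated by \<open>(p/e) |a - b|\<close>.
\<close>

lemma powr_diff_le_absorb:
  fixes a b P p e :: real
  assumes p: "p \<ge> 1" and e: "e > 0" and a: "0 \<le> a" "a \<le> P" and b: "0 \<le> b" "b \<le> P"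
  shows "\<bar>a powr p - b powr p\<bar> \<le> e * P powr p + (p / e) powr p * \<bar>a - b\<bar> powr p"
proof -
  have *: "a powr p - b powr p \<le> e * P powr p + (p / e) powr p * \<bar>a - b\<bar> powr p"
    if a: "0 \<le> a" "a \<le> P" and b: "0 \<le> b" "b \<le> P" for a b :: real
  proof (cases "a \<le> b")
    case True
    then have "a powr p \<le> b powr p" using a p by (intro powr_mono2) auto
    then show ?thesis using e by (intro order_trans[OF _ add_nonneg_nonneg]) auto
  next
    case False
    then have ab: "b < a" and P: "P > 0" using a b by auto
    show ?thesis
    proof (cases "a - b \<le> e / p * P")
      case True
      have "a powr p - b powr p \<le> p * P powr (p - 1) * (a - b)"
      proof (cases "b = 0")
        case True
        have "a powr p = a powr (p - 1) * a" using ab b powr_add[of a "p - 1" 1] by simp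
        also have "\<dots> \<le> P powr (p - 1) * a" using a p by (intro mult_right_mono powr_mono2) auto
        also have "\<dots> \<le> p * P powr (p - 1) * a" using a p mult_right_mono[of 1 p "P powr (p - 1) * a"] by (simp add: mult.assoc)
        finally show ?thesis using True p by simp
      next
        case False
        then have b0: "b > 0" using b by simp
        have "\<exists>z. b < z \<and> z < a \<and> a powr p - b powr p = (a - b) * (p * z powr (p - 1))"
          using ab b0 by (intro MVT2) (auto intro!: derivative_eq_intros)
        then obtain z where z: "b < z" "z < a" "a powr p - b powr p = (a - b) * (p * z powr (p - 1))" by blast
        have "z powr (p - 1) \<le> P powr (p - 1)" using z b0 a p by (intro powr_mono2) auto
        then show ?thesis unfolding z(3) using ab p by (simp add: mult.commute mult_left_mono)
      qed
      also have "\<dots> \<le> p * P powr (p - 1) * (e / p * P)" using True p by (intro mult_left_mono) auto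
      also have "\<dots> = e * P powr p" using p P powr_add[of P "p - 1" 1] by simp
      finally show ?thesis by (rule order_trans) simp
    next
      case False
      then have "P \<le> p / e * \<bar>a - b\<bar>" using p e ab by (simp add: field_simps)
      then have "P powr p \<le> (p / e * \<bar>a - b\<bar>) powr p" using P p by (intro powr_mono2) auto
      also have "\<dots> = (p / e) powr p * \<bar>a - b\<bar> powr p" using p e by (intro powr_mult)
      finally have "P powr p \<le> \<dots>" .
      moreover have "a powr p \<le> P powr p" using a p by (intro powr_mono2) auto
      moreover have "0 \<le> b powr p" "0 \<le> e * P powr p" using e by auto
      ultimately show ?thesis by linarith
    qed
  qed
  show ?thesis using *[OF a b] *[OF b a] by (simp add: abs_le_iff abs_minus_commute)
qed

text \<open>
  The concave function \<open>t^\<theta>\<close> lies below its tangent at the point \<open>r\<close> where the derivative of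
  \<open>c t - K t^\<theta>\<close> vanishes.
\<close>

lemma linear_minus_power_ge:
  fixes \<theta> K c t :: real
  assumes \<theta>: "0 < \<theta>" "\<theta> < 1" and K: "K > 0" and c: "c > 0" and t: "t \<ge> 0"
  shows "- ((1 - \<theta>) * \<theta> powr (\<theta> / (1 - \<theta>)) * K powr (1 / (1 - \<theta>)) * c powr - (\<theta> / (1 - \<theta>)))
    \<le> c * t - K * t powr \<theta>"
proof -
  \<comment> \<open>The critical point of \<open>c t - K t^\<theta>\<close>.\<close>
  define r where "r = (K * \<theta> / c) powr (1 / (1 - \<theta>))"
  have r: "r > 0" using assms by (simp add: r_def)
  have r1: "r powr (1 - \<theta>) = K * \<theta> / c" using assms by (simp add: r_def powr_powr)
  have rr: "r = r powr \<theta> * (K * \<theta> / c)" using r powr_add[of r \<theta> "1 - \<theta>"] r1 by simp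
  have tang: "t powr \<theta> \<le> \<theta> * (r powr \<theta> / r) * t + (1 - \<theta>) * r powr \<theta>"
  proof -
    have "t powr \<theta> * r powr (1 - \<theta>) \<le> \<theta> * t + (1 - \<theta>) * r"
      using Youngs_inequality_0[of \<theta> "1 - \<theta>" t r] \<theta> t r by (cases "t = 0") auto
    note young = this
    define q where "q = r powr \<theta> / r"
    have q: "q \<ge> 0" "r * q = r powr \<theta>" "r powr (1 - \<theta>) * q = 1"
      using r powr_add[of r "1 - \<theta>" \<theta>] by (auto simp: q_def)
    have "t powr \<theta> = t powr \<theta> * r powr (1 - \<theta>) * q" using q(3) by (simp add: mult.assoc)
    also have "\<dots> \<le> (\<theta> * t + (1 - \<theta>) * r) * q" using young q(1) by (rule mult_right_mono)
    also have "\<dots> = \<theta> * q * t + (1 - \<theta>) * (r * q)" by (simp add: algebra_simps)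
    finally show ?thesis unfolding q(2) by (simp only: q_def)
  qed
  have Kc: "K * (\<theta> * (r powr \<theta> / r)) = c"
  proof -
    have "c * r = r powr \<theta> * (K * \<theta>)" using rr c by (simp add: field_simps)
    then show ?thesis using r by (simp add: field_simps)
  qed
  have "K * t powr \<theta> \<le> K * (\<theta> * (r powr \<theta> / r) * t + (1 - \<theta>) * r powr \<theta>)"
    using tang K by (intro mult_left_mono) auto
  also have "\<dots> = K * (\<theta> * (r powr \<theta> / r)) * t + K * ((1 - \<theta>) * r powr \<theta>)"
    by (simp only: distrib_left mult.assoc)
  finally have "K * t powr \<theta> \<le> c * t + K * ((1 - \<theta>) * r powr \<theta>)" unfolding Kc .
  moreover have "K * ((1 - \<theta>) * r powr \<theta>)
      = (1 - \<theta>) * \<theta> powr (\<theta> / (1 - \<theta>)) * K powr (1 / (1 - \<theta>)) * c powr - (\<theta> / (1 - \<theta>))"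
  proof -
    have "r powr \<theta> = (K * \<theta> / c) powr (\<theta> / (1 - \<theta>))" by (simp add: r_def powr_powr)
    also have "\<dots> = K powr (\<theta> / (1 - \<theta>)) * \<theta> powr (\<theta> / (1 - \<theta>)) * c powr - (\<theta> / (1 - \<theta>))"
      using K \<theta> c powr_minus_divide[of c "\<theta> / (1 - \<theta>)"] by (simp add: powr_mult powr_divide)
    finally have "K * r powr \<theta> = (K powr 1 * K powr (\<theta> / (1 - \<theta>))) * \<theta> powr (\<theta> / (1 - \<theta>)) * c powr - (\<theta> / (1 - \<theta>))"
      using K by simp
    also have "K powr 1 * K powr (\<theta> / (1 - \<theta>)) = K powr (1 / (1 - \<theta>))"
      unfolding powr_add[symmetric] using \<theta> by (simp add: field_simps)
    finally show ?thesis by (simp add: mult_ac)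
  qed
  ultimately show ?thesis by linarith
qed

lemma linear_minus_power_attained:
  fixes \<theta> K :: real
  assumes \<theta>: "0 < \<theta>" "\<theta> < 1" and K: "K > 0"
  obtains r where "r > 0" "r - K * r powr \<theta> = - ((1 - \<theta>) * \<theta> powr (\<theta> / (1 - \<theta>)) * K powr (1 / (1 - \<theta>)))"
proof -
  define r where "r = (K * \<theta>) powr (1 / (1 - \<theta>))"
  have r: "r > 0" using assms by (simp add: r_def)
  have r1: "r powr (1 - \<theta>) = K * \<theta>" using assms by (simp add: r_def powr_powr)
  have rr: "r = r powr \<theta> * (K * \<theta>)" using r powr_add[of r \<theta> "1 - \<theta>"] r1 by simp
  have "K * r powr \<theta> = K powr 1 * K powr (\<theta> / (1 - \<theta>)) * \<theta> powr (\<theta> / (1 - \<theta>))"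
    using K \<theta> by (simp add: r_def powr_powr powr_mult)
  also have "K powr 1 * K powr (\<theta> / (1 - \<theta>)) = K powr (1 / (1 - \<theta>))"
    unfolding powr_add[symmetric] using \<theta> by (simp add: field_simps)
  finally have Kr: "K * r powr \<theta> = K powr (1 / (1 - \<theta>)) * \<theta> powr (\<theta> / (1 - \<theta>))" .
  have "r = \<theta> * (K * r powr \<theta>)" using rr by (simp add: mult_ac)
  then have "r - K * r powr \<theta> = - ((1 - \<theta>) * (K * r powr \<theta>))"
    by (simp add: left_diff_distrib)
  then show ?thesis using that[OF r] unfolding Kr by (simp add: mult_ac)
qed

section \<open>The potential term\<close>

lemma integrable_potential_term:
  fixes V :: "'a::euclidean_space \<Rightarrow> real"
  assumes p: "p \<ge> 0" and V: "integrable lebesgue V" and v: "continuous_on UNIV v" and K: "\<And>x. \<bar>v x\<bar> \<le> K"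
  shows "integrable lebesgue (\<lambda>x. V x * \<bar>v x\<bar> powr p)"
proof (rule Bochner_Integration.integrable_bound)
  have "v \<in> borel_measurable lebesgue"
    using borel_measurable_continuous_onI[OF v] by (intro measurable_completion) simp
  then show "(\<lambda>x. V x * \<bar>v x\<bar> powr p) \<in> borel_measurable lebesgue" using V by measurable
  show "integrable lebesgue (\<lambda>x. K powr p * V x)" using V by simp
  show "AE x in lebesgue. norm (V x * \<bar>v x\<bar> powr p) \<le> norm (K powr p * V x)"
  proof (intro always_eventually allI)
    fix x
    have "\<bar>v x\<bar> powr p \<le> K powr p" using K p by (intro powr_mono2) auto
    then show "norm (V x * \<bar>v x\<bar> powr p) \<le> norm (K powr p * V x)"
      by (simp add: abs_mult mult.commute mult_left_mono)
  qed
qed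

lemma Q_form_continuous_version:
  fixes u :: "'a::euclidean_space \<Rightarrow> real"
  assumes p: "p > real DIM('a)" and V: "integrable lebesgue V" and u: "u \<in> W1p p" and v: "continuous_version u v"
  shows "Q_form p (\<lambda>x. \<alpha> * V x) u = gradient_energy p u - \<alpha> * (LINT x|lebesgue. V x * \<bar>v x\<bar> powr p)"
proof -
  have p0: "p \<ge> 0" using p DIM_positive[where 'a='a] by linarith
  obtain K where K: "\<And>x. \<bar>v x\<bar> \<le> K" using continuous_version_bounded[OF p u v] by metis
  have i1: "integrable lebesgue (\<lambda>x. norm (weak_gradient u x) powr p)"
    using W1p_weak_gradient(2)[OF u] by (simp add: in_Lp_def)
  have i2: "integrable lebesgue (\<lambda>x. V x * \<bar>v x\<bar> powr p)"
    by (rule integrable_potential_term[OF p0 V continuous_versionD(1)[OF v] K])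
  have um: "u \<in> borel_measurable lebesgue" using u by (simp add: W1p_def in_Lp_def)
  have "Q_form p (\<lambda>x. \<alpha> * V x) u
      = (LINT x|lebesgue. norm (weak_gradient u x) powr p - \<alpha> * (V x * \<bar>v x\<bar> powr p))"
    unfolding Q_form_def
  proof (rule integral_cong_AE)
    show "(\<lambda>x. norm (weak_gradient u x) powr p - \<alpha> * V x * \<bar>u x\<bar> powr p) \<in> borel_measurable lebesgue"
      using borel_measurable_integrable[OF i1] borel_measurable_integrable[OF V] um by measurable
    show "(\<lambda>x. norm (weak_gradient u x) powr p - \<alpha> * (V x * \<bar>v x\<bar> powr p)) \<in> borel_measurable lebesgue"
      using borel_measurable_integrable[OF i1] borel_measurable_integrable[OF i2] by measurable
    show "AE x in lebesgue. norm (weak_gradient u x) powr p - \<alpha> * V x * \<bar>u x\<bar> powr p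
        = norm (weak_gradient u x) powr p - \<alpha> * (V x * \<bar>v x\<bar> powr p)"
      using continuous_versionD(2)[OF v] by eventually_elim simp
  qed
  also have "\<dots> = gradient_energy p u - \<alpha> * (LINT x|lebesgue. V x * \<bar>v x\<bar> powr p)"
    using i1 i2 by simp
  finally show ?thesis .
qed

lemma integrable_tail_small:
  fixes V :: "'a::euclidean_space \<Rightarrow> real"
  assumes V: "integrable lebesgue V" and e: "e > 0"
  obtains R where "R > 0" "(LINT x|lebesgue. indicator (- cball 0 R) x * \<bar>V x\<bar>) < e"
proof -
  have "(\<lambda>n. LINT x|lebesgue. indicator (- cball 0 (real (Suc n))) x * \<bar>V x\<bar>) \<longlonglongrightarrow> integral\<^sup>L lebesgue (\<lambda>x::'a. 0::real)"
  proof (rule integral_dominated_convergence)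
    show "(\<lambda>x::'a. 0::real) \<in> borel_measurable lebesgue" by simp
    show "integrable lebesgue (\<lambda>x. \<bar>V x\<bar>)" using V by simp
    show "(\<lambda>x. indicator (- cball 0 (real (Suc n))) x * \<bar>V x\<bar>) \<in> borel_measurable lebesgue" for n
      using borel_measurable_integrable[OF V] by (intro borel_measurable_times borel_measurable_indicator) auto
    show "AE x in lebesgue. norm (indicator (- cball 0 (real (Suc n))) x * \<bar>V x\<bar>) \<le> \<bar>V x\<bar>" for n
      by (auto simp: indicator_def)
    show "AE x in lebesgue. (\<lambda>n. indicator (- cball 0 (real (Suc n))) x * \<bar>V x\<bar>) \<longlonglongrightarrow> 0"
    proof (intro always_eventually allI)
      fix x :: 'a
      obtain N where N: "norm x \<le> real N" using real_arch_simple by blast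
      have "\<forall>\<^sub>F n in sequentially. indicator (- cball 0 (real (Suc n))) x * \<bar>V x\<bar> = 0"
        using eventually_ge_at_top[of N] by eventually_elim (use N in \<open>auto simp: indicator_def\<close>)
      then show "(\<lambda>n. indicator (- cball 0 (real (Suc n))) x * \<bar>V x\<bar>) \<longlonglongrightarrow> 0"
        by (rule tendsto_eventually)
    qed
  qed
  then have "\<forall>\<^sub>F n in sequentially. (LINT x|lebesgue. indicator (- cball 0 (real (Suc n))) x * \<bar>V x\<bar>) < e"
    using e by (intro order_tendstoD(2)) auto
  then obtain n where "(LINT x|lebesgue. indicator (- cball 0 (real (Suc n))) x * \<bar>V x\<bar>) < e"
    by (meson eventually_sequentially le_refl)
  then show ?thesis by (rule that[rotated]) simp
qed

text \<open>
  Far away \<open>V\<close> has small mass, and \<open>|v|^p\<close> is bounded by \<open>S\<close> times the interpolation product. On a ball,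
  \<open>v\<close> is replaced by its value at the centre; the error is an oscillation, which Morrey's inequality bounds by
  the energy and \<open>powr_diff_le_absorb\<close> splits into a small multiple of the supremum and a large multiple
  of the energy. The sign of \<open>I\<close> matters: the value at the centre is estimated from above by the supremum.
\<close>

lemma potential_term_upper_bound:
  fixes V :: "'a::euclidean_space \<Rightarrow> real"
  assumes p: "p > real DIM('a)" and V: "integrable lebesgue V" and I: "(LINT x|lebesgue. V x) \<ge> 0" and e: "e > 0"
  shows "\<exists>K\<ge>0. \<forall>u v. u \<in> W1p p \<longrightarrow> continuous_version u v \<longrightarrow>
      (LINT x|lebesgue. V x * \<bar>v x\<bar> powr p)
        \<le> ((LINT x|lebesgue. V x) + e) * (sobolev_const TYPE('a) p * interpolation_product p u) + K * gradient_energy p u"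
proof -
  have p1: "p \<ge> 1" using p DIM_positive[where 'a='a] by linarith
  define \<gamma> where "\<gamma> = 1 - real DIM('a) / p"
  define S where "S = sobolev_const TYPE('a) p"
  define T where "T = (LINT x|lebesgue. \<bar>V x\<bar>)"
  have T: "T \<ge> 0" unfolding T_def by (intro Bochner_Integration.integral_nonneg) simp
  obtain C where C: "C > 0"
    "\<And>u :: 'a \<Rightarrow> real. u \<in> W1p p \<Longrightarrow> \<exists>v. continuous_version u v \<and>
       (\<forall>x y s. s > 0 \<longrightarrow> s * norm (y - x) \<le> 1 \<longrightarrow>
          \<bar>v x - v y\<bar> \<le> C * (gradient_energy p u powr (1 / p) * s powr - \<gamma>))"
    using Morrey[OF p] unfolding \<gamma>_def by metis
  obtain R where R: "R > 0" and tail: "(LINT x|lebesgue. indicator (- cball 0 R) x * \<bar>V x\<bar>) < e / 2"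
    using integrable_tail_small[OF V, of "e / 2"] e by auto
  \<comment> \<open>The oscillation is weighted by the mass \<open>T\<close> of \<open>V\<close>, which may take half of \<open>e\<close>; the tail takes the other half. The summand 1 avoids a division by 0.\<close>
  define \<delta> where "\<delta> = e / (2 * (T + 1))"
  have \<delta>: "\<delta> > 0" "T * \<delta> \<le> e / 2" using e T by (auto simp: \<delta>_def field_simps)
  \<comment> \<open>The radius of the ball enters through Morrey's inequality with \<open>s = 1 / R\<close>.\<close>
  define L where "L = (p / \<delta>) powr p * (C * (1 / R) powr - \<gamma>) powr p"
  have L: "L \<ge> 0" by (simp add: L_def)
  show ?thesis
  proof (intro exI[of _ "T * L"] conjI allI impI)
    show "T * L \<ge> 0" using T L by simp
    fix u v :: "'a \<Rightarrow> real" assume u: "u \<in> W1p p" and v: "continuous_version u v"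
    define A where "A = gradient_energy p u"
    define P where "P = S * interpolation_product p u"
    have A: "A \<ge> 0" unfolding A_def by (rule gradient_energy_nonneg)
    have vP: "\<bar>v x\<bar> powr p \<le> P" for x
      using sharp_sobolev_pointwise[OF p u v] by (simp add: P_def S_def)
    have P0: "P \<ge> 0" using vP[of 0] by (meson order_trans powr_ge_zero)
    obtain v' where v': "continuous_version u v'"
      "\<And>x y s. s > 0 \<Longrightarrow> s * norm (y - x) \<le> 1 \<Longrightarrow> \<bar>v' x - v' y\<bar> \<le> C * (A powr (1 / p) * s powr - \<gamma>)"
      using C(2)[OF u] unfolding A_def by blast
    have vv': "v x = v' x" for x
      using v v'(1) unfolding continuous_version_def by (intro continuous_AE_eq[of v v']) (auto elim: eventually_elim2)
    have osc: "\<bar>\<bar>v x\<bar> powr p - \<bar>v 0\<bar> powr p\<bar> \<le> \<delta> * P + L * A" if x: "norm x \<le> R" for x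
    proof -
      have vle: "\<bar>v x\<bar> \<le> P powr (1 / p)" for x
        using p1 by (intro le_powr_inverse vP) simp
      have Pp: "(P powr (1 / p)) powr p = P" using P0 p1 by (simp add: powr_powr)
      have "\<bar>\<bar>v x\<bar> - \<bar>v 0\<bar>\<bar> \<le> \<bar>v x - v 0\<bar>" by (rule abs_triangle_ineq3)
      also have "\<dots> \<le> C * (A powr (1 / p) * (1 / R) powr - \<gamma>)"
        unfolding vv' using R x by (intro v'(2)) (auto simp: field_simps)
      finally have "\<bar>\<bar>v x\<bar> - \<bar>v 0\<bar>\<bar> powr p \<le> (C * (A powr (1 / p) * (1 / R) powr - \<gamma>)) powr p"
        using p1 by (intro powr_mono2) auto
      also have "\<dots> = (C * (1 / R) powr - \<gamma>) powr p * A"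
      proof -
        have "(C * (A powr (1 / p) * (1 / R) powr - \<gamma>)) powr p = ((C * (1 / R) powr - \<gamma>) * A powr (1 / p)) powr p"
          by (simp add: mult_ac)
        also have "\<dots> = (C * (1 / R) powr - \<gamma>) powr p * (A powr (1 / p)) powr p" using C by (intro powr_mult)
        finally show ?thesis using A p1 by (simp add: powr_powr)
      qed
      finally have "(p / \<delta>) powr p * \<bar>\<bar>v x\<bar> - \<bar>v 0\<bar>\<bar> powr p \<le> L * A"
        unfolding L_def mult.assoc by (intro mult_left_mono) auto
      moreover have "\<bar>\<bar>v x\<bar> powr p - \<bar>v 0\<bar> powr p\<bar> \<le> \<delta> * (P powr (1 / p)) powr p + (p / \<delta>) powr p * \<bar>\<bar>v x\<bar> - \<bar>v 0\<bar>\<bar> powr p"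
        by (rule powr_diff_le_absorb[OF p1 \<delta>(1)]) (use vle in auto)
      ultimately show ?thesis unfolding Pp by linarith
    qed
    obtain K where K: "\<And>x. \<bar>v x\<bar> \<le> K" using continuous_version_bounded[OF p u v] by metis
    have i1: "integrable lebesgue (\<lambda>x. V x * \<bar>v x\<bar> powr p)"
      using p1 by (intro integrable_potential_term[OF _ V continuous_versionD(1)[OF v] K]) simp
    have i2: "integrable lebesgue (\<lambda>x. (\<delta> * P + L * A) * \<bar>V x\<bar>)" using V by simp
    have i3: "integrable lebesgue (\<lambda>x. P * (indicator (- cball 0 R) x * \<bar>V x\<bar>))"
    proof -
      have "integrable lebesgue (\<lambda>x. indicator (- cball 0 R) x *\<^sub>R \<bar>V x\<bar>)"
        by (rule integrable_mult_indicator) (use V in auto)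
      then show ?thesis by simp
    qed
    have i4: "integrable lebesgue (\<lambda>x. \<bar>v 0\<bar> powr p * V x)" using V by simp
    have "(LINT x|lebesgue. V x * \<bar>v x\<bar> powr p)
        \<le> (LINT x|lebesgue. (\<bar>v 0\<bar> powr p * V x + (\<delta> * P + L * A) * \<bar>V x\<bar>) + P * (indicator (- cball 0 R) x * \<bar>V x\<bar>))"
    proof (rule integral_mono[OF i1])
      show "integrable lebesgue (\<lambda>x. (\<bar>v 0\<bar> powr p * V x + (\<delta> * P + L * A) * \<bar>V x\<bar>) + P * (indicator (- cball 0 R) x * \<bar>V x\<bar>))"
        by (intro Bochner_Integration.integrable_add i2 i3 i4)
      fix x
      have "V x * \<bar>v x\<bar> powr p - \<bar>v 0\<bar> powr p * V x \<le> \<bar>V x\<bar> * \<bar>\<bar>v x\<bar> powr p - \<bar>v 0\<bar> powr p\<bar>"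
        by (metis abs_ge_self abs_mult mult.commute right_diff_distrib')
      also have "\<dots> \<le> (\<delta> * P + L * A) * \<bar>V x\<bar> + P * (indicator (- cball 0 R) x * \<bar>V x\<bar>)"
      proof (cases "norm x \<le> R")
        case True
        then show ?thesis using mult_left_mono[OF osc[OF True], of "\<bar>V x\<bar>"] by (simp add: mult.commute)
      next
        case False
        have "\<bar>\<bar>v x\<bar> powr p - \<bar>v 0\<bar> powr p\<bar> \<le> P" using vP[of x] vP[of 0] by (auto simp: abs_le_iff intro: order_trans[OF diff_left_mono[of 0]])
        from mult_left_mono[OF this, of "\<bar>V x\<bar>"] have "\<bar>V x\<bar> * \<bar>\<bar>v x\<bar> powr p - \<bar>v 0\<bar> powr p\<bar> \<le> P * \<bar>V x\<bar>"
          by (simp add: mult.commute)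
        moreover have "0 \<le> (\<delta> * P + L * A) * \<bar>V x\<bar>" using \<delta> P0 L A by simp
        ultimately show ?thesis using False by simp
      qed
      finally show "V x * \<bar>v x\<bar> powr p \<le> (\<bar>v 0\<bar> powr p * V x + (\<delta> * P + L * A) * \<bar>V x\<bar>) + P * (indicator (- cball 0 R) x * \<bar>V x\<bar>)"
        by simp
    qed
    also have "\<dots> = \<bar>v 0\<bar> powr p * (LINT x|lebesgue. V x) + (\<delta> * P + L * A) * T + P * (LINT x|lebesgue. indicator (- cball 0 R) x * \<bar>V x\<bar>)"
      using i2 i3 i4 by (simp add: T_def)
    also have "\<dots> \<le> P * (LINT x|lebesgue. V x) + (\<delta> * P + L * A) * T + P * (e / 2)"
      using I tail P0 vP[of 0] by (intro add_mono order_refl mult_right_mono mult_left_mono) auto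
    also have "\<dots> = P * (LINT x|lebesgue. V x) + T * \<delta> * P + P * (e / 2) + T * L * A"
      by (simp add: algebra_simps)
    also have "\<dots> \<le> P * (LINT x|lebesgue. V x) + e / 2 * P + P * (e / 2) + T * L * A"
      using \<delta>(2) P0 by (intro add_mono mult_right_mono order_refl) auto
    also have "\<dots> = ((LINT x|lebesgue. V x) + e) * P + T * L * A" by (simp add: algebra_simps)
    finally show "(LINT x|lebesgue. V x * \<bar>v x\<bar> powr p)
        \<le> ((LINT x|lebesgue. V x) + e) * (sobolev_const TYPE('a) p * interpolation_product p u) + T * L * gradient_energy p u"
      by (simp add: P_def S_def A_def)
  qed
qed

section \<open>The Rayleigh quotient at weak coupling\<close>

lemma W1p_scaled:
  fixes u :: "'a::euclidean_space \<Rightarrow> real" and a :: 'a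
  assumes u: "u \<in> W1p p" and c: "c > 0"
  defines "w \<equiv> \<lambda>x. u (c *\<^sub>R (x - a))"
  shows "w \<in> W1p p"
    and "gradient_energy p w = c powr p / c ^ DIM('a) * gradient_energy p u"
    and "Lp_mass p w = Lp_mass p u / c ^ DIM('a)"
    and "continuous_version u v \<Longrightarrow> continuous_version w (\<lambda>x. v (c *\<^sub>R (x - a)))"
proof -
  note g = W1p_weak_gradient[OF u]
  let ?G = "\<lambda>x. c *\<^sub>R weak_gradient u (c *\<^sub>R (x - a))"
  have c0: "c \<noteq> 0" using c by simp
  have wg: "has_weak_gradient w ?G" unfolding w_def by (rule has_weak_gradient_scaled[OF g(1) c])
  have um: "u \<in> borel_measurable lebesgue" and gm: "weak_gradient u \<in> borel_measurable lebesgue"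
    and ui: "integrable lebesgue (\<lambda>x. \<bar>u x\<bar> powr p)" and gi: "integrable lebesgue (\<lambda>x. norm (weak_gradient u x) powr p)"
    using g(2,3) by (auto simp: in_Lp_def)
  have Gn: "norm (?G x) powr p = c powr p * norm (weak_gradient u (c *\<^sub>R (x - a))) powr p" for x
    using c by (simp add: powr_mult)
  have "in_Lp p w"
    unfolding in_Lp_def w_def using borel_measurable_scaled[OF c0 um, of a] integrable_scaled[OF c0 ui, of a] by simp
  moreover have LG: "in_Lp p ?G"
    unfolding in_Lp_def Gn
    using borel_measurable_scaled[OF c0 gm, of a] integrable_scaled[OF c0 gi, of a] by (intro conjI borel_measurable_scaleR) auto
  ultimately show W: "w \<in> W1p p" unfolding W1p_def using wg by blast
  note g' = W1p_weak_gradient[OF W]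
  have ae: "AE x in lebesgue. weak_gradient w x = ?G x" by (rule has_weak_gradient_unique[OF g'(1) wg])
  have "gradient_energy p w = (LINT x|lebesgue. norm (?G x) powr p)"
  proof (rule integral_cong_AE)
    show "(\<lambda>x. norm (weak_gradient w x) powr p) \<in> borel_measurable lebesgue"
      using g'(2) by (auto simp: in_Lp_def)
    show "(\<lambda>x. norm (?G x) powr p) \<in> borel_measurable lebesgue" using LG by (auto simp: in_Lp_def)
    show "AE x in lebesgue. norm (weak_gradient w x) powr p = norm (?G x) powr p" using ae by eventually_elim simp
  qed
  also have "\<dots> = c powr p * (LINT x|lebesgue. norm (weak_gradient u (c *\<^sub>R (x - a))) powr p)" unfolding Gn by simp
  also have "(LINT x|lebesgue. norm (weak_gradient u (c *\<^sub>R (x - a))) powr p) = 1 / c ^ DIM('a) * gradient_energy p u"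
    using integral_scaled[OF c0, of "\<lambda>x. norm (weak_gradient u x) powr p" a] c by simp
  finally show "gradient_energy p w = c powr p / c ^ DIM('a) * gradient_energy p u" by simp
  show "Lp_mass p w = Lp_mass p u / c ^ DIM('a)"
    unfolding w_def using integral_scaled[OF c0, of "\<lambda>x. \<bar>u x\<bar> powr p" a] c by simp
  show "continuous_version w (\<lambda>x. v (c *\<^sub>R (x - a)))" if v: "continuous_version u v"
    unfolding continuous_version_def
  proof
    show "continuous_on UNIV (\<lambda>x. v (c *\<^sub>R (x - a)))"
      by (intro continuous_on_compose2[OF continuous_versionD(1)[OF v]] continuous_intros) auto
    show "AE x in lebesgue. w x = v (c *\<^sub>R (x - a))"
      unfolding w_def by (rule AE_scaled[OF c0 continuous_versionD(2)[OF v]])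
  qed
qed

lemma Lp_mass_pos_iff:
  fixes u :: "'a::euclidean_space \<Rightarrow> real"
  assumes "u \<in> W1p p"
  shows "Lp_mass p u > 0 \<longleftrightarrow> \<not> (AE x in lebesgue. u x = 0)"
proof -
  have "integrable lebesgue (\<lambda>x. \<bar>u x\<bar> powr p)" using assms by (simp add: W1p_def in_Lp_def)
  from integral_nonneg_eq_0_iff_AE[OF this] have "Lp_mass p u = 0 \<longleftrightarrow> (AE x in lebesgue. u x = 0)" by simp
  then show ?thesis using Lp_mass_nonneg[of u p] by (metis order_le_imp_less_or_eq less_irrefl)
qed

text \<open>
  A function that is stretched to infinite length about \<open>x\<^sub>0\<close> is seen by \<open>V\<close> as the constant \<open>v x\<^sub>0\<close>.
\<close>

lemma potential_term_spreading_limit: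
  fixes V :: "'a::euclidean_space \<Rightarrow> real"
  assumes p: "p > 0" and V: "integrable lebesgue V" and v: "continuous_on UNIV v" and K: "\<And>x. \<bar>v x\<bar> \<le> K"
    and c: "(c \<longlongrightarrow> 0) (at_right (0::real))"
  shows "((\<lambda>\<alpha>. LINT x|lebesgue. V x * \<bar>v (x\<^sub>0 + c \<alpha> *\<^sub>R x)\<bar> powr p) \<longlongrightarrow> (LINT x|lebesgue. V x) * \<bar>v x\<^sub>0\<bar> powr p) (at_right 0)"
  unfolding tendsto_at_iff_sequentially comp_def
proof (intro allI impI)
  fix X :: "nat \<Rightarrow> real" assume X: "\<forall>i. X i \<in> {0<..} - {0}" "X \<longlonglongrightarrow> 0"
  have cX: "(\<lambda>n. c (X n)) \<longlonglongrightarrow> 0"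
    using c X unfolding tendsto_at_iff_sequentially comp_def by blast
  have vm: "v \<in> borel_measurable borel" using borel_measurable_continuous_onI[OF v] .
  have "(\<lambda>n. LINT x|lebesgue. V x * \<bar>v (x\<^sub>0 + c (X n) *\<^sub>R x)\<bar> powr p) \<longlonglongrightarrow> (LINT x|lebesgue. V x * \<bar>v x\<^sub>0\<bar> powr p)"
  proof (rule integral_dominated_convergence)
    show "integrable lebesgue (\<lambda>x. norm (K powr p * V x))" using V by simp
    show "(\<lambda>x. V x * \<bar>v x\<^sub>0\<bar> powr p) \<in> borel_measurable lebesgue" using V by measurable
    show "(\<lambda>x. V x * \<bar>v (x\<^sub>0 + c (X n) *\<^sub>R x)\<bar> powr p) \<in> borel_measurable lebesgue" for n
    proof -
      have "continuous_on UNIV (\<lambda>x. v (x\<^sub>0 + c (X n) *\<^sub>R x))"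
        by (intro continuous_on_compose2[OF v] continuous_intros) auto
      then have "(\<lambda>x. v (x\<^sub>0 + c (X n) *\<^sub>R x)) \<in> borel_measurable lebesgue"
        by (intro measurable_completion) (simp add: borel_measurable_continuous_onI)
      then show ?thesis using V by measurable
    qed
    show "AE x in lebesgue. (\<lambda>n. V x * \<bar>v (x\<^sub>0 + c (X n) *\<^sub>R x)\<bar> powr p) \<longlonglongrightarrow> V x * \<bar>v x\<^sub>0\<bar> powr p"
    proof (intro always_eventually allI tendsto_mult tendsto_const)
      fix x
      have "(\<lambda>n. x\<^sub>0 + c (X n) *\<^sub>R x) \<longlonglongrightarrow> x\<^sub>0 + 0 *\<^sub>R x" by (intro tendsto_intros cX)
      then have "(\<lambda>n. x\<^sub>0 + c (X n) *\<^sub>R x) \<longlonglongrightarrow> x\<^sub>0" by simp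
      moreover have "isCont v x\<^sub>0" using v by (simp add: continuous_on_eq_continuous_at)
      ultimately have "(\<lambda>n. v (x\<^sub>0 + c (X n) *\<^sub>R x)) \<longlonglongrightarrow> v x\<^sub>0" by (rule isCont_tendsto_compose[rotated])
      then show "(\<lambda>n. \<bar>v (x\<^sub>0 + c (X n) *\<^sub>R x)\<bar> powr p) \<longlonglongrightarrow> \<bar>v x\<^sub>0\<bar> powr p"
        using p by (intro tendsto_powr' tendsto_rabs tendsto_const) auto
    qed
    show "AE x in lebesgue. norm (V x * \<bar>v (x\<^sub>0 + c (X n) *\<^sub>R x)\<bar> powr p) \<le> norm (K powr p * V x)" for n
    proof (intro always_eventually allI)
      fix x
      have "\<bar>v (x\<^sub>0 + c (X n) *\<^sub>R x)\<bar> powr p \<le> K powr p" using K p by (intro powr_mono2) auto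
      then show "norm (V x * \<bar>v (x\<^sub>0 + c (X n) *\<^sub>R x)\<bar> powr p) \<le> norm (K powr p * V x)"
        by (simp add: abs_mult mult.commute mult_left_mono)
    qed
  qed
  then show "(\<lambda>n. LINT x|lebesgue. V x * \<bar>v (x\<^sub>0 + c (X n) *\<^sub>R x)\<bar> powr p) \<longlonglongrightarrow> (LINT x|lebesgue. V x) * \<bar>v x\<^sub>0\<bar> powr p"
    by simp
qed

abbreviation rayleigh_quotient :: "real \<Rightarrow> ('a::euclidean_space \<Rightarrow> real) \<Rightarrow> ('a \<Rightarrow> real) \<Rightarrow> real" where
  "rayleigh_quotient p V u \<equiv> Q_form p V u / Lp_mass p u"

abbreviation rayleigh_quotients :: "real \<Rightarrow> ('a::euclidean_space \<Rightarrow> real) \<Rightarrow> real set" where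
  "rayleigh_quotients p V \<equiv> {rayleigh_quotient p V u | u. u \<in> W1p p \<and> \<not> (AE x in lebesgue. u x = 0)}"

text \<open>
  The negative of the minimum of \<open>t - t^\<theta>\<close> over \<open>t > 0\<close>.
\<close>

definition optimal_value :: "real \<Rightarrow> real" where
  "optimal_value \<theta> = (1 - \<theta>) * \<theta> powr (\<theta> / (1 - \<theta>))"

lemma interpolation_quotient:
  fixes A B \<theta> :: real
  assumes "A \<ge> 0" "B > 0"
  shows "A powr \<theta> * B powr (1 - \<theta>) / B = (A / B) powr \<theta>"
  using assms by (simp add: powr_diff powr_divide)

text \<open>
  With \<open>t\<close> the ratio of the energies, the Rayleigh quotient is at least \<open>(1 - \<alpha>K) t - \<alpha> J t^\<theta>\<close>, where
  \<open>J = S (I + e)\<close>.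
\<close>

lemma rayleigh_quotient_lower_bound:
  fixes V :: "'a::euclidean_space \<Rightarrow> real"
  assumes p: "p > real DIM('a)" and V: "integrable lebesgue V" and I: "(LINT x|lebesgue. V x) \<ge> 0" and e: "e > 0"
  defines "\<theta> \<equiv> real DIM('a) / p"
  shows "\<exists>K\<ge>0. \<forall>\<alpha> u. 0 < \<alpha> \<longrightarrow> \<alpha> * K < 1 \<longrightarrow> u \<in> W1p p \<longrightarrow> \<not> (AE x in lebesgue. u x = 0) \<longrightarrow>
      - (optimal_value \<theta> * (\<alpha> * (sobolev_const TYPE('a) p * ((LINT x|lebesgue. V x) + e))) powr (1 / (1 - \<theta>))
          * (1 - \<alpha> * K) powr - (\<theta> / (1 - \<theta>)))
      \<le> rayleigh_quotient p (\<lambda>x. \<alpha> * V x) u"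
proof -
  have p0: "p > 0" using p DIM_positive[where 'a='a] by linarith
  have \<theta>: "0 < \<theta>" "\<theta> < 1" using p p0 by (auto simp: \<theta>_def)
  define S where "S = sobolev_const TYPE('a) p"
  have S: "S > 0" unfolding S_def by (rule sobolev_const_attained_pos(2)[OF p])
  define J where "J = S * ((LINT x|lebesgue. V x) + e)"
  have J: "J > 0" using S I e by (simp add: J_def)
  obtain K where K: "K \<ge> 0"
    "\<And>u v. u \<in> W1p p \<Longrightarrow> continuous_version u v \<Longrightarrow>
      (LINT x|lebesgue. V x * \<bar>v x\<bar> powr p)
        \<le> ((LINT x|lebesgue. V x) + e) * (S * interpolation_product p u) + K * gradient_energy p u"
    using potential_term_upper_bound[OF p V I e] unfolding S_def by blast
  show ?thesis
  proof (intro exI[of _ K] conjI allI impI K(1))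
    fix \<alpha> :: real and u :: "'a \<Rightarrow> real"
    assume \<alpha>: "0 < \<alpha>" "\<alpha> * K < 1" and u: "u \<in> W1p p" and u0: "\<not> (AE x in lebesgue. u x = 0)"
    obtain v where v: "continuous_version u v" by (rule exists_continuous_version[OF p u])
    define A where "A = gradient_energy p u"
    define B where "B = Lp_mass p u"
    have A: "A \<ge> 0" unfolding A_def by (rule gradient_energy_nonneg)
    have B: "B > 0" unfolding B_def using Lp_mass_pos_iff[OF u] u0 by blast
    have "\<alpha> * (LINT x|lebesgue. V x * \<bar>v x\<bar> powr p) \<le> \<alpha> * (J * (A powr \<theta> * B powr (1 - \<theta>)) + K * A)"
      using K(2)[OF u v] \<alpha> by (intro mult_left_mono) (auto simp: interpolation_product_def A_def B_def \<theta>_def J_def mult_ac)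
    then have "(1 - \<alpha> * K) * A - \<alpha> * J * (A powr \<theta> * B powr (1 - \<theta>)) \<le> Q_form p (\<lambda>x. \<alpha> * V x) u"
      unfolding Q_form_continuous_version[OF p V u v] A_def[symmetric] by (simp add: algebra_simps)
    then have "((1 - \<alpha> * K) * A - \<alpha> * J * (A powr \<theta> * B powr (1 - \<theta>))) / B \<le> rayleigh_quotient p (\<lambda>x. \<alpha> * V x) u"
      using B by (simp add: B_def divide_right_mono)
    moreover have "((1 - \<alpha> * K) * A - \<alpha> * J * (A powr \<theta> * B powr (1 - \<theta>))) / B
        = (1 - \<alpha> * K) * (A / B) - \<alpha> * J * (A / B) powr \<theta>"
      unfolding interpolation_quotient[OF A B, symmetric] by (simp add: diff_divide_distrib)
    moreover have "- ((1 - \<theta>) * \<theta> powr (\<theta> / (1 - \<theta>)) * (\<alpha> * J) powr (1 / (1 - \<theta>)) * (1 - \<alpha> * K) powr - (\<theta> / (1 - \<theta>)))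
        \<le> (1 - \<alpha> * K) * (A / B) - \<alpha> * J * (A / B) powr \<theta>"
      by (rule linear_minus_power_ge[OF \<theta>]) (use \<alpha> J A B in auto)
    ultimately show "- (optimal_value \<theta> * (\<alpha> * (sobolev_const TYPE('a) p * ((LINT x|lebesgue. V x) + e))) powr (1 / (1 - \<theta>))
          * (1 - \<alpha> * K) powr - (\<theta> / (1 - \<theta>)))
      \<le> rayleigh_quotient p (\<lambda>x. \<alpha> * V x) u"
      unfolding optimal_value_def J_def S_def by linarith
  qed
qed

lemma rayleigh_quotient_bdd_below:
  fixes V :: "'a::euclidean_space \<Rightarrow> real"
  assumes p: "p > real DIM('a)" and V: "integrable lebesgue V" and I: "(LINT x|lebesgue. V x) \<ge> 0"
  shows "\<forall>\<^sub>F \<alpha> in at_right 0. bdd_below (rayleigh_quotients p (\<lambda>x. \<alpha> * V x))"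
proof -
  let ?low = "\<lambda>\<alpha> K. - (optimal_value (real DIM('a) / p) * (\<alpha> * (sobolev_const TYPE('a) p * ((LINT x|lebesgue. V x) + 1))) powr (1 / (1 - real DIM('a) / p))
          * (1 - \<alpha> * K) powr - (real DIM('a) / p / (1 - real DIM('a) / p)))"
  obtain K where K: "K \<ge> 0"
    "\<And>\<alpha> u. 0 < \<alpha> \<Longrightarrow> \<alpha> * K < 1 \<Longrightarrow> u \<in> W1p p \<Longrightarrow> \<not> (AE x in lebesgue. u x = 0) \<Longrightarrow>
      ?low \<alpha> K
      \<le> rayleigh_quotient p (\<lambda>x. \<alpha> * V x) u"
    using rayleigh_quotient_lower_bound[OF p V I zero_less_one] by blast
  have "((\<lambda>\<alpha>. \<alpha> * K) \<longlongrightarrow> 0 * K) (at_right 0)" by (intro tendsto_intros)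
  then have "\<forall>\<^sub>F \<alpha> in at_right 0. \<alpha> * K < 1" by (intro order_tendstoD(2)) auto
  then show ?thesis
    using eventually_at_right_less[of 0]
  proof eventually_elim
    case (elim \<alpha>)
    show ?case
    proof (rule bdd_belowI)
      fix q assume "q \<in> rayleigh_quotients p (\<lambda>x. \<alpha> * V x)"
      then obtain u where q: "q = rayleigh_quotient p (\<lambda>x. \<alpha> * V x) u" "u \<in> W1p p" "\<not> (AE x in lebesgue. u x = 0)"
        by blast
      show "?low \<alpha> K \<le> q"
        unfolding q(1) by (rule K(2)[OF elim(2,1) q(2,3)])
    qed
  qed
qed

lemma W1p_nontrivial:
  assumes p: "p > real DIM('a)"
  obtains u :: "'a::euclidean_space \<Rightarrow> real" where "u \<in> W1p p" "\<not> (AE x in lebesgue. u x = 0)"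
proof -
  have S: "sobolev_const TYPE('a) p > 0" by (rule sobolev_const_attained_pos(2)[OF p])
  obtain u v :: "'a \<Rightarrow> real" and x\<^sub>0 where u: "u \<in> W1p p" "Lp_mass p u > 0"
    using near_optimal_function[OF p, of "sobolev_const TYPE('a) p / 2"] S by auto
  then have "\<not> (AE x in lebesgue. u x = 0)" using Lp_mass_pos_iff by blast
  with u(1) show ?thesis by (rule that)
qed

text \<open>
  The power of \<open>\<alpha>\<close> cancels in the bound of \<open>rayleigh_quotient_lower_bound\<close>. First \<open>e\<close> is fixed so small that the
  limit of the bound as \<open>\<alpha>\<close> tends to 0 still exceeds \<open>y\<close>, then \<open>\<alpha>\<close> tends to 0.
\<close>

lemma lambda_liminf:
  fixes V :: "'a::euclidean_space \<Rightarrow> real"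
  assumes p: "p > real DIM('a)" and V: "integrable lebesgue V" and I: "(LINT x|lebesgue. V x) > 0"
  defines "\<theta> \<equiv> real DIM('a) / p"
  assumes y: "y < - (optimal_value \<theta> * (sobolev_const TYPE('a) p * (LINT x|lebesgue. V x)) powr (1 / (1 - \<theta>)))"
  shows "\<forall>\<^sub>F \<alpha> in at_right 0. y < \<alpha> powr - (1 / (1 - \<theta>)) * lambda_inf p (\<lambda>x. \<alpha> * V x)"
proof -
  define S where "S = sobolev_const TYPE('a) p"
  have S: "S > 0" unfolding S_def by (rule sobolev_const_attained_pos(2)[OF p])
  let ?I = "LINT x|lebesgue. V x"
  have "((\<lambda>e. - (optimal_value \<theta> * (S * (?I + e)) powr (1 / (1 - \<theta>)))) \<longlongrightarrow>
      - (optimal_value \<theta> * (S * (?I + 0)) powr (1 / (1 - \<theta>)))) (at_right 0)"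
    using S I by (intro tendsto_intros) auto
  then have "\<forall>\<^sub>F e in at_right 0. y < - (optimal_value \<theta> * (S * (?I + e)) powr (1 / (1 - \<theta>)))"
    using y by (intro order_tendstoD(1)) (auto simp: S_def)
  then have "\<forall>\<^sub>F e in at_right 0. 0 < e \<and> y < - (optimal_value \<theta> * (S * (?I + e)) powr (1 / (1 - \<theta>)))"
    using eventually_at_right_less[of 0] by eventually_elim simp
  then obtain e where e: "e > 0" "y < - (optimal_value \<theta> * (S * (?I + e)) powr (1 / (1 - \<theta>)))"
    using eventually_happens'[OF trivial_limit_at_right_real] by blast
  define J where "J = S * (?I + e)"
  have J: "J > 0" using S I e by (simp add: J_def)
  let ?low = "\<lambda>\<alpha> K. - (optimal_value \<theta> * (\<alpha> * J) powr (1 / (1 - \<theta>)) * (1 - \<alpha> * K) powr - (\<theta> / (1 - \<theta>)))"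
  obtain K where K: "K \<ge> 0"
    "\<And>\<alpha> u. 0 < \<alpha> \<Longrightarrow> \<alpha> * K < 1 \<Longrightarrow> u \<in> W1p p \<Longrightarrow> \<not> (AE x in lebesgue. u x = 0) \<Longrightarrow>
      ?low \<alpha> K
      \<le> rayleigh_quotient p (\<lambda>x. \<alpha> * V x) u"
    using rayleigh_quotient_lower_bound[OF p V less_imp_le[OF I] e(1)]
    unfolding J_def S_def \<theta>_def by blast
  have "((\<lambda>\<alpha>. \<alpha> * K) \<longlongrightarrow> 0 * K) (at_right 0)" by (intro tendsto_intros)
  then have small: "\<forall>\<^sub>F \<alpha> in at_right 0. \<alpha> * K < 1" by (intro order_tendstoD(2)) auto
  have "((\<lambda>\<alpha>. - (optimal_value \<theta> * J powr (1 / (1 - \<theta>)) * (1 - \<alpha> * K) powr - (\<theta> / (1 - \<theta>)))) \<longlongrightarrow>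
      - (optimal_value \<theta> * J powr (1 / (1 - \<theta>)) * (1 - 0 * K) powr - (\<theta> / (1 - \<theta>)))) (at_right 0)"
    by (intro tendsto_intros) auto
  then have "\<forall>\<^sub>F \<alpha> in at_right 0. y < - (optimal_value \<theta> * J powr (1 / (1 - \<theta>)) * (1 - \<alpha> * K) powr - (\<theta> / (1 - \<theta>)))"
    using e(2) by (intro order_tendstoD(1)) (auto simp: J_def)
  then show ?thesis
    using small eventually_at_right_less[of 0]
  proof eventually_elim
    case (elim \<alpha>)
    obtain u\<^sub>0 :: "'a \<Rightarrow> real" where u0: "u\<^sub>0 \<in> W1p p" "\<not> (AE x in lebesgue. u\<^sub>0 x = 0)" by (rule W1p_nontrivial[OF p])
    have "?low \<alpha> K
        \<le> lambda_inf p (\<lambda>x. \<alpha> * V x)"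
      unfolding lambda_inf_def
    proof (rule cInf_greatest)
      show "rayleigh_quotients p (\<lambda>x. \<alpha> * V x) \<noteq> {}"
        using u0 by blast
      fix q assume "q \<in> rayleigh_quotients p (\<lambda>x. \<alpha> * V x)"
      then obtain u where q: "q = rayleigh_quotient p (\<lambda>x. \<alpha> * V x) u" "u \<in> W1p p" "\<not> (AE x in lebesgue. u x = 0)"
        by blast
      show "?low \<alpha> K \<le> q"
        unfolding q(1) by (rule K(2)[OF elim(3,2) q(2,3)])
    qed
    then have "\<alpha> powr - (1 / (1 - \<theta>)) * ?low \<alpha> K
        \<le> \<alpha> powr - (1 / (1 - \<theta>)) * lambda_inf p (\<lambda>x. \<alpha> * V x)"
      by (intro mult_left_mono) auto
    moreover have cancel: "\<alpha> powr - (1 / (1 - \<theta>)) * (\<alpha> * J) powr (1 / (1 - \<theta>)) = J powr (1 / (1 - \<theta>))"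
      using elim(3) J by (simp add: powr_mult powr_minus field_simps)
    moreover have "\<alpha> powr - (1 / (1 - \<theta>)) * ?low \<alpha> K
        = - (optimal_value \<theta> * J powr (1 / (1 - \<theta>)) * (1 - \<alpha> * K) powr - (\<theta> / (1 - \<theta>)))"
      unfolding cancel[symmetric] by (simp only: mult_minus_right mult_ac)
    ultimately show ?case using elim(1) by linarith
  qed
qed

text \<open>
  The trial functions are \<open>u(x\<^sub>0 + c x)\<close>, where \<open>u\<close> is almost optimal in the Sobolev inequality with its near maximum at
  \<open>x\<^sub>0\<close>, and \<open>c = \<sigma> \<alpha>^(1/(p-d))\<close>. This power makes kinetic and potential energy scale alike, by
  \<open>\<alpha>^(p/(p-d))\<close>, and \<open>\<sigma>\<close> is adjusted so that the ratio of the energies minimises \<open>t - \<kappa> t^\<theta>\<close>.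
\<close>

lemma lambda_limsup:
  fixes V :: "'a::euclidean_space \<Rightarrow> real"
  assumes p: "p > real DIM('a)" and V: "integrable lebesgue V" and I: "(LINT x|lebesgue. V x) > 0"
  defines "\<theta> \<equiv> real DIM('a) / p"
  assumes y: "- (optimal_value \<theta> * (sobolev_const TYPE('a) p * (LINT x|lebesgue. V x)) powr (1 / (1 - \<theta>))) < y"
  shows "\<forall>\<^sub>F \<alpha> in at_right 0. \<alpha> powr - (1 / (1 - \<theta>)) * lambda_inf p (\<lambda>x. \<alpha> * V x) < y"
proof -
  let ?d = "real DIM('a)"
  have p0: "p > 0" using p DIM_positive[where 'a='a] by linarith
  have \<theta>: "0 < \<theta>" "\<theta> < 1" using p p0 by (auto simp: \<theta>_def)
  have lc: "optimal_value \<theta> > 0" using \<theta> by (simp add: optimal_value_def)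
  define S where "S = sobolev_const TYPE('a) p"
  have S: "S > 0" unfolding S_def by (rule sobolev_const_attained_pos(2)[OF p])
  let ?I = "LINT x|lebesgue. V x"
  have "((\<lambda>c. - (optimal_value \<theta> * (c * ?I) powr (1 / (1 - \<theta>)))) \<longlongrightarrow>
      - (optimal_value \<theta> * (S * ?I) powr (1 / (1 - \<theta>)))) (at_left S)"
    using S I by (intro tendsto_intros) auto
  then have "\<forall>\<^sub>F c in at_left S. - (optimal_value \<theta> * (c * ?I) powr (1 / (1 - \<theta>))) < y"
    using y by (intro order_tendstoD(2)) (auto simp: S_def)
  moreover have "\<forall>\<^sub>F c in at_left S. 0 < c \<and> c < S"
    using eventually_at_left_real[OF S] by eventually_elim auto
  ultimately have "\<forall>\<^sub>F c in at_left S. 0 < c \<and> c < S \<and> - (optimal_value \<theta> * (c * ?I) powr (1 / (1 - \<theta>))) < y"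
    by eventually_elim simp
  then obtain C where C: "0 < C" "C < S" "- (optimal_value \<theta> * (C * ?I) powr (1 / (1 - \<theta>))) < y"
    using eventually_happens'[OF trivial_limit_at_left_real] by blast
  obtain u v :: "'a \<Rightarrow> real" and x\<^sub>0 where u: "u \<in> W1p p" and v: "continuous_version u v"
    and pos: "gradient_energy p u > 0" "Lp_mass p u > 0" and x0: "C * interpolation_product p u < \<bar>v x\<^sub>0\<bar> powr p"
    using near_optimal_function[OF p C(1) C(2)[unfolded S_def]] .
  define A where "A = gradient_energy p u"
  define B where "B = Lp_mass p u"
  define X where "X = interpolation_product p u"
  define m where "m = \<bar>v x\<^sub>0\<bar> powr p"
  have AB: "A > 0" "B > 0" using pos by (simp_all add: A_def B_def)
  have X: "X = A powr \<theta> * B powr (1 - \<theta>)" by (simp add: X_def interpolation_product_def A_def B_def \<theta>_def)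
  have Xpos: "X > 0" using AB by (simp add: X)
  define \<kappa> where "\<kappa> = ?I * m / X"
  have \<kappa>: "C * ?I < \<kappa>" using x0 I Xpos by (simp add: \<kappa>_def m_def X_def pos_less_divide_eq mult_ac)
  have "0 < C * ?I" using C(1) I by simp
  then have \<kappa>pos: "\<kappa> > 0" using \<kappa> by linarith
  obtain r where r: "r > 0" "r - \<kappa> * r powr \<theta> = - (optimal_value \<theta> * \<kappa> powr (1 / (1 - \<theta>)))"
    using linear_minus_power_attained[OF \<theta> \<kappa>pos] unfolding optimal_value_def by metis
  have "(C * ?I) powr (1 / (1 - \<theta>)) \<le> \<kappa> powr (1 / (1 - \<theta>))"
    using \<kappa> C(1) I \<theta> by (intro powr_mono2) auto
  then have ry: "r - \<kappa> * r powr \<theta> < y"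
    unfolding r(2) using C(3) lc by (smt (verit) mult_left_mono)
  \<comment> \<open>Dilation by the inverse length \<open>c\<close> multiplies the ratio \<open>A / B\<close> by \<open>c^p\<close>; \<open>\<sigma>\<close> is chosen to turn this ratio into the minimiser \<open>r\<close>, up to the power of \<open>\<alpha>\<close>.\<close>
  define \<sigma> where "\<sigma> = (r * B / A) powr (1 / p)"
  have \<sigma>: "\<sigma> > 0" using r AB by (simp add: \<sigma>_def)
  have \<sigma>p: "\<sigma> powr p = r * B / A" using r AB p0 by (simp add: \<sigma>_def powr_powr)
  have \<sigma>d: "\<sigma> ^ DIM('a) = (r * B / A) powr \<theta>"
    using \<sigma> by (simp add: powr_realpow[symmetric]) (simp add: \<sigma>_def powr_powr \<theta>_def)
  define c where "c \<alpha> = \<sigma> * \<alpha> powr (1 / (p - ?d))" for \<alpha>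
  have clim: "(c \<longlongrightarrow> 0) (at_right 0)"
  proof -
    have "((\<lambda>\<alpha>::real. \<sigma> * \<alpha> powr (1 / (p - ?d))) \<longlongrightarrow> \<sigma> * 0 powr (1 / (p - ?d))) (at_right 0)"
      using p by (intro tendsto_mult tendsto_const tendsto_powr' tendsto_ident_at) (auto simp: eventually_at_filter)
    then show ?thesis by (simp add: c_def[abs_def])
  qed
  obtain K where K: "\<And>x. \<bar>v x\<bar> \<le> K" using continuous_version_bounded[OF p u v] by metis
  define J where "J \<alpha> = (LINT x|lebesgue. V x * \<bar>v (x\<^sub>0 + c \<alpha> *\<^sub>R x)\<bar> powr p)" for \<alpha>
  have Jlim: "(J \<longlongrightarrow> ?I * m) (at_right 0)"
    unfolding J_def m_def
    by (rule potential_term_spreading_limit[OF p0 V continuous_versionD(1)[OF v] K clim])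
  have "((\<lambda>\<alpha>. (\<sigma> powr p * A - \<sigma> ^ DIM('a) * J \<alpha>) / B) \<longlongrightarrow> (\<sigma> powr p * A - \<sigma> ^ DIM('a) * (?I * m)) / B) (at_right 0)"
    using AB by (intro tendsto_intros Jlim) auto
  moreover have "(\<sigma> powr p * A - \<sigma> ^ DIM('a) * (?I * m)) / B = r - \<kappa> * r powr \<theta>"
  proof -
    have "?I * m = \<kappa> * X" using Xpos by (simp add: \<kappa>_def)
    then have "\<sigma> ^ DIM('a) * (?I * m) / B = \<kappa> * (\<sigma> ^ DIM('a) * (A powr \<theta> * B powr (1 - \<theta>) / B))"
      by (simp add: X)
    also have "A powr \<theta> * B powr (1 - \<theta>) / B = (A / B) powr \<theta>" using AB by (intro interpolation_quotient) auto
    also have "\<sigma> ^ DIM('a) * (A / B) powr \<theta> = r powr \<theta>"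
      unfolding \<sigma>d using r AB by (subst powr_mult[symmetric]) auto
    finally show ?thesis using AB by (simp add: diff_divide_distrib \<sigma>p)
  qed
  ultimately have "\<forall>\<^sub>F \<alpha> in at_right 0. (\<sigma> powr p * A - \<sigma> ^ DIM('a) * J \<alpha>) / B < y"
    using ry by (intro order_tendstoD(2)) auto
  then show ?thesis
    using rayleigh_quotient_bdd_below[OF p V less_imp_le[OF I]] eventually_at_right_less[of 0]
  proof eventually_elim
    case (elim \<alpha>)
    have c: "c \<alpha> > 0" using \<sigma> elim(3) by (simp add: c_def)
    define w where "w = (\<lambda>x. u (c \<alpha> *\<^sub>R (x - (- (1 / c \<alpha>) *\<^sub>R x\<^sub>0))))"
    note sc = W1p_scaled[OF u c, where a="- (1 / c \<alpha>) *\<^sub>R x\<^sub>0"]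
    have wW: "w \<in> W1p p" unfolding w_def by (rule sc(1))
    have arg: "c \<alpha> *\<^sub>R (x - (- (1 / c \<alpha>) *\<^sub>R x\<^sub>0)) = x\<^sub>0 + c \<alpha> *\<^sub>R x" for x
      using c by (simp add: algebra_simps)
    have wv: "continuous_version w (\<lambda>x. v (x\<^sub>0 + c \<alpha> *\<^sub>R x))" using sc(4)[OF v] unfolding w_def arg .
    have wB: "Lp_mass p w = B / c \<alpha> ^ DIM('a)" unfolding w_def B_def by (rule sc(3))
    have wA: "gradient_energy p w = c \<alpha> powr p / c \<alpha> ^ DIM('a) * A" unfolding w_def A_def by (rule sc(2))
    have w0: "\<not> (AE x in lebesgue. w x = 0)" using Lp_mass_pos_iff[OF wW] wB AB c by simp
    have "lambda_inf p (\<lambda>x. \<alpha> * V x) \<le> rayleigh_quotient p (\<lambda>x. \<alpha> * V x) w"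
      unfolding lambda_inf_def by (rule cInf_lower) (use wW w0 elim(2) in auto)
    also have "\<dots> = (c \<alpha> powr p / c \<alpha> ^ DIM('a) * A - \<alpha> * J \<alpha>) / (B / c \<alpha> ^ DIM('a))"
      unfolding Q_form_continuous_version[OF p V wW wv] wA wB J_def ..
    also have "\<dots> = (c \<alpha> powr p * A - \<alpha> * c \<alpha> ^ DIM('a) * J \<alpha>) / B"
      using c AB by (simp add: field_simps)
    finally have le: "lambda_inf p (\<lambda>x. \<alpha> * V x) \<le> (c \<alpha> powr p * A - \<alpha> * c \<alpha> ^ DIM('a) * J \<alpha>) / B" .
    have e1: "1 / (1 - \<theta>) = p / (p - ?d)" using p p0 by (simp add: \<theta>_def field_simps)
    have cp: "c \<alpha> powr p = \<sigma> powr p * \<alpha> powr (1 / (1 - \<theta>))"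
      using \<sigma> elim(3) by (simp add: c_def powr_mult powr_powr e1)
    have cd: "\<alpha> * c \<alpha> ^ DIM('a) = \<sigma> ^ DIM('a) * \<alpha> powr (1 / (1 - \<theta>))"
    proof -
      have "\<alpha> * c \<alpha> ^ DIM('a) = \<sigma> ^ DIM('a) * (\<alpha> powr 1 * \<alpha> powr (?d / (p - ?d)))"
        using elim(3) by (simp add: c_def power_mult_distrib powr_realpow[symmetric] powr_powr)
      also have "\<alpha> powr 1 * \<alpha> powr (?d / (p - ?d)) = \<alpha> powr (1 / (1 - \<theta>))"
        unfolding powr_add[symmetric] e1 using p by (simp add: field_simps)
      finally show ?thesis .
    qed
    have "\<alpha> powr - (1 / (1 - \<theta>)) * lambda_inf p (\<lambda>x. \<alpha> * V x)
        \<le> \<alpha> powr - (1 / (1 - \<theta>)) * ((c \<alpha> powr p * A - \<alpha> * c \<alpha> ^ DIM('a) * J \<alpha>) / B)"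
      using le by (intro mult_left_mono) auto
    also have "\<dots> = (\<alpha> powr - (1 / (1 - \<theta>)) * \<alpha> powr (1 / (1 - \<theta>))) * ((\<sigma> powr p * A - \<sigma> ^ DIM('a) * J \<alpha>) / B)"
      unfolding cp cd by (simp add: algebra_simps)
    also have "\<dots> = (\<sigma> powr p * A - \<sigma> ^ DIM('a) * J \<alpha>) / B"
      using elim(3) by (simp add: powr_minus)
    finally show ?case using elim(1) by linarith
  qed
qed

theorem theorem2p1:
  fixes V :: "'a::euclidean_space \<Rightarrow> real" and p d :: real
  defines "d \<equiv> real DIM('a)"
  assumes "p > d"
    and "integrable lebesgue V"
    and "(LINT x|lebesgue. V x) > 0"
  shows "((\<lambda>\<alpha>. \<alpha> powr (- (p / (p - d))) * lambda_inf p (\<lambda>x. \<alpha> * V x)) \<longlongrightarrow>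
           - ((p - d) / p) * (d / p) powr (d / (p - d))
             * (sobolev_const TYPE('a) p * (LINT x|lebesgue. V x)) powr (p / (p - d)))
         (at_right 0)"
proof -
  define \<theta> where "\<theta> = real DIM('a) / p"
  have p: "p > real DIM('a)" using assms(2) by (simp add: d_def)
  have p0: "p > 0" using p DIM_positive[where 'a='a] by linarith
  have exponents: "p / (p - d) = 1 / (1 - \<theta>)" "(p - d) / p = 1 - \<theta>" "d / p = \<theta>" "d / (p - d) = \<theta> / (1 - \<theta>)"
    using p p0 by (auto simp: \<theta>_def d_def field_simps)
  have eq: "- ((p - d) / p) * (d / p) powr (d / (p - d)) * (sobolev_const TYPE('a) p * (LINT x|lebesgue. V x)) powr (p / (p - d))
      = - (optimal_value \<theta> * (sobolev_const TYPE('a) p * (LINT x|lebesgue. V x)) powr (1 / (1 - \<theta>)))"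
    unfolding exponents optimal_value_def by (simp only: mult_minus_left)
  show ?thesis
    unfolding eq unfolding exponents(1)
  proof (rule order_tendstoI)
    fix y
    assume "y < - (optimal_value \<theta> * (sobolev_const TYPE('a) p * (LINT x|lebesgue. V x)) powr (1 / (1 - \<theta>)))"
    then show "\<forall>\<^sub>F \<alpha> in at_right 0. y < \<alpha> powr - (1 / (1 - \<theta>)) * lambda_inf p (\<lambda>x. \<alpha> * V x)"
      unfolding \<theta>_def by (rule lambda_liminf[OF p assms(3,4)])
  next
    fix y
    assume "- (optimal_value \<theta> * (sobolev_const TYPE('a) p * (LINT x|lebesgue. V x)) powr (1 / (1 - \<theta>))) < y"
    then show "\<forall>\<^sub>F \<alpha> in at_right 0. \<alpha> powr - (1 / (1 - \<theta>)) * lambda_inf p (\<lambda>x. \<alpha> * V x) < y"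
      unfolding \<theta>_def by (rule lambda_limsup[OF p assms(3,4)])
  qed
qed

end
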